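(* Let $\mathcal{P}$ be a finite classical polar space of type III, of rank $d$ over $\mathbb{F}_q$, and let $B$ be the incidence matrix of hyperbolic classes versus generators of $\mathcal{P}$. Let $\mathcal{L}$ be a set of generators with characteristic vector $\boldsymbol{\chi}$. The following are equivalent: (i) $\boldsymbol{\chi}\in\mathrm{im}(B^t)$; (ii) $\boldsymbol{\chi}\in(\ker B)^{\perp}$; (iii) $\mathcal{L}$ is a Cameron-Liebler set.
   Context: The polar spaces of type III are the parabolic quadric $\mathcal{Q}(2d,q)$ with $d$ odd and the symplectic polar space $\mathcal{W}(2d-1,q)$ with $d$ odd and $q$ even; both are polar spaces of rank $d$ with parameter $e=1$, whose generators are their totally isotropic subspaces of projective dimension $d-1$; disjoint means trivial intersection. A hyperbolic class of $\mathcal{Q}(2d,q)$ is the set of generators of one of the two classes (two generators being in the same class iff their intersection has projective dimension $\equiv d-1\pmod 2$) of a hyperbolic quadric $\mathcal{Q}^{+}(2d-1,q)$ obtained as the intersection of $\mathcal{Q}(2d,q)$ with a hyperplane. For $q$ even, $\mathcal{W}(2d-1,q)$ is obtained from $\mathcal{Q}(2d,q)$ by projecting from its nucleus (the point through which every line is tangent) onto a hyperplane not containing it, and hyperbolic classes of $\mathcal{W}(2d-1,q)$ are the images of those of $\mathcal{Q}(2d,q)$. A set $\mathcal{L}$ of generators is a Cameron-Liebler set (with parameter $x=|\mathcal{L}|/\prod_{i=0}^{d-2}(q^{1+i}+1)$) if every generator $\pi$ is disjoint from exactly $(x-\chi_\pi)q^{\binom{d-1}{2}+(d-1)}$ elements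 of $\mathcal{L}$, where $\chi_\pi=1$ if $\pi\in\mathcal{L}$ and $0$ otherwise. *)

theory Defs
  imports "HOL-Analysis.Analysis" "HOL-Number_Theory.Cong"
begin

section \<open>Quadratic and symplectic forms over a finite field\<close>

text \<open>The field is a finite type \<open>'a\<close>, so $q$ is \<open>CARD('a)\<close>. All dimensions below are vector
  space dimensions, one more than the projective ones.\<close>

definition bilinear_form :: "('a::field^'n::finite \<Rightarrow> 'a^'n \<Rightarrow> 'a) \<Rightarrow> bool" where
  "bilinear_form f \<longleftrightarrow>
     (\<forall>u. Vector_Spaces.linear (*s) (*) (\<lambda>v. f u v)) \<and>
     (\<forall>v. Vector_Spaces.linear (*s) (*) (\<lambda>u. f u v))"

definition polar_form :: "('a::field^'n::finite \<Rightarrow> 'a) \<Rightarrow> 'a^'n \<Rightarrow> 'a^'n \<Rightarrow> 'a" where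
  "polar_form Q u v = Q (u + v) - Q u - Q v"

definition quadratic_form :: "('a::field^'n::finite \<Rightarrow> 'a) \<Rightarrow> bool" where
  "quadratic_form Q \<longleftrightarrow> (\<forall>c v. Q (c *s v) = c\<^sup>2 * Q v) \<and> bilinear_form (polar_form Q)"

text \<open>The condition \<open>Q v = 0\<close> matters in characteristic 2: there a nonsingular form in odd
  dimension has a polar form with a one-dimensional radical.\<close>

definition nonsingular_on :: "('a::field^'n::finite) set \<Rightarrow> ('a^'n \<Rightarrow> 'a) \<Rightarrow> bool" where
  "nonsingular_on U Q \<longleftrightarrow>
     (\<forall>v\<in>U. Q v = 0 \<and> (\<forall>w\<in>U. polar_form Q v w = 0) \<longrightarrow> v = 0)"

definition symplectic_form :: "('a::field^'n::finite \<Rightarrow> 'a^'n \<Rightarrow> 'a) \<Rightarrow> bool" where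
  "symplectic_form f \<longleftrightarrow> bilinear_form f \<and> (\<forall>v. f v v = 0) \<and>
     (\<forall>v. (\<forall>w. f v w = 0) \<longrightarrow> v = 0)"

section \<open>Parabolic quadrics\<close>

text \<open>Every nonsingular quadratic form on $\mathbb{F}_q^{2d+1}$ defines a quadric projectively
  equivalent to $\mathcal{Q}(2d,q)$.\<close>

definition parabolic :: "nat \<Rightarrow> ('a::field^'n::finite \<Rightarrow> 'a) \<Rightarrow> bool" where
  "parabolic d Q \<longleftrightarrow> CARD('n) = 2 * d + 1 \<and> quadratic_form Q \<and> nonsingular_on UNIV Q"

definition quadric_subspaces :: "nat \<Rightarrow> ('a::field^'n::finite \<Rightarrow> 'a) \<Rightarrow> ('a^'n) set set" where
  "quadric_subspaces k Q = {\<pi>. vec.subspace \<pi> \<and> vec.dim \<pi> = k \<and> (\<forall>v\<in>\<pi>. Q v = 0)}"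

text \<open>\<open>H\<close> is a hyperplane meeting the quadric in a $\mathcal{Q}^+(2d-1,q)$: a nonsingular
  quadric of maximal Witt index $d$.\<close>

definition hyperbolic_hyperplane ::
  "nat \<Rightarrow> ('a::field^'n::finite \<Rightarrow> 'a) \<Rightarrow> ('a^'n) set \<Rightarrow> bool" where
  "hyperbolic_hyperplane d Q H \<longleftrightarrow>
     vec.subspace H \<and> vec.dim H = 2 * d \<and> nonsingular_on H Q \<and>
     (\<exists>\<pi>\<in>quadric_subspaces d Q. \<pi> \<subseteq> H)"

definition same_class :: "nat \<Rightarrow> (('a::field^'n::finite) set \<times> ('a^'n) set) set" where
  "same_class d = {(\<pi>, \<tau>). [int (vec.dim (\<pi> \<inter> \<tau>)) - 1 = int d - 1] (mod 2)}"

text \<open>Intersecting with \<open>S\<close> cuts the class of a generator down to the generators inside \<open>H\<close>,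
  where \<open>same_class d\<close> is an equivalence relation with two classes.\<close>

definition quadric_hyperbolic_classes ::
  "nat \<Rightarrow> ('a::field^'n::finite \<Rightarrow> 'a) \<Rightarrow> ('a^'n) set set set" where
  "quadric_hyperbolic_classes d Q =
     (\<Union>H\<in>{H. hyperbolic_hyperplane d Q H}.
        let S = {\<pi> \<in> quadric_subspaces d Q. \<pi> \<subseteq> H} in S // (same_class d \<inter> S \<times> S))"

section \<open>Symplectic polar spaces in even characteristic\<close>

definition isotropic_subspaces ::
  "nat \<Rightarrow> ('a::field^'n::finite \<Rightarrow> 'a^'n \<Rightarrow> 'a) \<Rightarrow> ('a^'n) set set" where
  "isotropic_subspaces k f =
     {\<pi>. vec.subspace \<pi> \<and> vec.dim \<pi> = k \<and> (\<forall>u\<in>\<pi>. \<forall>v\<in>\<pi>. f u v = 0)}"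

definition tangent_line :: "('a::field^'n::finite \<Rightarrow> 'a) \<Rightarrow> ('a^'n) set \<Rightarrow> bool" where
  "tangent_line Q l \<longleftrightarrow> vec.subspace l \<and> vec.dim l = 2 \<and> (\<exists>!p. p \<in> quadric_subspaces 1 Q \<and> p \<subseteq> l)"

definition is_nucleus :: "('a::field^'n::finite \<Rightarrow> 'a) \<Rightarrow> ('a^'n) set \<Rightarrow> bool" where
  "is_nucleus Q N \<longleftrightarrow> vec.subspace N \<and> vec.dim N = 1 \<and>
     (\<forall>l. vec.subspace l \<and> vec.dim l = 2 \<and> N \<subseteq> l \<longrightarrow> tangent_line Q l)"

text \<open>Projection from the nucleus of the parabolic quadric \<open>Q\<close> onto a hyperplane not containing
  it, the hyperplane being identified with the space \<open>'a^'m\<close> of the symplectic form \<open>f\<close>: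
  up to that identification, such projections are exactly the surjective linear maps whose kernel
  is the nucleus. That the projected polar space is the one of \<open>f\<close> is expressed by \<open>f\<close> pulling
  back to the polar form of \<open>Q\<close>.\<close>

definition nucleus_projection ::
  "('a::field^'n::finite \<Rightarrow> 'a) \<Rightarrow> ('a^'m::finite \<Rightarrow> 'a^'m \<Rightarrow> 'a) \<Rightarrow> ('a^'n \<Rightarrow> 'a^'m) \<Rightarrow> bool" where
  "nucleus_projection Q f p \<longleftrightarrow>
     Vector_Spaces.linear (*s) (*s) p \<and> surj p \<and> is_nucleus Q {v. p v = 0} \<and>
     (\<forall>u v. f (p u) (p v) = polar_form Q u v)"

text \<open>The index type \<open>'m option\<close> has one element more than \<open>'m\<close>. All pairs \<open>(Q, p)\<close> yield
  the same classes.\<close>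

definition symplectic_hyperbolic_classes ::
  "nat \<Rightarrow> ('a::field^'m::finite \<Rightarrow> 'a^'m \<Rightarrow> 'a) \<Rightarrow> ('a^'m) set set set" where
  "symplectic_hyperbolic_classes d f =
     {(\<lambda>\<pi>. p ` \<pi>) ` C | (Q :: 'a^'m option \<Rightarrow> 'a) p C.
        parabolic d Q \<and> nucleus_projection Q f p \<and> C \<in> quadric_hyperbolic_classes d Q}"

section \<open>Polar spaces of type III\<close>

datatype ('a, 'n::finite) polar_space =
    Parabolic "'a^'n \<Rightarrow> 'a"
  | Symplectic "'a^'n \<Rightarrow> 'a^'n \<Rightarrow> 'a"

fun type_III :: "nat \<Rightarrow> ('a::{field,finite}, 'n::finite) polar_space \<Rightarrow> bool" where
  "type_III d (Parabolic Q) \<longleftrightarrow> odd d \<and> parabolic d Q"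
| "type_III d (Symplectic f) \<longleftrightarrow>
     odd d \<and> even CARD('a) \<and> CARD('n) = 2 * d \<and> symplectic_form f"

fun generators :: "nat \<Rightarrow> ('a::field, 'n::finite) polar_space \<Rightarrow> ('a^'n) set set" where
  "generators d (Parabolic Q) = quadric_subspaces d Q"
| "generators d (Symplectic f) = isotropic_subspaces d f"

fun hyperbolic_classes :: "nat \<Rightarrow> ('a::field, 'n::finite) polar_space \<Rightarrow> ('a^'n) set set set" where
  "hyperbolic_classes d (Parabolic Q) = quadric_hyperbolic_classes d Q"
| "hyperbolic_classes d (Symplectic f) = symplectic_hyperbolic_classes d f"

text \<open>The product runs over \<open>i = 0, ..., d - 2\<close> and is empty for \<open>d = 1\<close>.\<close>

definition cameron_liebler ::
  "nat \<Rightarrow> ('a::{field,finite}, 'n::finite) polar_space \<Rightarrow> ('a^'n) set set \<Rightarrow> bool" where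
  "cameron_liebler d P L \<longleftrightarrow> L \<subseteq> generators d P \<and>
     (let q = real CARD('a);
          x = real (card L) / (\<Prod>i<d - 1. (q ^ (1 + i) + 1))
      in \<forall>\<pi>\<in>generators d P.
           real (card {\<tau>\<in>L. \<pi> \<inter> \<tau> = {0}}) =
             (x - indicator L \<pi>) * q ^ (((d - 1) choose 2) + (d - 1)))"

section \<open>Real matrices over finite index sets\<close>

text \<open>A vector of $\mathbb{R}^J$ is an element of \<open>extensional J\<close>; an $I \times J$ matrix is a
  function of two arguments that is used on $I \times J$ only.\<close>

definition mat_vec ::
  "'i set \<Rightarrow> 'j set \<Rightarrow> ('i \<Rightarrow> 'j \<Rightarrow> real) \<Rightarrow> ('j \<Rightarrow> real) \<Rightarrow> ('i \<Rightarrow> real)" where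
  "mat_vec I J M v = (\<lambda>i\<in>I. \<Sum>j\<in>J. M i j * v j)"

definition mat_transpose :: "('i \<Rightarrow> 'j \<Rightarrow> real) \<Rightarrow> 'j \<Rightarrow> 'i \<Rightarrow> real" where
  "mat_transpose M = (\<lambda>j i. M i j)"

definition mat_image :: "'i set \<Rightarrow> 'j set \<Rightarrow> ('i \<Rightarrow> 'j \<Rightarrow> real) \<Rightarrow> ('i \<Rightarrow> real) set" where
  "mat_image I J M = mat_vec I J M ` extensional J"

definition mat_kernel :: "'i set \<Rightarrow> 'j set \<Rightarrow> ('i \<Rightarrow> 'j \<Rightarrow> real) \<Rightarrow> ('j \<Rightarrow> real) set" where
  "mat_kernel I J M = {v \<in> extensional J. mat_vec I J M v = (\<lambda>i\<in>I. 0)}"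

definition orth_complement :: "'j set \<Rightarrow> ('j \<Rightarrow> real) set \<Rightarrow> ('j \<Rightarrow> real) set" where
  "orth_complement J S = {u \<in> extensional J. \<forall>v\<in>S. (\<Sum>j\<in>J. u j * v j) = 0}"

definition incidence_matrix :: "'g set \<Rightarrow> 'g \<Rightarrow> real" where
  "incidence_matrix C \<pi> = (if \<pi> \<in> C then 1 else 0)"

definition char_vec :: "'g set \<Rightarrow> 'g set \<Rightarrow> 'g \<Rightarrow> real" where
  "char_vec G L = (\<lambda>\<pi>\<in>G. indicator L \<pi>)"

end

theory Submission
  imports Defs
begin

text \<open>Let \<open>A\<close> be the disjointness matrix of the generators and \<open>c = q ^ (d choose 2)\<close>. A hyperbolic class \<open>C\<close>
  satisfies \<open>A \<chi>\<^sub>C = c (1 - \<chi>\<^sub>C)\<close>: inside its hyperplane this is the parity rule for intersections of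
  generators, here using that \<open>d\<close> is odd, and a generator \<open>\<pi>\<close> outside the hyperplane \<open>H\<close> can be replaced by
  the generator of the other class through \<open>\<pi> \<inter> H\<close>. So vectors in the row space of \<open>B\<close> are Cameron-Liebler.
  Conversely, split \<open>\<chi>\<close> orthogonally as \<open>t + w\<close> with \<open>t\<close> in the row space and \<open>w\<close> in \<open>ker B\<close>; the
  Cameron-Liebler equation gives \<open>A w = - c w\<close>, and \<open>w = 0\<close> follows without computing the spectrum of \<open>A\<close>.
  Summing over all hyperbolic hyperplanes (through a point) shows that \<open>w\<close> sums to zero over all generators and over
  those through a point; the eigenvalue equation and Moebius inversion extend this to the generators through any
  totally singular subspace of dimension less than \<open>d\<close>; finally the sum over all hyperbolic classes containing
  a generator \<open>\<pi>\<close> is a positive multiple of \<open>w(\<pi>)\<close>. The symplectic case is transported along the projection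
  from the nucleus.\<close>

section \<open>Counting in vector spaces over a finite field\<close>

text \<open>The comparison of powers of q that kills the pencil sums is an equality at dimension 1
  and, for odd \<open>d\<close>, with equal signs also at dimension \<open>d\<close>. These two
  dimensions are where the hyperbolic classes have to do the work: whole hyperplane sections settle
  the points, and the parity condition that separates the two classes of a section settles the
  single generators. Hyperplanes are handled as kernels of linear functionals, \<open>q - 1\<close>
  functionals for each, because in even characteristic the polar form has a radical and not every
  hyperplane is the perp of a vector. The functionals \<open>B r\<close> with \<open>Q r = 0\<close>
  belong to the tangent hyperplanes; a kernel of any other functional that contains a generator is
  hyperbolic. Counting is done with cardinalities and incidences, so most counts are products
  without division. The counts start from a given generator; for a space without generators the
  equivalence holds trivially.\<close>

lemma card_fibers_additive:
  fixes E :: "('a::{field,finite}^'n::finite) set" and g :: "'a^'n \<Rightarrow> 'a"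
  assumes E: "vec.subspace E"
    and add: "\<And>u v. u \<in> E \<Longrightarrow> v \<in> E \<Longrightarrow> g (u + v) = g u + g v"
    and scale: "\<And>c u. u \<in> E \<Longrightarrow> g (c *s u) = c * g u"
    and e: "e \<in> E" "g e \<noteq> 0"
  shows "CARD('a) * card {v \<in> E. g v = t} = card E"
proof -
  have fib: "card {v \<in> E. g v = s} = card {v \<in> E. g v = t}" for s
  proof -
    \<comment> \<open>Scaled so that \<open>g w = s - t\<close>; translation by \<open>w\<close>
      then carries the fibre over \<open>t\<close> onto the fibre over \<open>s\<close>.\<close>
    define w where "w = ((s - t) / g e) *s e"
    have w: "w \<in> E" "g w = s - t"
      using e vec.subspace_scale[OF E] scale by (auto simp: w_def)
    have mw: "- w \<in> E" "g (- w) = t - s"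
      using w vec.subspace_neg[OF E] scale[OF w(1), of "-1"] by auto
    have "bij_betw (\<lambda>v. v + w) {v \<in> E. g v = t} {v \<in> E. g v = s}"
      by (rule bij_betwI[where g = "\<lambda>v. v + (- w)"])
        (use w mw vec.subspace_add[OF E] in \<open>auto simp del: add_uminus_conv_diff simp: add\<close>)
    then show ?thesis
      by (simp add: bij_betw_same_card)
  qed
  have "(\<Sum>s\<in>UNIV. \<Sum>v\<in>{v \<in> E. g v = s}. 1::nat) = (\<Sum>v\<in>E. 1)"
    by (rule sum.group) auto
  then have "card E = (\<Sum>s\<in>UNIV. card {v \<in> E. g v = s})"
    by simp
  also have "\<dots> = (\<Sum>s\<in>(UNIV :: 'a set). card {v \<in> E. g v = t})"
    by (intro sum.cong refl fib)
  also have "\<dots> = CARD('a) * card {v \<in> E. g v = t}"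
    by simp
  finally show ?thesis ..
qed

lemma card_ge_two: "2 \<le> CARD('a::{field,finite})"
proof -
  have "card {0::'a, 1} \<le> CARD('a)"
    by (rule card_mono) auto
  then show ?thesis by simp
qed

text \<open>Equational form of \<open>bilinear_form\<close> in which exchanging the two arguments is
  immediate; the duality count below needs both orders.\<close>

definition bilin :: "('a::field^'n::finite \<Rightarrow> 'a^'n \<Rightarrow> 'a) \<Rightarrow> bool" where
  "bilin f \<longleftrightarrow> (\<forall>u v w. f (u + v) w = f u w + f v w \<and> f w (u + v) = f w u + f w v) \<and>
     (\<forall>c u v. f (c *s u) v = c * f u v \<and> f u (c *s v) = c * f u v)"

lemma linear_vec_D:
  assumes "Vector_Spaces.linear (*s) (*) f"
  shows "f (u + v) = f u + f v" "f (c *s u) = c * f u"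
proof -
  interpret Vector_Spaces.linear "(*s)" "(*)" f by fact
  show "f (u + v) = f u + f v" "f (c *s u) = c * f u"
    by (rule add, rule scale)
qed

lemma bilinear_form_imp_bilin:
  assumes "bilinear_form f"
  shows "bilin f"
proof -
  have l: "Vector_Spaces.linear (*s) (*) (f u)" "Vector_Spaces.linear (*s) (*) (\<lambda>u. f u v)" for u v
    using assms unfolding bilinear_form_def by blast+
  show ?thesis
    unfolding bilin_def
    using linear_vec_D[OF l(1)] linear_vec_D[OF l(2)] by blast
qed

lemma bilinD:
  assumes "bilin f"
  shows "f (u + v) w = f u w + f v w" "f w (u + v) = f w u + f w v"
    "f (c *s u) v = c * f u v" "f u (c *s v) = c * f u v" "f 0 u = 0" "f u 0 = 0"
proof -
  show "f (u + v) w = f u w + f v w" "f w (u + v) = f w u + f w v"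
    "f (c *s u) v = c * f u v" "f u (c *s v) = c * f u v"
    using assms by (auto simp: bilin_def)
  have "f (0 *s u) u = 0 * f u u" "f u (0 *s u) = 0 * f u u"
    using assms unfolding bilin_def by blast+
  then show "f 0 u = 0" "f u 0 = 0"
    by simp_all
qed

text \<open>A row \<open>a\<close> in the left radical contributes all of \<open>E\<close>, any
  other row a q-th part of it. Multiplying by q and moving the negative term to the left keeps the
  equation in the natural numbers.\<close>

lemma card_pairs_bilin:
  fixes f :: "'a::{field,finite}^'n::finite \<Rightarrow> 'a^'n \<Rightarrow> 'a"
  assumes f: "bilin f" and A: "vec.subspace A" and E: "vec.subspace E"
  shows "CARD('a) * (\<Sum>a\<in>A. card {e\<in>E. f a e = 0}) + card {a\<in>A. \<forall>e\<in>E. f a e = 0} * card E =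
    CARD('a) * (card {a\<in>A. \<forall>e\<in>E. f a e = 0} * card E) + card A * card E"
proof -
  let ?A0 = "{a\<in>A. \<forall>e\<in>E. f a e = 0}"
  have 1: "CARD('a) * card {e\<in>E. f a e = 0} = card E" if "a \<in> A - ?A0" for a
  proof -
    from that obtain e where "e \<in> E" "f a e \<noteq> 0" by auto
    then show ?thesis
      using card_fibers_additive[OF E, of "f a" e 0] bilinD[OF f] by auto
  qed
  have 2: "card {e\<in>E. f a e = 0} = card E" if "a \<in> ?A0" for a
  proof -
    have "{e\<in>E. f a e = 0} = E" using that by auto
    then show ?thesis by simp
  qed
  have "CARD('a) * (\<Sum>a\<in>A. card {e\<in>E. f a e = 0}) =
    (\<Sum>a\<in>A - ?A0. CARD('a) * card {e\<in>E. f a e = 0}) + (\<Sum>a\<in>?A0. CARD('a) * card {e\<in>E. f a e = 0})"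
    unfolding sum_distrib_left
    by (rule sum.subset_diff) auto
  also have "\<dots> = card (A - ?A0) * card E + card ?A0 * (CARD('a) * card E)"
    using 1 2 by simp
  also have "card (A - ?A0) = card A - card ?A0"
    by (rule card_Diff_subset) auto
  finally have "CARD('a) * (\<Sum>a\<in>A. card {e\<in>E. f a e = 0}) =
     (card A - card ?A0) * card E + card ?A0 * (CARD('a) * card E)" .
  moreover have "card ?A0 \<le> card A" by (rule card_mono) auto
  then obtain k where "card A = card ?A0 + k" using le_Suc_ex by blast
  ultimately show ?thesis
    by (simp add: algebra_simps)
qed

text \<open>The orthogonal pairs counted by rows and by columns give the previous equation twice
  with the same sum; the difference of the two is \<open>q - 1\<close> times the claim. Radicals on
  either side are allowed, which even characteristic requires.\<close>

lemma card_perp_duality: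
  fixes f :: "'a::{field,finite}^'n::finite \<Rightarrow> 'a^'n \<Rightarrow> 'a"
  assumes f: "bilin f" and A: "vec.subspace A" and E: "vec.subspace E"
  shows "card A * card {e\<in>E. \<forall>a\<in>A. f a e = 0} = card E * card {a\<in>A. \<forall>e\<in>E. f a e = 0}"
proof -
  let ?a = "card {a\<in>A. \<forall>e\<in>E. f a e = 0}" and ?e = "card {e\<in>E. \<forall>a\<in>A. f a e = 0}"
  let ?g = "\<lambda>u v. f v u"
  have g: "bilin ?g" using f unfolding bilin_def by blast
  have S: "(\<Sum>a\<in>A. card {e\<in>E. f a e = 0}) = (\<Sum>e\<in>E. card {a\<in>A. f a e = 0})"
    using sum.swap_restrict[of A E "\<lambda>_ _. 1::nat" "\<lambda>a e. f a e = 0"] by simp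
  have "CARD('a) * (?a * card E) + ?e * card A = CARD('a) * (?e * card A) + ?a * card E"
    using card_pairs_bilin[OF f A E] card_pairs_bilin[OF g E A] S by (simp add: mult.commute)
  moreover obtain k where k: "CARD('a) = Suc k" "k > 0"
    using card_ge_two[where 'a='a] by (cases "CARD('a)") auto
  ultimately have "k * (?a * card E) = k * (?e * card A)"
    by (simp only: k) simp
  then show ?thesis using k by (simp add: mult.commute)
qed

lemma card_span_insert:
  fixes U :: "('a::{field,finite}^'n::finite) set"
  assumes U: "vec.subspace U" and v: "v \<notin> U"
  shows "card (vec.span (insert v U)) = CARD('a) * card U"
proof -
  have "bij_betw (\<lambda>(t, u). t *s v + u) (UNIV \<times> U) (vec.span (insert v U))"
  proof (rule bij_betw_imageI)
    show "inj_on (\<lambda>(t, u). t *s v + u) (UNIV \<times> U)"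
    proof (rule inj_onI, clarsimp)
      fix t u t' u'
      assume u: "u \<in> U" "u' \<in> U" and eq: "t *s v + u = t' *s v + u'"
      then have d: "(t - t') *s v = u' - u" by (simp add: algebra_simps vec.scale_left_diff_distrib)
      have "t = t'"
      proof (rule ccontr)
        assume "t \<noteq> t'"
        then have "v = (1 / (t - t')) *s ((t - t') *s v)" by (simp only: vec.scale_scale) simp
        also have "\<dots> \<in> U" unfolding d using u U by (simp add: vec.subspace_scale vec.subspace_diff)
        finally show False using v by simp
      qed
      then show "t = t' \<and> u = u'" using eq by simp
    qed
    have "vec.span U = U"
      using U by (simp only: vec.span_eq_iff)
    then have "vec.span (insert v U) = {x. \<exists>k. x - k *s v \<in> U}"
      by (simp only: vec.span_insert)
    moreover have "(\<lambda>(t, u). t *s v + u) ` (UNIV \<times> U) = {x. \<exists>k. x - k *s v \<in> U}"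
    proof (intro set_eqI iffI)
      fix x assume "x \<in> {x. \<exists>k. x - k *s v \<in> U}"
      then obtain k where "x - k *s v \<in> U" by auto
      then show "x \<in> (\<lambda>(t, u). t *s v + u) ` (UNIV \<times> U)"
        by (intro image_eqI[where x = "(k, x - k *s v)"]) auto
    next
      fix x assume "x \<in> (\<lambda>(t, u). t *s v + u) ` (UNIV \<times> U)"
      then obtain t u where x: "x = t *s v + u" "u \<in> U" by auto
      then have "x - t *s v \<in> U" by simp
      then show "x \<in> {x. \<exists>k. x - k *s v \<in> U}" by blast
    qed
    ultimately show "(\<lambda>(t, u). t *s v + u) ` (UNIV \<times> U) = vec.span (insert v U)"
      by simp
  qed
  then have "card (UNIV \<times> U :: ('a \<times> _) set) = card (vec.span (insert v U))"
    by (rule bij_betw_same_card)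
  then show ?thesis by (simp add: card_cartesian_product)
qed

lemma card_span_independent:
  fixes b :: "('a::{field,finite}^'n::finite) set"
  assumes "vec.independent b"
  shows "card (vec.span b) = CARD('a) ^ card b"
proof -
  have "finite b" by simp
  then show ?thesis using assms
  proof (induction b)
    case (insert x F)
    then have x: "x \<notin> vec.span F" "vec.independent F"
      by (simp_all add: vec.independent_insert)
    have "vec.span (insert x F) = vec.span (insert x (vec.span F))"
      by (simp only: vec.span_insert vec.span_span)
    then show ?case
      using card_span_insert[OF vec.subspace_span x(1)] insert x(2) by simp
  qed simp
qed

lemma card_subspace:
  fixes U :: "('a::{field,finite}^'n::finite) set"
  assumes "vec.subspace U"
  shows "card U = CARD('a) ^ vec.dim U"
proof -
  obtain b where "b \<subseteq> U" "vec.independent b" "U \<subseteq> vec.span b" "card b = vec.dim U"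
    using vec.basis_exists by blast
  then show ?thesis using card_span_independent[of b] vec.span_minimal[of b U] assms
    by (metis subset_antisym)
qed

lemma power_CARD_inject [simp]:
  "CARD('a::{field,finite}) ^ i = CARD('a) ^ j \<longleftrightarrow> i = j"
  using card_ge_two[where 'a='a] by (intro power_inject_exp) simp

lemma dim_eq_iff_card:
  fixes U :: "('a::{field,finite}^'n::finite) set"
  assumes "vec.subspace U"
  shows "vec.dim U = k \<longleftrightarrow> card U = CARD('a) ^ k"
  using card_subspace[OF assms] by simp

text \<open>Each fibre of the addition map on \<open>U \<times> W\<close> is a copy of
  \<open>U \<inter> W\<close>: the dimension formula in multiplicative form.\<close>

lemma card_subspace_sum:
  fixes U W :: "('a::{field,finite}^'n::finite) set"
  assumes U: "vec.subspace U" and W: "vec.subspace W"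
  shows "card {u + w | u w. u \<in> U \<and> w \<in> W} * card (U \<inter> W) = card U * card W"
proof -
  let ?S = "{u + w | u w. u \<in> U \<and> w \<in> W}"
  have fib: "card {x \<in> U \<times> W. fst x + snd x = s} = card (U \<inter> W)" if s: "s \<in> ?S" for s
  proof -
    from s obtain u w where uw: "u \<in> U" "w \<in> W" "s = u + w" by auto
    have "bij_betw (\<lambda>z. (u + z, w - z)) (U \<inter> W) {x \<in> U \<times> W. fst x + snd x = s}"
    proof (rule bij_betwI[where g = "\<lambda>x. fst x - u"])
      show "(\<lambda>x. fst x - u) \<in> {x \<in> U \<times> W. fst x + snd x = s} \<rightarrow> U \<inter> W"
      proof (clarsimp simp: uw(3), intro conjI)
        fix a b assume ab: "a \<in> U" "b \<in> W" "a + b = u + w"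
        then have "a - u = w - b" by (simp add: algebra_simps)
        then show "a - u \<in> W" using ab uw W by (simp add: vec.subspace_diff)
        show "a - u \<in> U" using ab uw U by (simp add: vec.subspace_diff)
      qed
    qed (use uw U W in \<open>auto simp: vec.subspace_add vec.subspace_diff algebra_simps\<close>)
    then show ?thesis by (simp add: bij_betw_same_card)
  qed
  have "(\<Sum>s\<in>?S. \<Sum>x\<in>{x \<in> U \<times> W. fst x + snd x = s}. 1::nat) = (\<Sum>x\<in>U \<times> W. 1)"
    by (rule sum.group) (auto, blast)
  then have "card (U \<times> W) = (\<Sum>s\<in>?S. card {x \<in> U \<times> W. fst x + snd x = s})"
    by simp
  then show ?thesis using fib by (simp add: card_cartesian_product)
qed

section \<open>Quadratic spaces and their generators\<close>

definition totally_singular :: "('a::field^'n::finite \<Rightarrow> 'a) \<Rightarrow> ('a^'n) set \<Rightarrow> bool" where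
  "totally_singular Q U \<longleftrightarrow> vec.subspace U \<and> (\<forall>v\<in>U. Q v = 0)"

definition perp :: "('a::field^'n::finite \<Rightarrow> 'a) \<Rightarrow> ('a^'n) set \<Rightarrow> ('a^'n) set" where
  "perp Q U = {v. \<forall>u\<in>U. polar_form Q u v = 0}"

definition subspace_plus :: "('a::field^'n::finite) set \<Rightarrow> ('a^'n) set \<Rightarrow> ('a^'n) set" where
  "subspace_plus U W = {u + w | u w. u \<in> U \<and> w \<in> W}"

lemma subspace_subspace_plus:
  assumes "vec.subspace U" "vec.subspace W"
  shows "vec.subspace (subspace_plus U W)"
  unfolding subspace_plus_def using vec.subspace_sums[OF assms] .

lemma subspace_plus_upper:
  assumes "vec.subspace U" "vec.subspace W"
  shows "U \<subseteq> subspace_plus U W" "W \<subseteq> subspace_plus U W"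
proof -
  show "U \<subseteq> subspace_plus U W"
    using vec.subspace_0[OF assms(2)] by (force simp: subspace_plus_def)
  show "W \<subseteq> subspace_plus U W"
    using vec.subspace_0[OF assms(1)] by (force simp: subspace_plus_def)
qed

lemma card_subspace_plus:
  fixes U W :: "('a::{field,finite}^'n::finite) set"
  assumes "vec.subspace U" "vec.subspace W"
  shows "card (subspace_plus U W) * card (U \<inter> W) = card U * card W"
  unfolding subspace_plus_def by (rule card_subspace_sum[OF assms])

lemma mem_span_insert:
  assumes "vec.subspace U"
  shows "x \<in> vec.span (insert v U) \<longleftrightarrow> (\<exists>k. \<exists>u\<in>U. x = k *s v + u)"
proof -
  have "vec.span U = U"
    using assms by (simp only: vec.span_eq_iff)
  then have "x \<in> vec.span (insert v U) \<longleftrightarrow> (\<exists>k. x - k *s v \<in> U)"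
    by (simp only: vec.span_insert mem_Collect_eq)
  also have "\<dots> \<longleftrightarrow> (\<exists>k. \<exists>u\<in>U. x = k *s v + u)"
    by (metis add.commute add_diff_cancel_left' diff_add_cancel)
  finally show ?thesis .
qed

locale quadratic =
  fixes Q :: "'a::{field,finite}^'n::finite \<Rightarrow> 'a"
  assumes quad: "quadratic_form Q"
begin

abbreviation "B \<equiv> polar_form Q"

lemma bilin_B: "bilin B"
  using quad by (simp add: quadratic_form_def bilinear_form_imp_bilin)

lemma B_sym: "B u v = B v u"
  by (simp add: polar_form_def add.commute)

lemma Q_add: "Q (u + v) = Q u + Q v + B u v"
  by (simp add: polar_form_def)

lemma Q_scale: "Q (c *s v) = c\<^sup>2 * Q v"
  using quad by (simp add: quadratic_form_def)

lemma Q_0 [simp]: "Q 0 = 0"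
  using Q_scale[of 0 0] by simp

lemmas B_simps = bilinD[OF bilin_B]

lemma ts_subspace: "totally_singular Q U \<Longrightarrow> vec.subspace U"
  by (simp add: totally_singular_def)

lemma ts_Q: "totally_singular Q U \<Longrightarrow> v \<in> U \<Longrightarrow> Q v = 0"
  by (simp add: totally_singular_def)

lemma ts_B: "totally_singular Q U \<Longrightarrow> u \<in> U \<Longrightarrow> v \<in> U \<Longrightarrow> B u v = 0"
  by (simp add: polar_form_def ts_Q vec.subspace_add ts_subspace)

lemma ts_subset_perp: "totally_singular Q U \<Longrightarrow> U \<subseteq> perp Q U"
  by (auto simp: perp_def ts_B)

lemma ts_mono: "totally_singular Q U \<Longrightarrow> vec.subspace W \<Longrightarrow> W \<subseteq> U \<Longrightarrow> totally_singular Q W"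
  by (auto simp: totally_singular_def)

lemma subspace_perp: "vec.subspace (perp Q U)"
  by (auto simp: vec.subspace_def perp_def B_simps)

lemma perp_antimono: "U \<subseteq> W \<Longrightarrow> perp Q W \<subseteq> perp Q U"
  by (auto simp: perp_def)

lemma ts_plus:
  assumes "totally_singular Q U" "totally_singular Q W" "W \<subseteq> perp Q U"
  shows "totally_singular Q (subspace_plus U W)"
  unfolding totally_singular_def
proof (intro conjI ballI)
  show "vec.subspace (subspace_plus U W)"
    using assms by (intro subspace_subspace_plus ts_subspace)
  fix v assume "v \<in> subspace_plus U W"
  then obtain u w where "v = u + w" "u \<in> U" "w \<in> W" by (auto simp: subspace_plus_def)
  then show "Q v = 0"
    using assms by (auto simp: Q_add ts_Q perp_def)
qed

lemma ts_span_insert: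
  assumes U: "totally_singular Q U" and v: "Q v = 0" "v \<in> perp Q U"
  shows "totally_singular Q (vec.span (insert v U))"
  unfolding totally_singular_def
proof (intro conjI ballI)
  fix x assume "x \<in> vec.span (insert v U)"
  then obtain k u where "x = k *s v + u" "u \<in> U"
    using mem_span_insert[OF ts_subspace[OF U]] by blast
  then show "Q x = 0"
    using U v B_sym[of v u] by (simp add: Q_add Q_scale ts_Q B_simps perp_def)
qed simp

end

text \<open>Writing the dimension as \<open>d + m\<close> lets one set of counts serve two cases:
  \<open>m = d\<close> is a hyperbolic quadric inside a hyperplane, \<open>m = d + 1\<close> the
  parabolic quadric in the whole space.\<close>

locale quadratic_space = quadratic Q
  for Q :: "'a::{field,finite}^'n::finite \<Rightarrow> 'a" +
  fixes S :: "('a^'n) set" and d m :: nat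
  assumes subspace_S: "vec.subspace S" and nonsing: "nonsingular_on S Q"
    and card_S: "card S = CARD('a) ^ (d + m)"
    and dm: "0 < d" "d \<le> m" "m \<le> d + 1"
begin

definition gens :: "('a^'n) set set" where
  "gens = {\<pi> \<in> quadric_subspaces d Q. \<pi> \<subseteq> S}"

lemma mem_gens: "\<pi> \<in> gens \<longleftrightarrow> totally_singular Q \<pi> \<and> \<pi> \<subseteq> S \<and> card \<pi> = CARD('a) ^ d"
  using dim_eq_iff_card[of \<pi> d]
  by (auto simp: gens_def quadric_subspaces_def totally_singular_def)

lemma gens_ts: "\<pi> \<in> gens \<Longrightarrow> totally_singular Q \<pi>"
  and gens_S: "\<pi> \<in> gens \<Longrightarrow> \<pi> \<subseteq> S"
  and gens_card: "\<pi> \<in> gens \<Longrightarrow> card \<pi> = CARD('a) ^ d"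
  and gens_subspace: "\<pi> \<in> gens \<Longrightarrow> vec.subspace \<pi>"
  by (auto simp: mem_gens ts_subspace)

text \<open>Even if the polar form has a radical on \<open>S\<close>, that radical meets
  \<open>U\<close> trivially because the vectors of \<open>U\<close> are singular; duality then
  gives the same size as for a nondegenerate form.\<close>

lemma card_perp:
  assumes U: "totally_singular Q U" "U \<subseteq> S"
  shows "card U * card (S \<inter> perp Q U) = CARD('a) ^ (d + m)"
proof -
  have "{a \<in> U. \<forall>e\<in>S. B a e = 0} = {0}"
  proof -
    have "a = 0" if "a \<in> U" "\<forall>e\<in>S. B a e = 0" for a
      using nonsing that U ts_Q unfolding nonsingular_on_def by blast
    then show ?thesis
      using vec.subspace_0[OF ts_subspace[OF U(1)]] by (auto simp: B_simps)
  qed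
  moreover have "{e \<in> S. \<forall>a\<in>U. B a e = 0} = S \<inter> perp Q U"
    by (auto simp: perp_def)
  ultimately show ?thesis
    using card_perp_duality[OF bilin_B ts_subspace[OF U(1)] subspace_S] card_S by simp
qed

lemma card_perp_power:
  assumes U: "totally_singular Q U" "U \<subseteq> S" and j: "card U = CARD('a) ^ j" "j \<le> d"
  shows "card (S \<inter> perp Q U) = CARD('a) ^ (d + m - j)"
proof -
  have "CARD('a) ^ j * card (S \<inter> perp Q U) = CARD('a) ^ j * CARD('a) ^ (d + m - j)"
    using card_perp[OF U] j by (simp flip: power_add)
  then show ?thesis by simp
qed

text \<open>\<open>F\<close> lies in its own perp, so twice its dimension is at most
  \<open>d + m\<close>, which is at most \<open>2 * d + 1\<close>.\<close>

lemma dim_ts_le: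
  assumes "totally_singular Q F" "F \<subseteq> S"
  shows "vec.dim F \<le> d"
proof -
  have F: "card F = CARD('a) ^ vec.dim F"
    using assms card_subspace ts_subspace by blast
  have "card F * card F \<le> card F * card (S \<inter> perp Q F)"
    using assms ts_subset_perp by (intro mult_left_mono card_mono) auto
  also have "\<dots> = CARD('a) ^ (d + m)" using card_perp[OF assms] .
  finally have "CARD('a) ^ (vec.dim F + vec.dim F) \<le> CARD('a) ^ (d + m)"
    by (simp add: F power_add)
  then have "vec.dim F + vec.dim F \<le> d + m"
    using card_ge_two[where 'a = 'a] by (subst (asm) power_increasing_iff) auto
  then show ?thesis using dm by simp
qed

text \<open>Otherwise \<open>v\<close> and \<open>E\<close> would span a totally singular subspace
  of dimension \<open>d + 1\<close>.\<close>

lemma singular_perp_gen: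
  assumes E: "E \<in> gens" and v: "v \<in> S" "Q v = 0" "v \<in> perp Q E"
  shows "v \<in> E"
proof (rule ccontr)
  assume "v \<notin> E"
  let ?F = "vec.span (insert v E)"
  have ts: "totally_singular Q ?F"
    using ts_span_insert[OF gens_ts[OF E] v(2,3)] .
  have "card ?F = CARD('a) ^ (d + 1)"
    using card_span_insert[OF gens_subspace[OF E] \<open>v \<notin> E\<close>] gens_card[OF E] by simp
  then have "vec.dim ?F = d + 1"
    using dim_eq_iff_card[OF ts_subspace[OF ts], of "d + 1"] by blast
  moreover have "?F \<subseteq> S"
    using v gens_S[OF E] subspace_S by (intro vec.span_minimal) auto
  ultimately show False
    using dim_ts_le[OF ts] by linarith
qed

text \<open>By maximality of \<open>E\<close>, the vectors of \<open>U\<close> orthogonal to all of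
  \<open>E\<close> are exactly those of \<open>U \<inter> E\<close>; the rest is duality for the
  pairing of \<open>U\<close> with \<open>E\<close>.\<close>

lemma card_gen_perp:
  assumes U: "totally_singular Q U" "U \<subseteq> S" and E: "E \<in> gens"
  shows "card U * card (E \<inter> perp Q U) = CARD('a) ^ d * card (U \<inter> E)"
proof -
  have "{a \<in> U. \<forall>e\<in>E. B a e = 0} = U \<inter> E"
  proof -
    have "a \<in> E" if "a \<in> U" "\<forall>e\<in>E. B a e = 0" for a
      using that U B_sym by (intro singular_perp_gen[OF E]) (auto simp: perp_def ts_Q)
    then show ?thesis using ts_B[OF U(1)] ts_B[OF gens_ts[OF E]] by auto
  qed
  moreover have "{e \<in> E. \<forall>a\<in>U. B a e = 0} = E \<inter> perp Q U"
    by (auto simp: perp_def)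
  ultimately show ?thesis
    using card_perp_duality[OF bilin_B ts_subspace[OF U(1)] gens_subspace[OF E]] gens_card[OF E]
    by simp
qed

text \<open>The projection of \<open>U\<close> onto \<open>E\<close>: the two summands meet in
  \<open>U \<inter> E\<close>, whose size cancels against \<open>card_gen_perp\<close>. This is the
  source of generators through a prescribed subspace.\<close>

lemma gen_through:
  assumes U: "totally_singular Q U" "U \<subseteq> S" and E: "E \<in> gens"
  shows "subspace_plus U (E \<inter> perp Q U) \<in> gens"
proof -
  let ?W = "E \<inter> perp Q U"
  have W: "vec.subspace ?W"
    using gens_subspace[OF E] subspace_perp by (rule vec.subspace_inter)
  have "U \<inter> ?W = U \<inter> E" using ts_subset_perp[OF U(1)] by auto
  then have "card (subspace_plus U ?W) * card (U \<inter> E) = CARD('a) ^ d * card (U \<inter> E)"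
    using card_subspace_plus[OF ts_subspace[OF U(1)] W] card_gen_perp[OF U E] by simp
  moreover have "0 \<in> U \<inter> E"
    using vec.subspace_0 gens_subspace[OF E] ts_subspace[OF U(1)] by auto
  then have "card (U \<inter> E) \<noteq> 0" by auto
  ultimately have "card (subspace_plus U ?W) = CARD('a) ^ d" by simp
  moreover have "totally_singular Q (subspace_plus U ?W)"
    using ts_mono[OF gens_ts[OF E] W] by (intro ts_plus[OF U(1)]) auto
  moreover have "subspace_plus U ?W \<subseteq> S"
    using U gens_S[OF E] subspace_S by (auto simp: subspace_plus_def intro!: vec.subspace_add)
  ultimately show ?thesis by (simp add: mem_gens)
qed

text \<open>On a coset of \<open>E\<close> not orthogonal to \<open>E\<close> exactly one vector in \<open>q\<close> is singular; an orthogonal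
  coset other than \<open>E\<close> contains none.\<close>

lemma card_singular_perp:
  assumes E: "E \<in> gens" and U: "vec.subspace U" "U \<subseteq> E" "card U = CARD('a) ^ j"
  shows "card {v \<in> S. v \<in> perp Q U \<and> Q v = 0} + CARD('a) ^ (m - 1) = CARD('a) ^ (d + m - 1 - j) + CARD('a) ^ d"
proof -
  have tsU: "totally_singular Q U" using ts_mono[OF gens_ts[OF E] U(1,2)] .
  have US: "U \<subseteq> S" using U gens_S[OF E] by auto
  have jd: "j \<le> d"
    using dim_ts_le[OF tsU US] U card_subspace[OF U(1)] by simp
  let ?S = "S \<inter> perp Q U" and ?P = "S \<inter> perp Q E"
  let ?N = "{v \<in> S. v \<in> perp Q U \<and> Q v = 0}"
  have subS: "vec.subspace ?S" using subspace_S subspace_perp by (rule vec.subspace_inter)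
  have ES: "E \<subseteq> ?S" using gens_S[OF E] ts_subset_perp[OF gens_ts[OF E]] perp_antimono[OF U(2)] by auto
  have P: "?P \<subseteq> ?S" using perp_antimono[OF U(2)] by auto
  have cS: "card ?S = CARD('a) ^ (d + m - j)" using card_perp_power[OF tsU US U(3) jd] .
  have cP: "card ?P = CARD('a) ^ m"
    using card_perp_power[OF gens_ts[OF E] gens_S[OF E] gens_card[OF E]] by simp
  have sh: "card {v \<in> ?S. Q (v + e) = 0} = card ?N" if "e \<in> E" for e
  proof -
    have "bij_betw (\<lambda>v. v + e) {v \<in> ?S. Q (v + e) = 0} ?N"
    proof (rule bij_betwI[where g = "\<lambda>v. v - e"])
      show "(\<lambda>v. v + e) \<in> {v \<in> ?S. Q (v + e) = 0} \<rightarrow> ?N"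
        using vec.subspace_add[OF subS] that ES by blast
      show "(\<lambda>v. v - e) \<in> ?N \<rightarrow> {v \<in> ?S. Q (v + e) = 0}"
        using vec.subspace_diff[OF subS] that ES by fastforce
    qed auto
    then show ?thesis by (rule bij_betw_same_card)
  qed
  \<comment> \<open>Counts pairs with \<open>Q (v + e) = 0\<close>. For fixed \<open>e\<close> the
    vectors \<open>v\<close> form a translate of \<open>?N\<close>; for fixed \<open>v\<close> the
    number depends only on whether \<open>v\<close> lies in \<open>perp Q E\<close> and in
    \<open>E\<close>.\<close>
  have "card E * card ?N = (\<Sum>e\<in>E. card {v \<in> ?S. Q (v + e) = 0})"
    using sh by simp
  also have "\<dots> = (\<Sum>v\<in>?S. card {e \<in> E. Q (v + e) = 0})"
    using sum.swap_restrict[of E ?S "\<lambda>_ _. 1::nat" "\<lambda>e v. Q (v + e) = 0"] by simp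
  also have "\<dots> = (\<Sum>v\<in>?S - ?P. card {e \<in> E. Q (v + e) = 0}) + (\<Sum>v\<in>?P. card {e \<in> E. Q (v + e) = 0})"
    using P by (intro sum.subset_diff) auto
  finally have main: "card E * card ?N = \<dots>" .
  have 1: "CARD('a) * card {e \<in> E. Q (v + e) = 0} = card E" if "v \<in> ?S - ?P" for v
  proof -
    from that obtain e where e: "e \<in> E" "B v e \<noteq> 0" using B_sym by (auto simp: perp_def)
    have "{e \<in> E. Q (v + e) = 0} = {e \<in> E. B v e = - Q v}"
      using ts_Q[OF gens_ts[OF E]] by (auto simp: Q_add add_eq_0_iff)
    moreover have "CARD('a) * card {e \<in> E. B v e = - Q v} = card E"
      using e by (intro card_fibers_additive[OF gens_subspace[OF E]]) (auto simp: B_simps)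
    ultimately show ?thesis by simp
  qed
  have "(\<Sum>v\<in>?P. card {e \<in> E. Q (v + e) = 0}) = (\<Sum>v\<in>?P. if v \<in> E then card E else 0)"
  proof (rule sum.cong[OF refl])
    fix v assume v: "v \<in> ?P"
    have eq: "Q (v + e) = Q v" if "e \<in> E" for e
      using that v ts_Q[OF gens_ts[OF E]] B_sym[of v e] by (auto simp: Q_add perp_def)
    show "card {e \<in> E. Q (v + e) = 0} = (if v \<in> E then card E else 0)"
    proof (cases "v \<in> E")
      case True
      then have "{e \<in> E. Q (v + e) = 0} = E" using eq ts_Q[OF gens_ts[OF E]] by auto
      then show ?thesis using True by simp
    next
      case False
      then have "Q v \<noteq> 0" using singular_perp_gen[OF E] v by auto
      then have "{e \<in> E. Q (v + e) = 0} = {}" using eq by auto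
      then show ?thesis using False by simp
    qed
  qed
  also have "\<dots> = card E * card E"
  proof -
    have "?P \<inter> E = E" using gens_S[OF E] ts_subset_perp[OF gens_ts[OF E]] by auto
    then show ?thesis by (simp add: sum.If_cases Int_def[symmetric])
  qed
  finally have 2: "(\<Sum>v\<in>?P. card {e \<in> E. Q (v + e) = 0}) = card E * card E" .
  have "CARD('a) * (\<Sum>v\<in>?S - ?P. card {e \<in> E. Q (v + e) = 0}) = card (?S - ?P) * card E"
    using 1 by (simp add: sum_distrib_left)
  then have "CARD('a) * (card E * card ?N) = card (?S - ?P) * card E + CARD('a) * (card E * card E)"
    using main 2 by (simp add: distrib_left)
  then have "card E * (CARD('a) * card ?N) = card E * (card (?S - ?P) + CARD('a) * card E)"
    by (simp add: algebra_simps)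
  then have 3: "CARD('a) * card ?N = card (?S - ?P) + CARD('a) * card E"
    using gens_card[OF E] by simp
  have "card (?S - ?P) + card ?P = card ?S"
    using P by (simp add: card_Diff_subset card_mono)
  then have "CARD('a) * card ?N + CARD('a) ^ m = CARD('a) ^ (d + m - j) + CARD('a) * CARD('a) ^ d"
    using 3 cS cP gens_card[OF E] by simp
  moreover have "CARD('a) ^ m = CARD('a) * CARD('a) ^ (m - 1)" "CARD('a) ^ (d + m - j) = CARD('a) * CARD('a) ^ (d + m - 1 - j)"
    using dm jd by (auto simp flip: power_Suc intro!: arg_cong[where f = "\<lambda>i. CARD('a) ^ i"])
  ultimately have "CARD('a) * (card ?N + CARD('a) ^ (m - 1)) = CARD('a) * (CARD('a) ^ (d + m - 1 - j) + CARD('a) ^ d)"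
    by (simp add: distrib_left)
  then show ?thesis by simp
qed

text \<open>Induction step of the two generator counts below: \<open>V\<close> is the set of
  singular vectors by which \<open>U\<close> may be enlarged, and \<open>c\<close> the count already
  known for the enlarged subspace.\<close>

lemma double_count_vectors:
  fixes \<T> :: "('a^'n) set set"
  assumes U: "card U = CARD('a) ^ j" and T: "\<And>T. T \<in> \<T> \<Longrightarrow> T \<in> gens \<and> U \<subseteq> T"
    and V: "\<And>T. T \<in> \<T> \<Longrightarrow> T - U \<subseteq> V"
    and c: "\<And>v. v \<in> V \<Longrightarrow> card {T \<in> \<T>. v \<in> T} = c"
    and disj: "V \<inter> U = {}"
  shows "card \<T> * (CARD('a) ^ d - CARD('a) ^ j) = card V * c"
proof -
  have "card (T - U) = CARD('a) ^ d - CARD('a) ^ j" if "T \<in> \<T>" for T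
    using T[OF that] U gens_card by (simp add: card_Diff_subset)
  then have "card \<T> * (CARD('a) ^ d - CARD('a) ^ j) = (\<Sum>T\<in>\<T>. card (T - U))" by simp
  also have "\<dots> = (\<Sum>T\<in>\<T>. card {v \<in> V. v \<in> T})"
  proof (rule sum.cong[OF refl])
    fix T assume "T \<in> \<T>"
    then have "T - U = {v \<in> V. v \<in> T}" using V disj by blast
    then show "card (T - U) = card {v \<in> V. v \<in> T}" by simp
  qed
  also have "\<dots> = (\<Sum>v\<in>V. card {T \<in> \<T>. v \<in> T})"
    using sum.swap_restrict[of \<T> V "\<lambda>_ _. 1::nat" "\<lambda>T v. v \<in> T"] by simp
  also have "\<dots> = card V * c" using c by simp
  finally show ?thesis .
qed

end

lemma subspace_psubset_card:
  fixes U W :: "('a::{field,finite}^'n::finite) set"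
  assumes U: "vec.subspace U" and W: "vec.subspace W" and UW: "U \<subset> W"
  shows "CARD('a) * card U \<le> card W"
proof -
  obtain v where v: "v \<in> W" "v \<notin> U" using UW by auto
  have "vec.span (insert v U) \<subseteq> W"
    using v UW W by (intro vec.span_minimal) auto
  then have "card (vec.span (insert v U)) \<le> card W" by (intro card_mono) auto
  then show ?thesis using card_span_insert[OF U v(2)] by simp
qed

lemma subspace_psubset_dim:
  fixes U W :: "('a::{field,finite}^'n::finite) set"
  assumes U: "vec.subspace U" and W: "vec.subspace W" and UW: "U \<subset> W"
  shows "vec.dim U < vec.dim W"
proof -
  have "CARD('a) ^ (vec.dim U + 1) \<le> CARD('a) ^ vec.dim W"
    using subspace_psubset_card[OF assms] card_subspace[OF U] card_subspace[OF W] by simp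
  then have "vec.dim U + 1 \<le> vec.dim W"
    using card_ge_two[where 'a = 'a] by (subst (asm) power_increasing_iff) auto
  then show ?thesis by simp
qed

lemma card_less_not_subset: "finite A \<Longrightarrow> card A < card B \<Longrightarrow> \<not> B \<subseteq> A"
  using card_mono[of A B] by auto

text \<open>\<open>R\<close> is a largest proper subspace of \<open>P\<close> above
  \<open>W\<close>; adding any further vector of \<open>P\<close> must give all of \<open>P\<close>,
  which is therefore q times as large.\<close>

lemma hyperplane_between:
  fixes W P :: "('a::{field,finite}^'n::finite) set"
  assumes W: "vec.subspace W" and P: "vec.subspace P" and WP: "W \<subset> P"
  obtains R where "vec.subspace R" "W \<subseteq> R" "R \<subset> P" "card P = CARD('a) * card R"
proof -
  let ?X = "{R. vec.subspace R \<and> W \<subseteq> R \<and> R \<subset> P}"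
  have fin: "finite (card ` ?X)" by simp
  have ne: "W \<in> ?X" using assms by auto
  then have "Max (card ` ?X) \<in> card ` ?X" by (intro Max_in) auto
  then obtain R where R: "R \<in> ?X" and max: "\<And>R'. R' \<in> ?X \<Longrightarrow> card R' \<le> card R"
    using Max_ge[OF fin] by (metis (no_types, lifting) imageE image_eqI)
  from R obtain v where v: "v \<in> P" "v \<notin> R" by auto
  have sub: "vec.span (insert v R) \<subseteq> P"
    using v R P by (intro vec.span_minimal) auto
  have c: "card (vec.span (insert v R)) = CARD('a) * card R"
    using card_span_insert[of R v] R v by simp
  have "card R > 0" using R by (auto simp: card_gt_0_iff dest: vec.subspace_0)
  then have "card R < CARD('a) * card R" using card_ge_two[where 'a='a] by simp
  then have "vec.span (insert v R) \<notin> ?X" using max c by force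
  moreover have "W \<subseteq> vec.span (insert v R)"
    using R vec.span_superset by blast
  ultimately have "vec.span (insert v R) = P"
    using sub by auto
  then show thesis using that[of R] R c by auto
qed

lemma span_insert_subset_iff:
  assumes "vec.subspace T"
  shows "vec.span (insert v U) \<subseteq> T \<longleftrightarrow> v \<in> T \<and> U \<subseteq> T"
proof
  assume "vec.span (insert v U) \<subseteq> T"
  then show "v \<in> T \<and> U \<subseteq> T"
    using vec.span_superset[of "insert v U"] by auto
next
  assume "v \<in> T \<and> U \<subseteq> T"
  then show "vec.span (insert v U) \<subseteq> T"
    by (intro vec.span_minimal assms) auto
qed

section \<open>Counting generators through a totally singular subspace\<close>

context quadratic_space
begin

lemma ts_span_insert_S:
  assumes U: "totally_singular Q U" "U \<subseteq> S" and v: "v \<in> S" "v \<in> perp Q U" "Q v = 0" "v \<notin> U"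
    and j: "card U = CARD('a) ^ j"
  shows "totally_singular Q (vec.span (insert v U))" "vec.span (insert v U) \<subseteq> S"
    "card (vec.span (insert v U)) = CARD('a) ^ Suc j"
  using ts_span_insert[OF U(1) v(3,2)] U v card_span_insert[OF ts_subspace[OF U(1)] v(4)] j
  by (simp_all add: span_insert_subset_iff subspace_S)

lemma gen_subset_singular_perp:
  assumes "T \<in> gens" "U \<subseteq> T"
  shows "T \<subseteq> {v \<in> S. v \<in> perp Q U \<and> Q v = 0}"
  using gens_S[OF assms(1)] ts_subset_perp[OF gens_ts[OF assms(1)]] perp_antimono[OF assms(2)]
    ts_Q[OF gens_ts[OF assms(1)]] by blast

lemma gen_eq:
  assumes "T \<in> gens" "U \<subseteq> T" "card U = CARD('a) ^ d"
  shows "U = T"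
  using assms gens_card by (intro card_subset_eq) auto

lemma gens_eq_zero_iff:
  assumes "T \<in> gens"
  shows "0 \<in> T"
  using gens_subspace[OF assms] vec.subspace_0 by blast

text \<open>The generators through \<open>U\<close> are those of a parabolic quadric of rank
  \<open>d - j\<close>. The step enlarges \<open>U\<close> by one singular vector of its perp; there
  are \<open>q ^ (2 * d - j) - q ^ j = (q ^ (d - j) + 1) * (q ^ d - q ^ j)\<close> choices outside
  \<open>U\<close>, and the second factor is the number of choices lying in one generator.\<close>

lemma card_gens_through:
  assumes m: "m = d + 1" and E: "gens \<noteq> {}"
    and U: "totally_singular Q U" "U \<subseteq> S" "card U = CARD('a) ^ j" "j \<le> d"
  shows "card {T \<in> gens. U \<subseteq> T} = (\<Prod>i<d - j. CARD('a) ^ (i + 1) + 1)"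
  using U
proof (induction "d - j" arbitrary: U j)
  case 0
  then have "j = d" by simp
  obtain E where "E \<in> gens" using E by auto
  have "U \<in> gens" using 0 \<open>j = d\<close> by (simp add: mem_gens)
  moreover have "T = U" if "T \<in> gens" "U \<subseteq> T" for T
    using gen_eq[OF that] 0 \<open>j = d\<close> by simp
  ultimately have "{T \<in> gens. U \<subseteq> T} = {U}"
    by auto
  then show ?case using 0 by simp
next
  case (Suc k)
  let ?V = "{v \<in> S. v \<in> perp Q U \<and> Q v = 0}"
  let ?c = "\<Prod>i<d - Suc j. CARD('a) ^ (i + 1) + 1"
  obtain E0 where E0: "E0 \<in> gens" using E by auto
  have sU: "vec.subspace U" using Suc.prems ts_subspace by blast
  obtain E where E: "E \<in> gens" "U \<subseteq> E"
    using gen_through[OF Suc.prems(1,2) E0] subspace_plus_upper(1)[OF sU]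
      vec.subspace_inter[OF gens_subspace[OF E0] subspace_perp] by blast
  have jd: "j < d" using Suc.hyps by simp
  \<comment> \<open>For \<open>m = d + 1\<close> the terms \<open>q ^ (m - 1)\<close> and
    \<open>q ^ d\<close> of \<open>card_singular_perp\<close> coincide and cancel.\<close>
  have "card ?V + CARD('a) ^ d = CARD('a) ^ (2 * d - j) + CARD('a) ^ d"
    using card_singular_perp[OF E(1) sU E(2) Suc.prems(3)] m by (simp add: mult_2)
  then have V: "card ?V = CARD('a) ^ (2 * d - j)" by simp
  have UV: "U \<subseteq> ?V"
    using Suc.prems ts_subset_perp ts_Q by blast
  have "card {T \<in> gens. U \<subseteq> T} * (CARD('a) ^ d - CARD('a) ^ j) = card (?V - U) * ?c"
  proof (rule double_count_vectors[OF Suc.prems(3)])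
    fix T assume "T \<in> {T \<in> gens. U \<subseteq> T}"
    then have T: "T \<in> gens" "U \<subseteq> T" by auto
    then show "T \<in> gens \<and> U \<subseteq> T" by simp
    show "T - U \<subseteq> ?V - U"
      using gen_subset_singular_perp[OF T] by blast
  next
    fix v assume "v \<in> ?V - U"
    then have v: "v \<in> S" "v \<in> perp Q U" "Q v = 0" "v \<notin> U" by auto
    note W = ts_span_insert_S[OF Suc.prems(1,2) v Suc.prems(3)]
    have "{T \<in> {T \<in> gens. U \<subseteq> T}. v \<in> T} = {T \<in> gens. vec.span (insert v U) \<subseteq> T}"
      using span_insert_subset_iff[OF gens_subspace] by blast
    then show "card {T \<in> {T \<in> gens. U \<subseteq> T}. v \<in> T} = ?c"
      using Suc.hyps(1)[OF _ W] Suc.hyps(2) jd by simp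
  qed auto
  also have "card (?V - U) = CARD('a) ^ (2 * d - j) - CARD('a) ^ j"
    using V UV Suc.prems(3) by (simp add: card_Diff_subset)
  also have "\<dots> = (CARD('a) ^ (d - j) + 1) * (CARD('a) ^ d - CARD('a) ^ j)"
  proof -
    have "CARD('a) ^ (2 * d - j) = CARD('a) ^ (d - j) * CARD('a) ^ d"
      "CARD('a) ^ d = CARD('a) ^ (d - j) * CARD('a) ^ j"
      using jd by (simp_all flip: power_add)
    then show ?thesis
      by (simp add: diff_mult_distrib2 distrib_right)
  qed
  finally have "card {T \<in> gens. U \<subseteq> T} * (CARD('a) ^ d - CARD('a) ^ j) =
    ((CARD('a) ^ (d - j) + 1) * ?c) * (CARD('a) ^ d - CARD('a) ^ j)"
    by (simp only: mult_ac)
  moreover have "CARD('a) ^ j < CARD('a) ^ d"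
    using jd card_ge_two[where 'a='a] by (intro power_strict_increasing) auto
  ultimately have "card {T \<in> gens. U \<subseteq> T} = (CARD('a) ^ (d - j) + 1) * ?c"
    by simp
  moreover have "d - j = Suc (d - Suc j)" using jd by simp
  ultimately show ?case
    by (simp add: mult.commute)
qed

text \<open>A singular vector of the perp of \<open>U\<close> keeps the enlarged subspace disjoint
  from \<pi> exactly when it avoids the generator \<open>E = U + (\<pi> \<inter> perp Q U)\<close>.
  This leaves \<open>q ^ (m - 1 - j) * (q ^ d - q ^ j)\<close> vectors, so each step contributes the
  factor \<open>q ^ (m - 1 - j)\<close>.\<close>

lemma card_gens_through_disjoint:
  assumes \<pi>: "\<pi> \<in> gens"
    and U: "totally_singular Q U" "U \<subseteq> S" "card U = CARD('a) ^ j" "j \<le> d" "U \<inter> \<pi> = {0}"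
  shows "card {T \<in> gens. U \<subseteq> T \<and> T \<inter> \<pi> = {0}} = CARD('a) ^ (\<Sum>i=j..<d. m - 1 - i)"
  using U
proof (induction "d - j" arbitrary: U j)
  case 0
  then have "j = d" by simp
  have "U \<in> gens" using 0 \<open>j = d\<close> by (simp add: mem_gens)
  moreover have "T = U" if "T \<in> gens" "U \<subseteq> T" for T
    using gen_eq[OF that] 0 \<open>j = d\<close> by simp
  ultimately have "{T \<in> gens. U \<subseteq> T \<and> T \<inter> \<pi> = {0}} = {U}"
    using 0 by auto
  then show ?case using 0 by simp
next
  case (Suc k)
  let ?N = "{v \<in> S. v \<in> perp Q U \<and> Q v = 0}"
  let ?c = "CARD('a) ^ (\<Sum>i=Suc j..<d. m - 1 - i)"
  define E where "E = subspace_plus U (\<pi> \<inter> perp Q U)"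
  have sU: "vec.subspace U" using Suc.prems ts_subspace by blast
  have sP: "vec.subspace (\<pi> \<inter> perp Q U)"
    using vec.subspace_inter[OF gens_subspace[OF \<pi>] subspace_perp] .
  have E: "E \<in> gens" using gen_through[OF Suc.prems(1,2) \<pi>] by (simp add: E_def)
  have UE: "U \<subseteq> E" using subspace_plus_upper(1)[OF sU sP] by (simp add: E_def)
  have jd: "j < d" using Suc.hyps by simp
  have N: "card ?N + CARD('a) ^ (m - 1) = CARD('a) ^ (d + m - 1 - j) + CARD('a) ^ d"
    using card_singular_perp[OF E(1) sU UE Suc.prems(3)] .
  have EN: "E \<subseteq> ?N"
    by (rule gen_subset_singular_perp[OF E UE])
  let ?T = "{T \<in> gens. U \<subseteq> T \<and> T \<inter> \<pi> = {0}}"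
  have "card ?T * (CARD('a) ^ d - CARD('a) ^ j) = card (?N - E) * ?c"
  proof (rule double_count_vectors[OF Suc.prems(3)])
    fix T assume "T \<in> ?T"
    then have T: "T \<in> gens" "U \<subseteq> T" "T \<inter> \<pi> = {0}" by auto
    then show "T \<in> gens \<and> U \<subseteq> T" by simp
    show "T - U \<subseteq> ?N - E"
    proof
      fix v assume v: "v \<in> T - U"
      then have "v \<in> ?N"
        using gen_subset_singular_perp[OF T(1,2)] by blast
      moreover have "v \<notin> E"
      proof
        assume "v \<in> E"
        then obtain u e where ue: "u \<in> U" "e \<in> \<pi>" "v = u + e"
          by (auto simp: E_def subspace_plus_def)
        then have "e = v - u" by simp
        moreover have "v - u \<in> T"
          using v ue(1) T(2) by (intro vec.subspace_diff gens_subspace[OF T(1)]) auto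
        ultimately have "e \<in> T" by simp
        then have "e = 0" using ue T(3) by auto
        then show False using ue v by simp
      qed
      ultimately show "v \<in> ?N - E" by simp
    qed
  next
    fix v assume "v \<in> ?N - E"
    then have v: "v \<in> S" "v \<in> perp Q U" "Q v = 0" "v \<notin> U" and vE: "v \<notin> E" using UE by auto
    note W = ts_span_insert_S[OF Suc.prems(1,2) v Suc.prems(3)]
    have "vec.span (insert v U) \<inter> \<pi> = {0}"
    proof -
      have "x = 0" if x: "x \<in> vec.span (insert v U)" "x \<in> \<pi>" for x
      proof -
        obtain k u where ku: "u \<in> U" "x = k *s v + u" using x mem_span_insert[OF sU] by blast
        have "k = 0"
        proof (rule ccontr)
          assume k: "k \<noteq> 0"
          have "x \<in> perp Q U"
            unfolding ku using v ku ts_subset_perp[OF Suc.prems(1)] subspace_perp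
            by (auto intro!: vec.subspace_add vec.subspace_scale)
          moreover have "k *s v = - u + x" "- u \<in> U"
            using ku sU vec.subspace_neg by auto
          ultimately have "k *s v \<in> E"
            using x(2) unfolding E_def subspace_plus_def by blast
          then have "(1 / k) *s (k *s v) \<in> E" using gens_subspace[OF E] vec.subspace_scale by blast
          then show False using vE k by (simp add: vec.scale_scale)
        qed
        then show ?thesis using ku x Suc.prems(5) by auto
      qed
      then show ?thesis
        using vec.subspace_0[OF vec.subspace_span] vec.subspace_0[OF gens_subspace[OF \<pi>]] by blast
    qed
    moreover have "{T \<in> ?T. v \<in> T} = {T \<in> gens. vec.span (insert v U) \<subseteq> T \<and> T \<inter> \<pi> = {0}}"
      using span_insert_subset_iff[OF gens_subspace] by blast
    ultimately show "card {T \<in> ?T. v \<in> T} = ?c"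
      using Suc.hyps(1)[OF _ W] Suc.hyps(2) jd by simp
  qed (use UE in auto)
  also have "card (?N - E) = CARD('a) ^ (d + m - 1 - j) - CARD('a) ^ (m - 1)"
    using N EN gens_card[OF E] by (simp add: card_Diff_subset)
  also have "\<dots> = CARD('a) ^ (m - 1 - j) * (CARD('a) ^ d - CARD('a) ^ j)"
  proof -
    have "CARD('a) ^ (d + m - 1 - j) = CARD('a) ^ (m - 1 - j) * CARD('a) ^ d"
      "CARD('a) ^ (m - 1) = CARD('a) ^ (m - 1 - j) * CARD('a) ^ j"
      using jd dm by (simp_all flip: power_add)
    then show ?thesis
      by (simp add: diff_mult_distrib2)
  qed
  finally have "card ?T * (CARD('a) ^ d - CARD('a) ^ j) =
    (CARD('a) ^ (m - 1 - j) * ?c) * (CARD('a) ^ d - CARD('a) ^ j)"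
    by (simp only: mult_ac)
  moreover have "CARD('a) ^ j < CARD('a) ^ d"
    using jd card_ge_two[where 'a='a] by (intro power_strict_increasing) auto
  ultimately have "card ?T = CARD('a) ^ (m - 1 - j) * ?c"
    by simp
  then show ?case
    using jd by (simp add: sum.atLeast_Suc_lessThan power_add)
qed

lemma card_perp_hyperplane_gen:
  assumes \<tau>: "\<tau> \<in> gens" and \<rho>: "totally_singular Q \<rho>" "\<rho> \<subseteq> S" "card \<rho> * CARD('a) = CARD('a) ^ d"
  shows "card (\<tau> \<inter> perp Q \<rho>) = CARD('a) * card (\<rho> \<inter> \<tau>)"
proof -
  have "card \<rho> * card (\<tau> \<inter> perp Q \<rho>) = card \<rho> * (CARD('a) * card (\<rho> \<inter> \<tau>))"
    using card_gen_perp[OF \<rho>(1,2) \<tau>] \<rho>(3) by (metis mult.assoc)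
  moreover have "card \<rho> \<noteq> 0" using \<rho>(3) by (intro notI) simp
  ultimately show ?thesis by simp
qed

end

section \<open>Hyperbolic quadrics: parity of the intersections of generators\<close>

locale hyperbolic_space = quadratic_space Q S d d for Q :: "'a::{field,finite}^'n::finite \<Rightarrow> 'a" and S d
begin

text \<open>For \<open>m = d\<close> and \<open>j = d - 1\<close> the count becomes
  \<open>2 * q ^ d - q ^ (d - 1)\<close>, the size of a union of two generators that meet in
  \<rho>.\<close>

lemma card_singular_perp_hyperplane:
  assumes \<sigma>: "\<sigma> \<in> gens" and \<rho>: "vec.subspace \<rho>" "\<rho> \<subseteq> \<sigma>" "card \<rho> * CARD('a) = CARD('a) ^ d"
  shows "card {v \<in> S. v \<in> perp Q \<rho> \<and> Q v = 0} + card \<rho> = 2 * CARD('a) ^ d"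
proof -
  have "CARD('a) ^ d = CARD('a) ^ (d - 1) * CARD('a)"
    using dm by (metis One_nat_def power_Suc2 Suc_pred)
  then have "card \<rho> = CARD('a) ^ (d - 1)" using \<rho> by simp
  moreover have "d + d - 1 - (d - 1) = d" using dm by simp
  ultimately show ?thesis
    using card_singular_perp[OF \<sigma> \<rho>(1,2), of "d - 1"] by simp
qed

lemma two_gens_inter:
  assumes \<sigma>: "\<sigma>\<^sub>1 \<in> gens" "\<sigma>\<^sub>2 \<in> gens" "\<sigma>\<^sub>1 \<noteq> \<sigma>\<^sub>2"
    and \<rho>: "vec.subspace \<rho>" "\<rho> \<subseteq> \<sigma>\<^sub>1" "\<rho> \<subseteq> \<sigma>\<^sub>2" "card \<rho> * CARD('a) = CARD('a) ^ d"
  shows "\<sigma>\<^sub>1 \<inter> \<sigma>\<^sub>2 = \<rho>"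
proof (rule ccontr)
  assume ne: "\<sigma>\<^sub>1 \<inter> \<sigma>\<^sub>2 \<noteq> \<rho>"
  have sI: "vec.subspace (\<sigma>\<^sub>1 \<inter> \<sigma>\<^sub>2)" using \<sigma> gens_subspace vec.subspace_inter by blast
  have "CARD('a) * card \<rho> \<le> card (\<sigma>\<^sub>1 \<inter> \<sigma>\<^sub>2)"
    using ne \<rho> by (intro subspace_psubset_card sI) auto
  then have "card \<sigma>\<^sub>1 \<le> card (\<sigma>\<^sub>1 \<inter> \<sigma>\<^sub>2)"
    using gens_card[OF \<sigma>(1)] \<rho>(4) by (simp add: mult.commute)
  then have "\<sigma>\<^sub>1 \<inter> \<sigma>\<^sub>2 = \<sigma>\<^sub>1"
    by (intro card_seteq) auto
  then have "\<sigma>\<^sub>1 = \<sigma>\<^sub>2" using gen_eq[OF \<sigma>(2), of \<sigma>\<^sub>1] gens_card[OF \<sigma>(1)] by auto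
  then show False using \<sigma>(3) by simp
qed

lemma singular_perp_hyperplane:
  assumes \<sigma>: "\<sigma>\<^sub>1 \<in> gens" "\<sigma>\<^sub>2 \<in> gens" "\<sigma>\<^sub>1 \<noteq> \<sigma>\<^sub>2"
    and \<rho>: "vec.subspace \<rho>" "\<rho> \<subseteq> \<sigma>\<^sub>1" "\<rho> \<subseteq> \<sigma>\<^sub>2" "card \<rho> * CARD('a) = CARD('a) ^ d"
  shows "{v \<in> S. v \<in> perp Q \<rho> \<and> Q v = 0} = \<sigma>\<^sub>1 \<union> \<sigma>\<^sub>2"
proof (rule card_subset_eq[symmetric])
  have sub: "\<sigma> \<subseteq> {v \<in> S. v \<in> perp Q \<rho> \<and> Q v = 0}" if "\<sigma> \<in> gens" "\<rho> \<subseteq> \<sigma>" for \<sigma>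
    by (rule gen_subset_singular_perp[OF that])
  then show "\<sigma>\<^sub>1 \<union> \<sigma>\<^sub>2 \<subseteq> {v \<in> S. v \<in> perp Q \<rho> \<and> Q v = 0}" using \<sigma> \<rho> by simp
  have "card (\<sigma>\<^sub>1 \<union> \<sigma>\<^sub>2) + card \<rho> = 2 * CARD('a) ^ d"
    using card_Un_Int[of \<sigma>\<^sub>1 \<sigma>\<^sub>2] two_gens_inter[OF assms] gens_card \<sigma> by simp
  then show "card (\<sigma>\<^sub>1 \<union> \<sigma>\<^sub>2) = card {v \<in> S. v \<in> perp Q \<rho> \<and> Q v = 0}"
    using card_singular_perp_hyperplane[OF \<sigma>(1) \<rho>(1,2,4)] by simp
qed simp

lemma subspace_subset_Un:
  assumes "vec.subspace W" "vec.subspace X" "vec.subspace Y" "W \<subseteq> X \<union> Y"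
  shows "W \<subseteq> X \<or> W \<subseteq> Y"
proof (rule ccontr)
  assume "\<not> ?thesis"
  then obtain x y where xy: "x \<in> W" "x \<notin> X" "y \<in> W" "y \<notin> Y" by auto
  then have "x \<in> Y" "y \<in> X" using assms by auto
  have "x + y \<in> W" using xy assms by (auto intro: vec.subspace_add)
  then have "x + y \<in> X \<or> x + y \<in> Y" using assms by auto
  then show False
    using vec.subspace_diff[OF assms(2), of "x + y" y] vec.subspace_diff[OF assms(3), of "x + y" x]
      xy \<open>x \<in> Y\<close> \<open>y \<in> X\<close> by auto
qed

text \<open>The singular vectors orthogonal to \<rho> fill exactly the two generators through it, so
  the subspace \<open>\<tau> \<inter> perp Q \<rho>\<close> lies in one of them. \<tau> meets that
  one in this subspace and the other one in \<open>\<rho> \<inter> \<tau>\<close>, which has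
  dimension one less.\<close>

lemma dim_inter_adjacent:
  assumes \<sigma>: "\<sigma>\<^sub>1 \<in> gens" "\<sigma>\<^sub>2 \<in> gens" "\<sigma>\<^sub>1 \<noteq> \<sigma>\<^sub>2"
    and \<rho>: "vec.subspace \<rho>" "\<rho> \<subseteq> \<sigma>\<^sub>1" "\<rho> \<subseteq> \<sigma>\<^sub>2" "card \<rho> * CARD('a) = CARD('a) ^ d"
    and \<tau>: "\<tau> \<in> gens"
  shows "odd (vec.dim (\<tau> \<inter> \<sigma>\<^sub>1) + vec.dim (\<tau> \<inter> \<sigma>\<^sub>2))"
proof -
  let ?W = "\<tau> \<inter> perp Q \<rho>"
  have ts\<rho>: "totally_singular Q \<rho>" and \<rho>S: "\<rho> \<subseteq> S"
    using ts_mono[OF gens_ts[OF \<sigma>(1)] \<rho>(1,2)] gens_S[OF \<sigma>(1)] \<rho> by auto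
  have sW: "vec.subspace ?W" using gens_subspace[OF \<tau>] subspace_perp by (rule vec.subspace_inter)
  have W: "?W \<subseteq> \<sigma>\<^sub>1 \<union> \<sigma>\<^sub>2"
    using singular_perp_hyperplane[OF assms(1-7)] gens_S[OF \<tau>] ts_Q[OF gens_ts[OF \<tau>]] by blast
  have cW: "card ?W = CARD('a) * card (\<rho> \<inter> \<tau>)"
    by (rule card_perp_hyperplane_gen[OF \<tau> ts\<rho> \<rho>S \<rho>(4)])
  have s\<rho>\<tau>: "vec.subspace (\<rho> \<inter> \<tau>)" using \<rho>(1) gens_subspace[OF \<tau>] by (rule vec.subspace_inter)
  have dW: "vec.dim ?W = Suc (vec.dim (\<rho> \<inter> \<tau>))"
    using dim_eq_iff_card[OF sW] cW card_subspace[OF s\<rho>\<tau>] by simp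
  have key: "vec.dim (\<tau> \<inter> \<alpha>) = vec.dim ?W \<and> vec.dim (\<tau> \<inter> \<beta>) = vec.dim (\<rho> \<inter> \<tau>)"
    if W\<alpha>: "?W \<subseteq> \<alpha>" and \<alpha>: "\<alpha> \<in> gens" "\<rho> \<subseteq> \<alpha>" and \<beta>: "\<beta> \<in> gens" "\<rho> \<subseteq> \<beta>" and ab: "\<alpha> \<inter> \<beta> = \<rho>" for \<alpha> \<beta>
  proof -
    have p: "\<alpha> \<subseteq> perp Q \<rho>" "\<beta> \<subseteq> perp Q \<rho>"
      using ts_subset_perp[OF gens_ts] perp_antimono \<alpha> \<beta> by blast+
    have "\<tau> \<inter> \<alpha> = ?W" using p W\<alpha> by auto
    moreover have "\<tau> \<inter> \<beta> = \<rho> \<inter> \<tau>" using p W\<alpha> ab by auto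
    ultimately show ?thesis by simp
  qed
  have i: "\<sigma>\<^sub>1 \<inter> \<sigma>\<^sub>2 = \<rho>" using two_gens_inter[OF assms(1-7)] .
  have "?W \<subseteq> \<sigma>\<^sub>1 \<or> ?W \<subseteq> \<sigma>\<^sub>2"
    using subspace_subset_Un[OF sW _ _ W] \<sigma> gens_subspace by blast
  then show ?thesis
  proof
    assume "?W \<subseteq> \<sigma>\<^sub>1"
    from key[OF this \<sigma>(1) \<rho>(2) \<sigma>(2) \<rho>(3) i] show ?thesis using dW by simp
  next
    assume "?W \<subseteq> \<sigma>\<^sub>2"
    from key[OF this \<sigma>(2) \<rho>(3) \<sigma>(1) \<rho>(2)] i show ?thesis using dW by (auto simp: Int_commute)
  qed
qed

text \<open>Replace \<pi> by an adjacent generator with a larger intersection with \<sigma>. Both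
  \<open>\<tau> \<inter> \<pi>\<close> and \<open>\<pi> \<inter> \<sigma>\<close> change the parity
  of their dimension, so the parity of the whole sum is preserved until \<pi> becomes
  \<sigma>.\<close>

lemma dim_inter_parity:
  assumes "\<pi> \<in> gens" "\<sigma> \<in> gens" "\<tau> \<in> gens"
  shows "even (vec.dim (\<tau> \<inter> \<pi>) + vec.dim (\<tau> \<inter> \<sigma>) + vec.dim (\<pi> \<inter> \<sigma>) + d)"
  using assms(1)
proof (induction "d - vec.dim (\<pi> \<inter> \<sigma>)" arbitrary: \<pi> rule: less_induct)
  case less
  note \<pi> = less.prems
  have sI: "vec.subspace (\<pi> \<inter> \<sigma>)" using \<pi> assms gens_subspace vec.subspace_inter by blast
  have dd: "vec.dim \<pi> = d" using gens_card[OF \<pi>] dim_eq_iff_card[OF gens_subspace[OF \<pi>]] by simp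
  show ?case
  proof (cases "\<pi> = \<sigma>")
    case True
    then show ?thesis using dd by simp
  next
    case False
    have "\<pi> \<inter> \<sigma> \<noteq> \<pi>" using gen_eq[OF assms(2), of \<pi>] gens_card[OF \<pi>] False by blast
    then have ps: "\<pi> \<inter> \<sigma> \<subset> \<pi>" by auto
    then obtain \<rho> where \<rho>: "vec.subspace \<rho>" "\<pi> \<inter> \<sigma> \<subseteq> \<rho>" "\<rho> \<subset> \<pi>" "card \<pi> = CARD('a) * card \<rho>"
      using hyperplane_between[OF sI gens_subspace[OF \<pi>]] by metis
    have c\<rho>: "card \<rho> * CARD('a) = CARD('a) ^ d" using \<rho>(4) gens_card[OF \<pi>] by (simp add: mult.commute)
    have ts\<rho>: "totally_singular Q \<rho>" and \<rho>S: "\<rho> \<subseteq> S"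
      using ts_mono[OF gens_ts[OF \<pi>] \<rho>(1)] gens_S[OF \<pi>] \<rho> by auto
    have I: "\<rho> \<inter> \<sigma> = \<pi> \<inter> \<sigma>" using \<rho> by auto
    have s\<rho>\<sigma>: "vec.subspace (\<rho> \<inter> \<sigma>)" using sI I by simp
    have "card (\<rho> \<inter> \<sigma>) > 0" using vec.subspace_0[OF s\<rho>\<sigma>] by (auto simp: card_gt_0_iff)
    \<comment> \<open>This yields a vector of \<sigma> that is orthogonal to \<rho> but outside it.
      It is also outside \<pi>, because \<rho> contains \<open>\<pi> \<inter> \<sigma>\<close>, and
      together with \<rho> it spans the adjacent generator.\<close>
    then have "card (\<rho> \<inter> \<sigma>) < card (\<sigma> \<inter> perp Q \<rho>)"
      using card_perp_hyperplane_gen[OF assms(2) ts\<rho> \<rho>S c\<rho>] card_ge_two[where 'a='a] by simp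
    then have "\<not> \<sigma> \<inter> perp Q \<rho> \<subseteq> \<rho> \<inter> \<sigma>" by (intro card_less_not_subset) auto
    then obtain v where v: "v \<in> \<sigma>" "v \<in> perp Q \<rho>" "v \<notin> \<rho>" by auto
    have vS: "v \<in> S" "Q v = 0" using v gens_S[OF assms(2)] ts_Q[OF gens_ts[OF assms(2)]] by auto
    have v\<pi>: "v \<notin> \<pi>" using v \<rho> by auto
    define \<pi>' where "\<pi>' = vec.span (insert v \<rho>)"
    have \<pi>': "\<pi>' \<in> gens"
      unfolding mem_gens \<pi>'_def
      using ts_span_insert[OF ts\<rho> vS(2) v(2)] card_span_insert[OF \<rho>(1) v(3)] c\<rho> \<rho>S vS
      by (simp add: span_insert_subset_iff subspace_S mult.commute)
    have in': "v \<in> \<pi>'" "\<rho> \<subseteq> \<pi>'"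
      using vec.span_superset[of "insert v \<rho>"] by (auto simp: \<pi>'_def)
    have ne: "\<pi> \<noteq> \<pi>'" using in' v\<pi> by auto
    have "\<pi> \<inter> \<sigma> \<subset> \<pi>' \<inter> \<sigma>" using in' v v\<pi> I by auto
    then have "vec.dim (\<pi> \<inter> \<sigma>) < vec.dim (\<pi>' \<inter> \<sigma>)"
      by (intro subspace_psubset_dim sI vec.subspace_inter gens_subspace \<pi>' assms)
    moreover have "vec.dim (\<pi> \<inter> \<sigma>) < d"
      using subspace_psubset_dim[OF sI gens_subspace[OF \<pi>] ps] dd by simp
    ultimately have "even (vec.dim (\<tau> \<inter> \<pi>') + vec.dim (\<tau> \<inter> \<sigma>) + vec.dim (\<pi>' \<inter> \<sigma>) + d)"
      using \<pi>' by (intro less.hyps) auto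
    moreover have "odd (vec.dim (\<tau> \<inter> \<pi>) + vec.dim (\<tau> \<inter> \<pi>'))"
      using \<rho> in' c\<rho> by (intro dim_inter_adjacent[OF \<pi> \<pi>' ne _ _ _ _ assms(3)]) auto
    moreover have "odd (vec.dim (\<sigma> \<inter> \<pi>) + vec.dim (\<sigma> \<inter> \<pi>'))"
      using \<rho> in' c\<rho> by (intro dim_inter_adjacent[OF \<pi> \<pi>' ne _ _ _ _ assms(2)]) auto
    ultimately show ?thesis by (auto simp: Int_commute)
  qed
qed

text \<open>\<open>2 * q ^ d - q ^ (d - 1)\<close> exceeds \<open>q ^ d\<close>, so some singular
  vector orthogonal to \<rho> lies outside \<sigma>.\<close>

lemma adjacent_gen_exists:
  assumes \<sigma>: "\<sigma> \<in> gens" and \<rho>: "vec.subspace \<rho>" "\<rho> \<subseteq> \<sigma>" "card \<rho> * CARD('a) = CARD('a) ^ d"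
  obtains \<sigma>' where "\<sigma>' \<in> gens" "\<rho> \<subseteq> \<sigma>'" "\<sigma>' \<noteq> \<sigma>"
proof -
  let ?N = "{v \<in> S. v \<in> perp Q \<rho> \<and> Q v = 0}"
  have ts\<rho>: "totally_singular Q \<rho>" and \<rho>S: "\<rho> \<subseteq> S"
    using ts_mono[OF gens_ts[OF \<sigma>] \<rho>(1,2)] gens_S[OF \<sigma>] \<rho> by auto
  have "card \<rho> > 0" using vec.subspace_0[OF \<rho>(1)] by (auto simp: card_gt_0_iff)
  then have "card \<rho> < card \<rho> * CARD('a)" using card_ge_two[where 'a='a] by simp
  then have "card \<sigma> < card ?N"
    using card_singular_perp_hyperplane[OF assms] gens_card[OF \<sigma>] \<rho>(3) by simp
  then have "\<not> ?N \<subseteq> \<sigma>" by (intro card_less_not_subset) auto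
  then obtain v where v: "v \<in> S" "v \<in> perp Q \<rho>" "Q v = 0" "v \<notin> \<sigma>" by auto
  then have "v \<notin> \<rho>" using \<rho> by auto
  have "vec.span (insert v \<rho>) \<in> gens"
    unfolding mem_gens
    using ts_span_insert[OF ts\<rho> v(3,2)] card_span_insert[OF \<rho>(1) \<open>v \<notin> \<rho>\<close>] \<rho> \<rho>S v
    by (simp add: span_insert_subset_iff subspace_S mult.commute)
  moreover have "v \<in> vec.span (insert v \<rho>)" "\<rho> \<subseteq> vec.span (insert v \<rho>)"
    using vec.span_superset[of "insert v \<rho>"] by auto
  ultimately show thesis using that v by blast
qed

end

section \<open>Moebius inversion in the subspace lattice\<close>

text \<open>Only the top value of the Moebius function is needed: when all proper superspace sums below
  \<open>U\<close> vanish, inversion leaves the single term \<open>\<mu>(X, U)\<close>.\<close>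

lemma moebius_subspaces:
  fixes \<T> :: "('a::{field,finite}^'n::finite) set set" and w :: "('a^'n) set \<Rightarrow> real"
  assumes sub: "\<And>T. T \<in> \<T> \<Longrightarrow> vec.subspace T"
    and U: "vec.subspace U" and X: "vec.subspace X" "X \<subseteq> U" "card U = CARD('a) ^ i * card X"
    and zero: "\<And>Z. vec.subspace Z \<Longrightarrow> X \<subseteq> Z \<Longrightarrow> Z \<subset> U \<Longrightarrow> (\<Sum>T | T \<in> \<T> \<and> Z \<subseteq> T. w T) = 0"
  shows "(\<Sum>T | T \<in> \<T> \<and> T \<inter> U = X. w T) =
    (-1) ^ i * real CARD('a) ^ (i choose 2) * (\<Sum>T | T \<in> \<T> \<and> U \<subseteq> T. w T)"
  using U X zero
proof (induction i arbitrary: U X)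
  case 0
  then have "X = U" by (intro card_subset_eq) auto
  then have "{T. T \<in> \<T> \<and> T \<inter> U = X} = {T. T \<in> \<T> \<and> U \<subseteq> T}" by auto
  then show ?case by (simp add: binomial_eq_0)
next
  case (Suc i)
  note sU = Suc.prems(1) and sX = Suc.prems(2) and XU = Suc.prems(3) and cU = Suc.prems(4)
    and zero = Suc.prems(5)
  have cX: "card X > 0" using vec.subspace_0[OF sX] by (auto simp: card_gt_0_iff)
  have "X \<noteq> U"
  proof
    assume "X = U"
    then have "CARD('a) ^ Suc i * card X = CARD('a) ^ 0 * card X"
      using cU by (simp only: power_0 mult_1)
    then have "CARD('a) ^ Suc i = CARD('a) ^ 0"
      using cX by (metis mult_cancel2 less_irrefl)
    then show False by (simp only: power_CARD_inject)
  qed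
  then have "X \<subset> U" using XU by auto
  then obtain Y where Y: "vec.subspace Y" "X \<subseteq> Y" "Y \<subset> U" "card U = CARD('a) * card Y"
    using hyperplane_between[OF sX sU] by metis
  have cY: "card Y = CARD('a) ^ i * card X" using Y(4) cU by simp
  define b where "b Z = (\<Sum>T | T \<in> \<T> \<and> T \<inter> U = Z. w T)" for Z
  \<comment> \<open>Weisner's argument: the members with \<open>T \<inter> Y = X\<close> are sorted
    by \<open>Z = T \<inter> U\<close>. As \<open>Y\<close> is a hyperplane of \<open>U\<close>,
    such a \<open>Z\<close> is \<open>X\<close> itself or has dimension one more.\<close>
  define \<Z> where "\<Z> = {Z. vec.subspace Z \<and> Z \<subseteq> U \<and> Z \<inter> Y = X}"
  let ?N = "\<Sum>T | T \<in> \<T> \<and> U \<subseteq> T. w T"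
  have XZ: "X \<in> \<Z>" using sX XU Y(2) by (auto simp: \<Z>_def)
  have cZ: "card Z = CARD('a) * card X" if "Z \<in> \<Z> - {X}" for Z
  proof (rule antisym)
    have Z: "vec.subspace Z" "Z \<subseteq> U" "Z \<inter> Y = X" "Z \<noteq> X" using that by (auto simp: \<Z>_def)
    have "subspace_plus Z Y \<subseteq> U"
      using Z Y sU by (auto simp: subspace_plus_def intro!: vec.subspace_add)
    then have "card (subspace_plus Z Y) \<le> CARD('a) * card Y"
      using Y(4) card_mono[of U "subspace_plus Z Y"] by simp
    then have "card (subspace_plus Z Y) * card X \<le> CARD('a) * card Y * card X"
      by (rule mult_right_mono) simp
    also have "card (subspace_plus Z Y) * card X = card Y * card Z"
      using card_subspace_plus[OF Z(1) Y(1)] Z(3) by (simp add: mult.commute)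
    also have "CARD('a) * card Y * card X = card Y * (CARD('a) * card X)"
      by (simp only: mult_ac)
    finally have "card Y * card Z \<le> card Y * (CARD('a) * card X)" .
    moreover have "card Y > 0" using cY cX by simp
    ultimately show "card Z \<le> CARD('a) * card X" by simp
    have "X \<subset> Z" using Z by auto
    then show "CARD('a) * card X \<le> card Z"
      by (rule subspace_psubset_card[OF sX Z(1)])
  qed
  \<comment> \<open>\<open>Z\<close> has codimension \<open>i\<close> in \<open>U\<close>, so the
    induction hypothesis applies to the pair \<open>Z\<close>, \<open>U\<close> and gives one value
    for all these \<open>Z\<close>.\<close>
  have bZ: "b Z = (-1) ^ i * real CARD('a) ^ (i choose 2) * ?N" if "Z \<in> \<Z> - {X}" for Z
  proof -
    have Z: "vec.subspace Z" "Z \<subseteq> U" "X \<subseteq> Z" using that by (auto simp: \<Z>_def)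
    have "card U = CARD('a) ^ i * card Z" using cZ[OF that] cU by simp
    then show ?thesis
      unfolding b_def using Z zero by (intro Suc.IH sU) auto
  qed
  \<comment> \<open>The induction hypothesis for the pair \<open>X\<close>, \<open>Y\<close> makes
    this a multiple of the sum over the members above \<open>Y\<close>, which vanishes because
    \<open>Y\<close> is proper in \<open>U\<close>.\<close>
  have "0 = (\<Sum>T | T \<in> \<T> \<and> T \<inter> Y = X. w T)"
  proof -
    have "(\<Sum>T | T \<in> \<T> \<and> T \<inter> Y = X. w T) =
      (-1) ^ i * real CARD('a) ^ (i choose 2) * (\<Sum>T | T \<in> \<T> \<and> Y \<subseteq> T. w T)"
      using Y zero by (intro Suc.IH cY sX) auto
    then show ?thesis using zero[OF Y(1,2,3)] by simp
  qed
  also have "\<dots> = (\<Sum>Z\<in>\<Z>. \<Sum>T\<in>{T \<in> {T. T \<in> \<T> \<and> T \<inter> Y = X}. T \<inter> U = Z}. w T)"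
    by (rule sum.group[symmetric])
      (use sub sU Y in \<open>auto simp: \<Z>_def intro: vec.subspace_inter\<close>)
  also have "\<dots> = (\<Sum>Z\<in>\<Z>. b Z)"
  proof (rule sum.cong[OF refl])
    fix Z assume "Z \<in> \<Z>"
    then have "{T \<in> {T. T \<in> \<T> \<and> T \<inter> Y = X}. T \<inter> U = Z} = {T. T \<in> \<T> \<and> T \<inter> U = Z}"
      using Y(3) by (auto simp: \<Z>_def)
    then show "(\<Sum>T\<in>{T \<in> {T. T \<in> \<T> \<and> T \<inter> Y = X}. T \<inter> U = Z}. w T) = b Z" by (simp add: b_def)
  qed
  also have "\<dots> = b X + (\<Sum>Z\<in>\<Z> - {X}. b Z)"
    using XZ by (intro sum.remove) auto
  also have "(\<Sum>Z\<in>\<Z> - {X}. b Z) = real (card (\<Z> - {X})) * ((-1) ^ i * real CARD('a) ^ (i choose 2) * ?N)"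
    using bZ by simp
  \<comment> \<open>The differences \<open>Z - X\<close> partition \<open>U - Y\<close>, which has
    \<open>(q - 1) * q ^ i * card X\<close> elements, into parts of size
    \<open>(q - 1) * card X\<close>.\<close>
  also have "card (\<Z> - {X}) = CARD('a) ^ i"
  proof -
    have part: "U - Y = (\<Union>Z\<in>\<Z> - {X}. Z - X)"
    proof (intro set_eqI iffI)
      fix z assume z: "z \<in> U - Y"
      let ?Z = "vec.span (insert z X)"
      have zZ: "z \<in> ?Z" "X \<subseteq> ?Z" using vec.span_superset[of "insert z X"] by auto
      have "x \<in> X" if x: "x \<in> ?Z" "x \<in> Y" for x
      proof -
        obtain k u where ku: "u \<in> X" "x = k *s z + u" using mem_span_insert[OF sX] x by blast
        have "k = 0"
        proof (rule ccontr)
          assume k: "k \<noteq> 0"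
          have "x - u \<in> Y" using x ku Y by (intro vec.subspace_diff) auto
          then have "k *s z \<in> Y" using ku by simp
          then have "(1 / k) *s (k *s z) \<in> Y" by (rule vec.subspace_scale[OF Y(1)])
          then show False using z k by (simp add: vec.scale_scale)
        qed
        then show "x \<in> X" using ku by simp
      qed
      then have "?Z \<inter> Y = X" using zZ Y(2) by blast
      moreover have "?Z \<subseteq> U" using z XU by (simp add: span_insert_subset_iff sU)
      ultimately have "?Z \<in> \<Z>" by (simp add: \<Z>_def)
      then show "z \<in> (\<Union>Z\<in>\<Z> - {X}. Z - X)" using zZ z Y(2) by blast
    qed (auto simp: \<Z>_def)
    have disj: "(Z - X) \<inter> (Z' - X) = {}" if Z: "Z \<in> \<Z> - {X}" and Z': "Z' \<in> \<Z> - {X}" and ne: "Z \<noteq> Z'" for Z Z'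
    proof (rule ccontr)
      assume "(Z - X) \<inter> (Z' - X) \<noteq> {}"
      then obtain z where z: "z \<in> Z" "z \<in> Z'" "z \<notin> X" by auto
      have "W = vec.span (insert z X)" if "W \<in> \<Z> - {X}" "z \<in> W" for W
      proof (rule card_subset_eq[symmetric])
        show "vec.span (insert z X) \<subseteq> W"
          using that by (auto simp: \<Z>_def span_insert_subset_iff)
        show "card (vec.span (insert z X)) = card W"
          using cZ[OF that(1)] card_span_insert[OF sX z(3)] by simp
      qed simp
      then show False using ne Z Z' z by blast
    qed
    have "card (U - Y) = (\<Sum>Z\<in>\<Z> - {X}. card (Z - X))"
      unfolding part using disj by (intro card_UN_disjoint) auto
    also have "\<dots> = (\<Sum>Z\<in>\<Z> - {X}. (CARD('a) - 1) * card X)"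
    proof (rule sum.cong[OF refl])
      fix Z assume Z: "Z \<in> \<Z> - {X}"
      then have "X \<subseteq> Z" by (auto simp: \<Z>_def)
      then show "card (Z - X) = (CARD('a) - 1) * card X"
        using cZ[OF Z] by (simp add: card_Diff_subset diff_mult_distrib)
    qed
    also have "\<dots> = (CARD('a) - 1) * card X * card (\<Z> - {X})" by simp
    finally have "(CARD('a) - 1) * card X * card (\<Z> - {X}) = card U - card Y"
      using Y(3) by (simp add: card_Diff_subset psubset_imp_subset)
    also have "\<dots> = (CARD('a) - 1) * card X * CARD('a) ^ i"
      unfolding Y(4) cY diff_mult_distrib by (simp add: mult_ac)
    finally show ?thesis using cX card_ge_two[where 'a = 'a] by (auto simp: card_gt_0_iff)
  qed
  finally have "b X = - (real CARD('a) ^ i * ((-1) ^ i * real CARD('a) ^ (i choose 2) * ?N))"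
    by simp
  moreover have "Suc i choose 2 = i + (i choose 2)"
    by (simp add: numeral_2_eq_2)
  ultimately show ?case
    unfolding b_def by (simp add: power_add mult_ac)
qed

section \<open>Linear functionals\<close>

text \<open>Functionals are represented by their coefficient vectors, so that the dual space is
  again \<open>'a^'n\<close> and the counting lemmas apply to it.\<close>

definition dotp :: "'a::field^'n::finite \<Rightarrow> 'a^'n \<Rightarrow> 'a" where
  "dotp u v = (\<Sum>i\<in>UNIV. u $ i * v $ i)"

lemma bilin_dotp: "bilin dotp"
  by (auto simp: bilin_def dotp_def algebra_simps sum.distrib sum_distrib_left)

lemma dotp_commute: "dotp u v = dotp v u"
  by (simp add: dotp_def mult.commute)

lemma dotp_axis: "dotp u (axis i 1) = u $ i"
proof -
  have "dotp u (axis i 1) = (\<Sum>j\<in>UNIV. if j = i then u $ j else 0)"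
    unfolding dotp_def by (intro sum.cong) (auto simp: axis_def)
  then show ?thesis by simp
qed

lemma dotp_eq_0: "(\<And>v. dotp u v = 0) \<Longrightarrow> u = 0"
  by (metis dotp_axis vec_eq_iff zero_index)

lemma functional_eq_dotp:
  fixes g :: "'a::field^'n::finite \<Rightarrow> 'a"
  assumes add: "\<And>u v. g (u + v) = g u + g v" and scale: "\<And>c v. g (c *s v) = c * g v"
  shows "g v = dotp (\<chi> i. g (axis i 1)) v"
proof -
  have 0: "g 0 = 0" using scale[of 0 0] by simp
  have s: "g (sum h A) = (\<Sum>i\<in>A. g (h i))" if "finite A" for h :: "'n \<Rightarrow> 'a^'n" and A
    using that by (induction A) (auto simp: 0 add)
  have "g v = g (\<Sum>i\<in>UNIV. v $ i *s axis i 1)" by (simp add: basis_expansion)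
  also have "\<dots> = (\<Sum>i\<in>UNIV. v $ i * g (axis i 1))" by (simp add: s scale)
  finally show ?thesis by (simp add: dotp_def mult.commute)
qed

definition annihilator :: "('a::field^'n::finite) set \<Rightarrow> ('a^'n) set" where
  "annihilator W = {\<phi>. \<forall>v\<in>W. dotp \<phi> v = 0}"

definition kernel :: "'a::field^'n::finite \<Rightarrow> ('a^'n) set" where
  "kernel \<phi> = {v. dotp \<phi> v = 0}"

lemma mem_annihilator: "\<phi> \<in> annihilator W \<longleftrightarrow> W \<subseteq> kernel \<phi>"
  by (auto simp: annihilator_def kernel_def)

lemma subspace_kernel: "vec.subspace (kernel \<phi>)"
  by (auto simp: vec.subspace_def kernel_def bilinD[OF bilin_dotp])

lemma card_annihilator:
  fixes W :: "('a::{field,finite}^'n::finite) set"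
  assumes W: "vec.subspace W"
  shows "card W * card (annihilator W) = CARD('a^'n)"
proof -
  have "{a \<in> W. \<forall>e\<in>UNIV. dotp a e = 0} = {0}"
    using dotp_eq_0 vec.subspace_0[OF W] by (auto simp: bilinD[OF bilin_dotp])
  moreover have "{e \<in> UNIV. \<forall>a\<in>W. dotp a e = 0} = annihilator W"
    by (auto simp: annihilator_def dotp_commute)
  ultimately show ?thesis
    using card_perp_duality[OF bilin_dotp W vec.subspace_UNIV] by simp
qed

lemma card_kernel:
  fixes \<phi> :: "'a::{field,finite}^'n::finite"
  assumes "\<phi> \<noteq> 0"
  shows "CARD('a) * card (kernel \<phi>) = CARD('a^'n)"
proof -
  obtain v where "dotp \<phi> v \<noteq> 0" using assms dotp_eq_0 by blast
  then show ?thesis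
    using card_fibers_additive[OF vec.subspace_UNIV, of "dotp \<phi>" v 0]
    by (simp add: kernel_def bilinD[OF bilin_dotp])
qed

section \<open>Parabolic quadrics and their hyperbolic classes\<close>

locale parabolic_quadric = quadratic_space Q UNIV d "d + 1" for Q :: "'a::{field,finite}^'n::finite \<Rightarrow> 'a" and d
begin

lemma gens_quadric_subspaces: "gens = quadric_subspaces d Q"
  by (simp add: gens_def)

lemma card_vec: "CARD('a^'n) = CARD('a) ^ (2 * d + 1)"
  using card_S by (simp add: mult_2)

text \<open>For a nonzero functional, the kernel is the tangent hyperplane at the singular point
  \<open>r\<close>. The zero functional counts as tangent, so that the other functionals all have
  hyperplanes as kernels.\<close>

definition tangent :: "'a^'n \<Rightarrow> bool" where
  "tangent \<phi> \<longleftrightarrow> (\<exists>r. Q r = 0 \<and> (\<forall>v. B r v = dotp \<phi> v))"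

lemma tangent_0: "tangent 0"
  unfolding tangent_def by (intro exI[of _ 0]) (auto simp: B_simps bilinD[OF bilin_dotp])

text \<open>If the quadric were singular on the kernel, there would be a nonzero singular
  \<open>v\<close> whose form \<open>B v\<close> vanishes on the kernel of \<phi>. Two functionals
  related in this way are proportional, so \<phi> would be tangent.\<close>

lemma hyperbolic_kernel:
  assumes \<phi>: "\<not> tangent \<phi>" and \<pi>: "\<pi> \<in> gens" "\<pi> \<subseteq> kernel \<phi>"
  shows "hyperbolic_hyperplane d Q (kernel \<phi>)"
  unfolding hyperbolic_hyperplane_def
proof (intro conjI)
  show "vec.subspace (kernel \<phi>)" by (rule subspace_kernel)
  have "\<phi> \<noteq> 0" using \<phi> tangent_0 by auto
  then have "CARD('a) * card (kernel \<phi>) = CARD('a) * CARD('a) ^ (2 * d)"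
    using card_kernel[of \<phi>] card_vec by simp
  then have "card (kernel \<phi>) = CARD('a) ^ (2 * d)" by simp
  then show "vec.dim (kernel \<phi>) = 2 * d"
    using dim_eq_iff_card[OF subspace_kernel, where k = "2 * d"] by blast
  show "\<exists>\<pi>\<in>quadric_subspaces d Q. \<pi> \<subseteq> kernel \<phi>"
    using \<pi> by (auto simp: gens_quadric_subspaces)
  show "nonsingular_on (kernel \<phi>) Q"
    unfolding nonsingular_on_def
  proof (intro ballI impI, elim conjE)
    fix v assume v: "v \<in> kernel \<phi>" "Q v = 0" "\<forall>w\<in>kernel \<phi>. B v w = 0"
    show "v = 0"
    proof (rule ccontr)
      assume "v \<noteq> 0"
      then obtain e where e: "B v e \<noteq> 0"
        using nonsing v(2) unfolding nonsingular_on_def by blast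
      then have e': "dotp \<phi> e \<noteq> 0" using v(3) by (auto simp: kernel_def)
      \<comment> \<open>The factor that makes \<phi> and \<open>B (?c *s v)\<close> agree at
        \<open>e\<close>; they agree everywhere because every vector is a multiple of
        \<open>e\<close> plus an element of the kernel.\<close>
      let ?c = "dotp \<phi> e / B v e"
      have "B (?c *s v) w = dotp \<phi> w" for w
      proof -
        let ?t = "dotp \<phi> w / dotp \<phi> e"
        have "dotp \<phi> (w + (- ?t) *s e) = dotp \<phi> w + (- ?t) * dotp \<phi> e"
          by (simp only: bilinD[OF bilin_dotp])
        then have "w + (- ?t) *s e \<in> kernel \<phi>"
          using e' by (simp add: kernel_def)
        then have "B v (w + (- ?t) *s e) = 0" using v(3) by blast
        then have "B v w + (- ?t) * B v e = 0" by (simp only: B_simps)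
        then have "B v w = ?t * B v e" by simp
        then show ?thesis using e e' by (simp add: B_simps)
      qed
      moreover have "Q (?c *s v) = 0" using v(2) by (simp add: Q_scale)
      ultimately show False using \<phi> unfolding tangent_def by blast
    qed
  qed
qed

text \<open>The bijection sends \<open>r\<close> to \<open>B r\<close>. A singular \<open>r\<close>
  whose form vanishes on \<open>W\<close>, hence on \<pi>, lies in \<pi> by maximality; injectivity
  holds because the difference of two vectors of \<pi> is singular, so it is zero once it lies in
  the radical.\<close>

lemma card_tangent_annihilator:
  assumes \<pi>: "\<pi> \<in> gens" and W: "\<pi> \<subseteq> W"
  shows "card {\<phi> \<in> annihilator W. tangent \<phi>} = card (\<pi> \<inter> perp Q W)"
proof -
  define g where "g r = (\<chi> i. B r (axis i 1))" for r
  have g: "dotp (g r) v = B r v" for r v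
    unfolding g_def by (rule functional_eq_dotp[symmetric]) (simp_all add: B_simps)
  have g_unique: "\<phi> = g r" if "\<forall>v. B r v = dotp \<phi> v" for \<phi> r
    using that by (simp add: g_def vec_eq_iff dotp_axis)
  have "bij_betw g (\<pi> \<inter> perp Q W) {\<phi> \<in> annihilator W. tangent \<phi>}"
  proof (rule bij_betw_imageI)
    show "inj_on g (\<pi> \<inter> perp Q W)"
    proof (rule inj_onI)
      fix r s assume rs: "r \<in> \<pi> \<inter> perp Q W" "s \<in> \<pi> \<inter> perp Q W" "g r = g s"
      have "r - s \<in> \<pi>" using rs gens_subspace[OF \<pi>] by (auto intro: vec.subspace_diff)
      then have "Q (r - s) = 0" using ts_Q[OF gens_ts[OF \<pi>]] by blast
      moreover have "B (r - s) v = 0" for v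
      proof -
        have "B r v = B s v" using rs(3) g by metis
        moreover have "B (r - s) v + B s v = B r v" by (simp flip: B_simps(1))
        ultimately show ?thesis by simp
      qed
      ultimately have "r - s = 0" using nonsing unfolding nonsingular_on_def by blast
      then show "r = s" by simp
    qed
    show "g ` (\<pi> \<inter> perp Q W) = {\<phi> \<in> annihilator W. tangent \<phi>}"
    proof (intro set_eqI iffI)
      fix \<phi> assume "\<phi> \<in> g ` (\<pi> \<inter> perp Q W)"
      then obtain r where r: "r \<in> \<pi>" "r \<in> perp Q W" "\<phi> = g r" by auto
      then have "tangent \<phi>"
        using ts_Q[OF gens_ts[OF \<pi>]] g unfolding tangent_def by metis
      moreover have "\<phi> \<in> annihilator W"
        using r g B_sym by (auto simp: annihilator_def perp_def)
      ultimately show "\<phi> \<in> {\<phi> \<in> annihilator W. tangent \<phi>}" by simp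
    next
      fix \<phi> assume "\<phi> \<in> {\<phi> \<in> annihilator W. tangent \<phi>}"
      then obtain r where r: "Q r = 0" "\<forall>v. B r v = dotp \<phi> v" and \<phi>: "\<phi> \<in> annihilator W"
        by (auto simp: tangent_def)
      have rW: "r \<in> perp Q W" using r \<phi> B_sym by (auto simp: annihilator_def perp_def)
      then have "r \<in> \<pi>"
        using singular_perp_gen[OF \<pi> _ r(1)] perp_antimono[OF W] by auto
      then show "\<phi> \<in> g ` (\<pi> \<inter> perp Q W)" using rW g_unique[OF r(2)] by blast
    qed
  qed
  then show ?thesis by (simp add: bij_betw_same_card)
qed

lemma card_hyperbolic_functionals:
  assumes \<pi>: "\<pi> \<in> gens" and W: "\<pi> \<subseteq> W" "vec.subspace W"
  shows "card W * (card {\<phi>. \<not> tangent \<phi> \<and> W \<subseteq> kernel \<phi>} + card (\<pi> \<inter> perp Q W)) = CARD('a) ^ (2 * d + 1)"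
proof -
  let ?A = "{\<phi>. \<not> tangent \<phi> \<and> W \<subseteq> kernel \<phi>}" and ?T = "{\<phi> \<in> annihilator W. tangent \<phi>}"
  have "annihilator W = ?A \<union> ?T" "?A \<inter> ?T = {}" by (auto simp: mem_annihilator)
  then have "card (annihilator W) = card ?A + card ?T"
    by (metis card_Un_disjoint finite)
  then show ?thesis
    using card_annihilator[OF W(2)] card_vec card_tangent_annihilator[OF \<pi> W(1)] by simp
qed

text \<open>The annihilator of \<open>\<pi> + \<tau>\<close> has
  \<open>q * card (\<pi> \<inter> \<tau>)\<close> elements, of which
  \<open>card (\<pi> \<inter> \<tau>)\<close> are tangent: a vector of \<pi> orthogonal to \<tau>
  lies in \<tau>.\<close>

lemma card_hyperbolic_functionals_pair:
  assumes \<pi>: "\<pi> \<in> gens" and \<tau>: "\<tau> \<in> gens"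
  shows "card {\<phi>. \<not> tangent \<phi> \<and> \<pi> \<subseteq> kernel \<phi> \<and> \<tau> \<subseteq> kernel \<phi>} = (CARD('a) - 1) * card (\<pi> \<inter> \<tau>)"
proof -
  let ?W = "subspace_plus \<pi> \<tau>"
  let ?X = "{\<phi>. \<not> tangent \<phi> \<and> ?W \<subseteq> kernel \<phi>}"
  have s: "vec.subspace \<pi>" "vec.subspace \<tau>" using \<pi> \<tau> gens_subspace by auto
  have W: "\<pi> \<subseteq> ?W" "\<tau> \<subseteq> ?W" using subspace_plus_upper[OF s] .
  have "?W \<subseteq> kernel \<phi> \<longleftrightarrow> \<pi> \<subseteq> kernel \<phi> \<and> \<tau> \<subseteq> kernel \<phi>" for \<phi>
    using W subspace_kernel[of \<phi>] by (auto simp: subspace_plus_def intro: vec.subspace_add)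
  then have eq: "{\<phi>. \<not> tangent \<phi> \<and> \<pi> \<subseteq> kernel \<phi> \<and> \<tau> \<subseteq> kernel \<phi>} = ?X" by auto
  have perpW: "\<pi> \<inter> perp Q ?W = \<pi> \<inter> \<tau>"
  proof (intro set_eqI iffI)
    fix v assume v: "v \<in> \<pi> \<inter> perp Q ?W"
    then have "v \<in> perp Q \<tau>" using perp_antimono[OF W(2)] by auto
    then show "v \<in> \<pi> \<inter> \<tau>" using v singular_perp_gen[OF \<tau>] ts_Q[OF gens_ts[OF \<pi>]] by auto
  next
    fix v assume v: "v \<in> \<pi> \<inter> \<tau>"
    then show "v \<in> \<pi> \<inter> perp Q ?W"
      using ts_B[OF gens_ts[OF \<pi>]] ts_B[OF gens_ts[OF \<tau>]]
      by (auto simp: perp_def subspace_plus_def B_simps)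
  qed
  have 1: "card ?W * (card ?X + card (\<pi> \<inter> \<tau>)) = CARD('a) ^ (2 * d + 1)"
    using card_hyperbolic_functionals[OF \<pi> W(1) subspace_subspace_plus[OF s]] perpW by simp
  have 2: "card ?W * card (\<pi> \<inter> \<tau>) = CARD('a) ^ (2 * d)"
    using card_subspace_plus[OF s] gens_card \<pi> \<tau> by (simp add: mult_2 power_add)
  have "card ?W * (card ?X + card (\<pi> \<inter> \<tau>)) = card ?W * (CARD('a) * card (\<pi> \<inter> \<tau>))"
    using 1 2 by simp
  moreover have "card ?W \<noteq> 0" using 2 by (intro notI) simp
  ultimately have "card ?X + card (\<pi> \<inter> \<tau>) = CARD('a) * card (\<pi> \<inter> \<tau>)" by simp
  then show ?thesis unfolding eq by (simp add: diff_mult_distrib)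
qed

lemma card_hyperbolic_functionals_gen:
  assumes "\<pi> \<in> gens"
  shows "card {\<phi>. \<not> tangent \<phi> \<and> \<pi> \<subseteq> kernel \<phi>} = (CARD('a) - 1) * CARD('a) ^ d"
  using card_hyperbolic_functionals_pair[OF assms assms] gens_card[OF assms] by simp

text \<open>The annihilator of the span of \<open>p\<close> and \<pi> has \<open>q ^ d\<close>
  elements, of which \<open>q ^ (d - 1)\<close> are tangent. That this is smaller than the count for
  a \<open>p\<close> inside \<pi> is what later isolates the generators through
  \<open>p\<close>.\<close>

lemma card_hyperbolic_functionals_point:
  assumes \<pi>: "\<pi> \<in> gens" and p: "Q p = 0" "p \<notin> \<pi>"
  shows "card {\<phi>. \<not> tangent \<phi> \<and> \<pi> \<subseteq> kernel \<phi> \<and> p \<in> kernel \<phi>} = (CARD('a) - 1) * CARD('a) ^ (d - 1)"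
proof -
  let ?W = "vec.span (insert p \<pi>)"
  let ?X = "{\<phi>. \<not> tangent \<phi> \<and> ?W \<subseteq> kernel \<phi>}"
  have eq: "{\<phi>. \<not> tangent \<phi> \<and> \<pi> \<subseteq> kernel \<phi> \<and> p \<in> kernel \<phi>} = ?X"
    by (auto simp: span_insert_subset_iff subspace_kernel)
  have W: "insert p \<pi> \<subseteq> ?W" by (rule vec.span_superset)
  have cW: "card ?W = CARD('a) * CARD('a) ^ d"
    using card_span_insert[OF gens_subspace[OF \<pi>] p(2)] gens_card[OF \<pi>] by simp
  have perpW: "\<pi> \<inter> perp Q ?W = {v \<in> \<pi>. B p v = 0}"
  proof (intro set_eqI iffI)
    fix v assume v: "v \<in> {v \<in> \<pi>. B p v = 0}"
    have "B u v = 0" if u: "u \<in> ?W" for u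
    proof -
      obtain k e where e: "e \<in> \<pi>" "u = k *s p + e"
        using u unfolding mem_span_insert[OF gens_subspace[OF \<pi>]] by auto
      then have "B e v = 0" using v ts_B[OF gens_ts[OF \<pi>]] by simp
      then show ?thesis using v e by (simp add: B_simps)
    qed
    then show "v \<in> \<pi> \<inter> perp Q ?W" using v by (auto simp: perp_def)
  qed (use W in \<open>auto simp: perp_def\<close>)
  have "\<not> (\<forall>e\<in>\<pi>. B e p = 0)"
    using singular_perp_gen[OF \<pi> UNIV_I p(1)] p(2) by (auto simp: perp_def)
  then obtain e where "e \<in> \<pi>" "B p e \<noteq> 0" using B_sym by metis
  then have "CARD('a) * card {v \<in> \<pi>. B p v = 0} = CARD('a) ^ d"
    using card_fibers_additive[OF gens_subspace[OF \<pi>], of "B p" e 0] gens_card[OF \<pi>]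
    by (simp add: B_simps)
  moreover have d: "CARD('a) ^ d = CARD('a) * CARD('a) ^ (d - 1)"
    using dm by (simp flip: power_Suc)
  ultimately have c: "card (\<pi> \<inter> perp Q ?W) = CARD('a) ^ (d - 1)"
    using perpW by simp
  have "(CARD('a) * CARD('a) ^ d) * (card ?X + CARD('a) ^ (d - 1)) = (CARD('a) * CARD('a) ^ d) * CARD('a) ^ d"
    using card_hyperbolic_functionals[OF \<pi> _ vec.subspace_span, of "insert p \<pi>"] W cW c
    by (simp add: mult_2 power_add)
  then have "card ?X + CARD('a) ^ (d - 1) = CARD('a) ^ d" by simp
  then show ?thesis unfolding eq by (simp add: d diff_mult_distrib)
qed

lemma hyperbolic_space:
  assumes H: "hyperbolic_hyperplane d Q H"
  shows "hyperbolic_space Q H d"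
proof
  show "vec.subspace H" "nonsingular_on H Q" using H by (auto simp: hyperbolic_hyperplane_def)
  then show "card H = CARD('a) ^ (d + d)"
    using H dim_eq_iff_card[of H "2 * d"] by (simp add: hyperbolic_hyperplane_def mult_2)
  show "0 < d" "d \<le> d" "d \<le> d + 1" using dm by auto
qed

definition gens_in :: "('a^'n) set \<Rightarrow> ('a^'n) set set" where
  "gens_in H = {\<pi> \<in> gens. \<pi> \<subseteq> H}"

lemma gens_in_eq:
  assumes "hyperbolic_hyperplane d Q H"
  shows "quadratic_space.gens Q H d = gens_in H"
proof -
  interpret h: hyperbolic_space Q H d by (rule hyperbolic_space[OF assms])
  show ?thesis by (simp add: h.gens_def gens_in_def gens_quadric_subspaces)
qed

lemma same_class_iff: "(\<pi>, \<tau>) \<in> same_class d \<longleftrightarrow> even (vec.dim (\<pi> \<inter> \<tau>) + d)"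
proof -
  have "(\<pi>, \<tau>) \<in> same_class d \<longleftrightarrow> even ((int (vec.dim (\<pi> \<inter> \<tau>)) - 1) - (int d - 1))"
    unfolding same_class_def mem_Collect_eq case_prod_conv cong_iff_dvd_diff by simp
  also have "\<dots> \<longleftrightarrow> even (int (vec.dim (\<pi> \<inter> \<tau>) + d))"
    by auto
  finally show ?thesis by (simp only: even_of_nat_iff)
qed

definition class_of :: "('a^'n) set \<Rightarrow> ('a^'n) set \<Rightarrow> ('a^'n) set set" where
  "class_of H \<pi> = {\<tau> \<in> gens_in H. even (vec.dim (\<pi> \<inter> \<tau>) + d)}"

lemma quadric_hyperbolic_classes_eq:
  "quadric_hyperbolic_classes d Q =
     {class_of H \<pi> | H \<pi>. hyperbolic_hyperplane d Q H \<and> \<pi> \<in> gens_in H}"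
proof -
  have "(same_class d \<inter> gens_in H \<times> gens_in H) `` {\<pi>} = class_of H \<pi>" if "\<pi> \<in> gens_in H" for H \<pi>
    using that by (auto simp: class_of_def same_class_iff)
  moreover have "quadric_hyperbolic_classes d Q =
    (\<Union>H\<in>{H. hyperbolic_hyperplane d Q H}. gens_in H // (same_class d \<inter> gens_in H \<times> gens_in H))"
    by (simp add: quadric_hyperbolic_classes_def gens_in_def gens_quadric_subspaces Let_def)
  ultimately show ?thesis by (auto simp: quotient_def)
qed

lemma parity_in:
  assumes "hyperbolic_hyperplane d Q H" "\<pi> \<in> gens_in H" "\<sigma> \<in> gens_in H" "\<tau> \<in> gens_in H"
  shows "even (vec.dim (\<tau> \<inter> \<pi>) + vec.dim (\<tau> \<inter> \<sigma>) + vec.dim (\<pi> \<inter> \<sigma>) + d)"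
proof -
  interpret h: hyperbolic_space Q H d by (rule hyperbolic_space[OF assms(1)])
  show ?thesis using h.dim_inter_parity assms gens_in_eq by simp
qed

lemma dim_gen: "\<pi> \<in> gens \<Longrightarrow> vec.dim \<pi> = d"
  using dim_eq_iff_card[OF gens_subspace] gens_card by blast

text \<open>The classes partition the generators of the hyperplane; transitivity of
  \<open>same_class d\<close> there is the parity rule for three generators.\<close>

lemma sum_gens_in_zero:
  fixes w :: "('a^'n) set \<Rightarrow> real"
  assumes H: "hyperbolic_hyperplane d Q H"
    and w: "\<And>C. C \<in> quadric_hyperbolic_classes d Q \<Longrightarrow> sum w C = 0"
  shows "sum w (gens_in H) = 0"
proof -
  let ?r = "same_class d \<inter> gens_in H \<times> gens_in H"
  have eq: "equiv (gens_in H) ?r"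
  proof (rule equivI)
    show "refl_on (gens_in H) ?r"
      by (auto simp: refl_on_def same_class_iff gens_in_def dim_gen)
    show "sym ?r" by (auto simp: sym_def same_class_iff Int_commute)
    show "trans ?r"
    proof (rule transI)
      fix x y z assume xyz: "(x, y) \<in> ?r" "(y, z) \<in> ?r"
      then have "even (vec.dim (x \<inter> y) + d)" "even (vec.dim (y \<inter> z) + d)"
        by (simp_all add: same_class_iff)
      moreover have "even (vec.dim (y \<inter> x) + vec.dim (y \<inter> z) + vec.dim (x \<inter> z) + d)"
        using xyz by (intro parity_in[OF H]) auto
      ultimately have "even (vec.dim (x \<inter> z) + d)" by (auto simp: Int_commute)
      then show "(x, z) \<in> ?r" using xyz by (simp add: same_class_iff)
    qed
  qed auto
  have "sum w (gens_in H) = sum (sum w) (gens_in H // ?r)"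
    using Union_quotient[OF eq] quotient_disj[OF eq]
      sum.Union_disjoint[of "gens_in H // ?r" w] by (metis comp_apply finite)
  also have "\<dots> = 0"
  proof (rule sum.neutral, rule ballI)
    fix C assume "C \<in> gens_in H // ?r"
    then have "C \<in> quadric_hyperbolic_classes d Q"
      using H by (auto simp: quadric_hyperbolic_classes_def gens_in_def gens_quadric_subspaces Let_def)
    then show "sum w C = 0" by (rule w)
  qed
  finally show ?thesis .
qed

end

section \<open>Eigenvectors orthogonal to the hyperbolic classes\<close>

lemma sum_swap_count:
  fixes w :: "'b \<Rightarrow> real"
  assumes "finite A" "finite G"
  shows "(\<Sum>a\<in>A. \<Sum>x | x \<in> G \<and> R a x. w x) = (\<Sum>x\<in>G. w x * real (card {a \<in> A. R a x}))"
  using sum.swap_restrict[OF assms, of "\<lambda>_ x. w x" R] by (simp add: mult.commute)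

lemma sum_arith_choose:
  assumes "j \<le> d"
  shows "(\<Sum>i=j..<d. d - i) = (d - j + 1) choose 2"
  using assms
proof (induction j rule: inc_induct)
  case (step n)
  then have "(\<Sum>i=n..<d. d - i) = (d - n) + ((d - Suc n + 1) choose 2)"
    by (simp add: sum.atLeast_Suc_lessThan)
  also have "d - Suc n + 1 = d - n" using step by simp
  also have "(d - n) + ((d - n) choose 2) = (d - n + 1) choose 2"
    by (simp add: numeral_2_eq_2)
  finally show ?case .
qed (simp add: binomial_eq_0)

lemma choose_two_add: "(a + b) choose 2 = (a choose 2) + (b choose 2) + a * b"
  by (induction a) (simp_all add: numeral_2_eq_2)

text \<open>With \<open>d = k + j\<close> the gap is \<open>k * (j - 1)\<close>; for
  \<open>j\<close> from 1 to \<open>d\<close> it closes only at the two ends.\<close>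

lemma choose_two_strict:
  assumes "2 \<le> j" "j < d"
  shows "(d - j + 1 choose 2) + (j choose 2) < d choose 2"
proof -
  obtain k where k: "d = k + j" "0 < k" using assms less_imp_add_positive[of j d] by (auto simp: add.commute)
  have "(k + 1 choose 2) = k + (k choose 2)" by (simp add: numeral_2_eq_2)
  moreover have "k < k * j" using k assms by simp
  ultimately show ?thesis unfolding k by (simp add: choose_two_add binomial_eq_0)
qed

section \<open>Pencil sums of a vector orthogonal to all hyperbolic classes\<close>

context parabolic_quadric
begin

text \<open>A kernel that contains no generator gives an empty sum, so later sums may run over all
  functionals that are not tangent, elliptic hyperplanes included.\<close>

lemma gens_in_kernel_sum_zero:
  fixes w :: "('a^'n) set \<Rightarrow> real"
  assumes w: "\<And>C. C \<in> quadric_hyperbolic_classes d Q \<Longrightarrow> sum w C = 0"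
    and \<phi>: "\<not> tangent \<phi>"
  shows "(\<Sum>\<pi> | \<pi> \<in> gens \<and> \<pi> \<subseteq> kernel \<phi>. w \<pi>) = 0"
proof (cases "gens_in (kernel \<phi>) = {}")
  case True
  then have "{\<pi>. \<pi> \<in> gens \<and> \<pi> \<subseteq> kernel \<phi>} = {}" by (simp add: gens_in_def)
  then show ?thesis by (simp only: sum.empty)
next
  case False
  then obtain \<pi> where "\<pi> \<in> gens" "\<pi> \<subseteq> kernel \<phi>" by (auto simp: gens_in_def)
  then have "hyperbolic_hyperplane d Q (kernel \<phi>)" using \<phi> by (intro hyperbolic_kernel)
  then have "sum w (gens_in (kernel \<phi>)) = 0" by (rule sum_gens_in_zero[OF _ w])
  then show ?thesis by (simp add: gens_in_def)
qed

text \<open>Summed over all non-tangent functionals, every generator is counted equally often, and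
  that number is positive.\<close>

lemma sum_gens_zero:
  fixes w :: "('a^'n) set \<Rightarrow> real"
  assumes w: "\<And>C. C \<in> quadric_hyperbolic_classes d Q \<Longrightarrow> sum w C = 0"
  shows "sum w gens = 0"
proof -
  have "0 = (\<Sum>\<phi> | \<not> tangent \<phi>. \<Sum>\<pi> | \<pi> \<in> gens \<and> \<pi> \<subseteq> kernel \<phi>. w \<pi>)"
    by (rule sum.neutral[symmetric]) (use gens_in_kernel_sum_zero[OF w] in auto)
  also have "\<dots> = (\<Sum>\<pi>\<in>gens. w \<pi> * real (card {\<phi> \<in> {\<phi>. \<not> tangent \<phi>}. \<pi> \<subseteq> kernel \<phi>}))"
    by (rule sum_swap_count) auto
  also have "\<dots> = (\<Sum>\<pi>\<in>gens. w \<pi> * real ((CARD('a) - 1) * CARD('a) ^ d))"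
    by (rule sum.cong) (simp_all only: mem_Collect_eq card_hyperbolic_functionals_gen)
  also have "\<dots> = sum w gens * real ((CARD('a) - 1) * CARD('a) ^ d)"
    by (rule sum_distrib_right[symmetric])
  finally show ?thesis using card_ge_two[where 'a = 'a] by auto
qed

text \<open>Summed over the non-tangent functionals vanishing at \<open>p\<close>, a generator has
  weight \<open>?a\<close> if it contains \<open>p\<close> and \<open>?b\<close> otherwise. Since
  the total over all generators is zero, \<open>?a - ?b\<close> times the pencil sum
  remains.\<close>

lemma sum_point_zero:
  fixes w :: "('a^'n) set \<Rightarrow> real"
  assumes w: "\<And>C. C \<in> quadric_hyperbolic_classes d Q \<Longrightarrow> sum w C = 0"
    and p: "Q p = 0"
  shows "(\<Sum>\<pi> | \<pi> \<in> gens \<and> p \<in> \<pi>. w \<pi>) = 0"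
proof -
  let ?\<Phi> = "{\<phi>. \<not> tangent \<phi> \<and> p \<in> kernel \<phi>}"
  let ?a = "real ((CARD('a) - 1) * CARD('a) ^ d)" and ?b = "real ((CARD('a) - 1) * CARD('a) ^ (d - 1))"
  have "0 = (\<Sum>\<phi>\<in>?\<Phi>. \<Sum>\<pi> | \<pi> \<in> gens \<and> \<pi> \<subseteq> kernel \<phi>. w \<pi>)"
    by (rule sum.neutral[symmetric]) (use gens_in_kernel_sum_zero[OF w] in auto)
  also have "\<dots> = (\<Sum>\<pi>\<in>gens. w \<pi> * real (card {\<phi> \<in> ?\<Phi>. \<pi> \<subseteq> kernel \<phi>}))"
    by (rule sum_swap_count) auto
  also have "\<dots> = (\<Sum>\<pi>\<in>gens. (if p \<in> \<pi> then w \<pi> * (?a - ?b) else 0) + w \<pi> * ?b)"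
  proof (rule sum.cong[OF refl])
    fix \<pi> assume \<pi>: "\<pi> \<in> gens"
    show "w \<pi> * real (card {\<phi> \<in> ?\<Phi>. \<pi> \<subseteq> kernel \<phi>}) = (if p \<in> \<pi> then w \<pi> * (?a - ?b) else 0) + w \<pi> * ?b"
    proof (cases "p \<in> \<pi>")
      case True
      then have "{\<phi> \<in> ?\<Phi>. \<pi> \<subseteq> kernel \<phi>} = {\<phi>. \<not> tangent \<phi> \<and> \<pi> \<subseteq> kernel \<phi>}" by auto
      then show ?thesis
        using True card_hyperbolic_functionals_gen[OF \<pi>] by (simp only: if_True) (simp add: algebra_simps)
    next
      case False
      have "{\<phi> \<in> ?\<Phi>. \<pi> \<subseteq> kernel \<phi>} = {\<phi>. \<not> tangent \<phi> \<and> \<pi> \<subseteq> kernel \<phi> \<and> p \<in> kernel \<phi>}" by auto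
      then show ?thesis
        using False card_hyperbolic_functionals_point[OF \<pi> p] by (simp only: if_False) simp
    qed
  qed
  also have "\<dots> = (\<Sum>\<pi>\<in>gens. if p \<in> \<pi> then w \<pi> * (?a - ?b) else 0) + sum w gens * ?b"
    by (simp only: sum.distrib sum_distrib_right)
  also have "(\<Sum>\<pi>\<in>gens. if p \<in> \<pi> then w \<pi> * (?a - ?b) else 0) = (\<Sum>\<pi> | \<pi> \<in> gens \<and> p \<in> \<pi>. w \<pi> * (?a - ?b))"
    by (subst sum.inter_filter[symmetric]) auto
  also have "\<dots> = (\<Sum>\<pi> | \<pi> \<in> gens \<and> p \<in> \<pi>. w \<pi>) * (?a - ?b)"
    by (rule sum_distrib_right[symmetric])
  also have "sum w gens = 0" by (rule sum_gens_zero[OF w])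
  finally have "(\<Sum>\<pi> | \<pi> \<in> gens \<and> p \<in> \<pi>. w \<pi>) * (?a - ?b) = 0" by simp
  then have "(\<Sum>\<pi> | \<pi> \<in> gens \<and> p \<in> \<pi>. w \<pi>) = 0 \<or> ?a - ?b = 0"
    by (rule mult_eq_0_iff[THEN iffD1])
  moreover have "?b < ?a"
    using card_ge_two[where 'a = 'a] dm(1) by (auto intro!: power_strict_increasing)
  ultimately show ?thesis by linarith
qed

lemma gens_zero_subspace: "totally_singular Q {0}" "{0} \<subseteq> (UNIV :: ('a^'n) set)"
  "card {0 :: 'a^'n} = CARD('a) ^ 0" "(0::nat) \<le> d"
  by (auto simp: totally_singular_def)

lemma card_gens:
  assumes "gens \<noteq> {}"
  shows "card gens = (\<Prod>i<d. CARD('a) ^ (i + 1) + 1)"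
proof -
  have "{T \<in> gens. {0} \<subseteq> T} = gens" by (auto simp: gens_eq_zero_iff)
  then show ?thesis using card_gens_through[OF refl assms gens_zero_subspace] by simp
qed

lemma card_disjoint_through:
  assumes \<pi>: "\<pi> \<in> gens"
    and U: "totally_singular Q U" "card U = CARD('a) ^ j" "j \<le> d" "U \<inter> \<pi> = {0}"
  shows "card {T \<in> gens. U \<subseteq> T \<and> T \<inter> \<pi> = {0}} = CARD('a) ^ ((d - j + 1) choose 2)"
  using card_gens_through_disjoint[OF \<pi> U(1) _ U(2-4)] sum_arith_choose[OF U(3)] by simp

lemma card_disjoint:
  assumes \<pi>: "\<pi> \<in> gens"
  shows "card {T \<in> gens. T \<inter> \<pi> = {0}} = CARD('a) ^ (d choose 2) * CARD('a) ^ d"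
proof -
  have "{0} \<inter> \<pi> = {0}" using gens_eq_zero_iff[OF \<pi>] by auto
  then have "card {T \<in> gens. {0} \<subseteq> T \<and> T \<inter> \<pi> = {0}} = CARD('a) ^ ((d + 1) choose 2)"
    using card_disjoint_through[OF \<pi> gens_zero_subspace(1,3)] by simp
  moreover have "{T \<in> gens. {0} \<subseteq> T \<and> T \<inter> \<pi> = {0}} = {T \<in> gens. T \<inter> \<pi> = {0}}" by auto
  moreover have "(d + 1) choose 2 = (d choose 2) + d" by (simp add: numeral_2_eq_2)
  ultimately show ?thesis by (simp add: power_add)
qed

text \<open>Summing the eigenvalue equation over the generators through \<open>U\<close> gives
  \<open>(-1) ^ j * q ^ ((d - j + 1) choose 2) * q ^ (j choose 2)\<close> times the pencil sum, by Moebius inversion and the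
  vanishing for smaller subspaces; in absolute value this differs from \<open>q ^ (d choose 2)\<close> for \<open>2 \<le> j < d\<close>.
  The eigenvalue is only taken by \<open>j = 1\<close> and \<open>j = d\<close>.\<close>

lemma pencil_sum_zero:
  fixes w :: "('a^'n) set \<Rightarrow> real"
  assumes w: "\<And>C. C \<in> quadric_hyperbolic_classes d Q \<Longrightarrow> sum w C = 0"
    and eig: "\<And>\<pi>. \<pi> \<in> gens \<Longrightarrow> (\<Sum>T | T \<in> gens \<and> T \<inter> \<pi> = {0}. w T) = - (real CARD('a) ^ (d choose 2) * w \<pi>)"
    and U: "totally_singular Q U" "card U = CARD('a) ^ j" "j < d"
  shows "(\<Sum>T | T \<in> gens \<and> U \<subseteq> T. w T) = 0"
  using U
proof (induction j arbitrary: U rule: less_induct)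
  case (less j)
  have sU: "vec.subspace U" using less.prems ts_subspace by blast
  consider "j = 0" | "j = 1" | "2 \<le> j" by linarith
  then show ?case
  proof cases
    case 1
    then obtain x where "U = {x}" using less.prems(2) by (auto simp: card_1_singleton_iff)
    then have "U = {0}" using vec.subspace_0[OF sU] by simp
    then have "{T. T \<in> gens \<and> U \<subseteq> T} = gens" by (auto simp: gens_eq_zero_iff)
    then show ?thesis using sum_gens_zero[OF w] by (simp only:)
  next
    case 2
    have "\<not> U \<subseteq> {0}"
    proof
      assume "U \<subseteq> {0}"
      then have "card U \<le> 1" using card_mono[of "{0}" U] by simp
      then show False using 2 less.prems(2) card_ge_two[where 'a = 'a] by simp
    qed
    then obtain p where p: "p \<in> U" "p \<noteq> 0" by auto
    have s0: "vec.subspace {0 :: 'a^'n}" by (rule vec.subspace_single_0)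
    have "vec.span (insert p {0}) = U"
    proof (rule card_subset_eq)
      show "vec.span (insert p {0}) \<subseteq> U"
        using p vec.subspace_0[OF sU] by (simp add: span_insert_subset_iff sU)
      show "card (vec.span (insert p {0})) = card U"
        using card_span_insert[OF s0, of p] p 2 less.prems(2) by simp
    qed simp
    then have "U \<subseteq> T \<longleftrightarrow> p \<in> T" if "T \<in> gens" for T
      using span_insert_subset_iff[OF gens_subspace[OF that], of p "{0}"] gens_eq_zero_iff[OF that] by simp
    then have "{T. T \<in> gens \<and> U \<subseteq> T} = {T. T \<in> gens \<and> p \<in> T}" by auto
    then show ?thesis using sum_point_zero[OF w ts_Q[OF less.prems(1) p(1)]] by (simp only:)
  next
    case 3
    let ?q = "real CARD('a)" and ?N = "\<Sum>T | T \<in> gens \<and> U \<subseteq> T. w T"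
    let ?e = "(d - j + 1) choose 2"
    have smaller: "(\<Sum>T | T \<in> gens \<and> Z \<subseteq> T. w T) = 0" if Z: "vec.subspace Z" "Z \<subset> U" for Z
    proof -
      have ts: "totally_singular Q Z" using ts_mono[OF less.prems(1) Z(1)] Z(2) by auto
      have "vec.dim Z < j"
        using subspace_psubset_dim[OF Z(1) sU Z(2)] dim_eq_iff_card[OF sU, of j] less.prems(2) by simp
      then show ?thesis
        using less.IH[OF _ ts card_subspace[OF Z(1)]] less.prems(3) by simp
    qed
    have "(\<Sum>T | T \<in> gens \<and> T \<inter> U = {0}. w T) = (-1) ^ j * ?q ^ (j choose 2) * ?N"
    proof (rule moebius_subspaces)
      show "vec.subspace {0 :: 'a^'n}" by (rule vec.subspace_single_0)
      show "{0} \<subseteq> U" using vec.subspace_0[OF sU] by simp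
      show "card U = CARD('a) ^ j * card {0 :: 'a^'n}" using less.prems(2) by simp
    qed (use sU gens_subspace smaller in auto)
    note moebius = this
    have "- (?q ^ (d choose 2)) * ?N = (\<Sum>T | T \<in> gens \<and> U \<subseteq> T. - (?q ^ (d choose 2) * w T))"
      by (simp add: sum_distrib_left)
    also have "\<dots> = (\<Sum>T | T \<in> gens \<and> U \<subseteq> T. \<Sum>\<pi> | \<pi> \<in> gens \<and> \<pi> \<inter> T = {0}. w \<pi>)"
      by (rule sum.cong[OF refl]) (simp add: eig)
    also have "\<dots> = (\<Sum>\<pi>\<in>gens. w \<pi> * real (card {T \<in> {T. T \<in> gens \<and> U \<subseteq> T}. \<pi> \<inter> T = {0}}))"
      by (rule sum_swap_count) auto
    also have "\<dots> = (\<Sum>\<pi>\<in>gens. if \<pi> \<inter> U = {0} then w \<pi> * ?q ^ ?e else 0)"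
    proof (rule sum.cong[OF refl])
      fix \<pi> assume \<pi>: "\<pi> \<in> gens"
      have eq: "{T \<in> {T. T \<in> gens \<and> U \<subseteq> T}. \<pi> \<inter> T = {0}} = {T \<in> gens. U \<subseteq> T \<and> T \<inter> \<pi> = {0}}"
        by auto
      show "w \<pi> * real (card {T \<in> {T. T \<in> gens \<and> U \<subseteq> T}. \<pi> \<inter> T = {0}}) =
        (if \<pi> \<inter> U = {0} then w \<pi> * ?q ^ ?e else 0)"
      proof (cases "\<pi> \<inter> U = {0}")
        case True
        then have "card {T \<in> gens. U \<subseteq> T \<and> T \<inter> \<pi> = {0}} = CARD('a) ^ ?e"
          using card_disjoint_through[OF \<pi> less.prems(1,2)] less.prems(3) by (simp add: Int_commute)
        then show ?thesis using True unfolding eq by simp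
      next
        case False
        moreover have "0 \<in> \<pi> \<inter> U" using gens_eq_zero_iff[OF \<pi>] vec.subspace_0[OF sU] by simp
        ultimately obtain x where x: "x \<in> \<pi>" "x \<in> U" "x \<noteq> 0" by blast
        then have "{T \<in> gens. U \<subseteq> T \<and> T \<inter> \<pi> = {0}} = {}" by auto
        then show ?thesis unfolding eq if_not_P[OF False] by (simp only: card.empty of_nat_0 mult_zero_right)
      qed
    qed
    also have "\<dots> = (\<Sum>\<pi> | \<pi> \<in> gens \<and> \<pi> \<inter> U = {0}. w \<pi> * ?q ^ ?e)"
      by (subst sum.inter_filter[symmetric]) auto
    also have "\<dots> = (\<Sum>\<pi> | \<pi> \<in> gens \<and> \<pi> \<inter> U = {0}. w \<pi>) * ?q ^ ?e"
      by (rule sum_distrib_right[symmetric])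
    also have "\<dots> = (-1) ^ j * ?q ^ (?e + (j choose 2)) * ?N"
      unfolding moebius by (simp only: power_add mult_ac)
    finally have "(?q ^ (d choose 2) + (-1) ^ j * ?q ^ (?e + (j choose 2))) * ?N = 0"
      by (simp only: distrib_right)
    moreover have "?q ^ (?e + (j choose 2)) < ?q ^ (d choose 2)"
      using choose_two_strict[OF 3 less.prems(3)] card_ge_two[where 'a = 'a]
      by (intro power_strict_increasing) auto
    then have "?q ^ (d choose 2) + (-1) ^ j * ?q ^ (?e + (j choose 2)) > 0"
      by (cases "even j") (auto simp: add_pos_pos)
    ultimately show ?thesis by simp
  qed
qed

lemma class_of_kernel:
  assumes "\<not> tangent \<phi>" "\<pi> \<in> gens" "\<pi> \<subseteq> kernel \<phi>"
  shows "class_of (kernel \<phi>) \<pi> \<in> quadric_hyperbolic_classes d Q"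
proof -
  have "hyperbolic_hyperplane d Q (kernel \<phi>)" "\<pi> \<in> gens_in (kernel \<phi>)"
    using assms hyperbolic_kernel by (auto simp: gens_in_def)
  then show ?thesis unfolding quadric_hyperbolic_classes_eq by blast
qed

text \<open>Once all pencil sums of proper subspaces vanish, the sum over the generators meeting \<open>\<pi>\<close> in a
  given subspace of even codimension is a positive multiple of \<open>w \<pi>\<close>; hence so is the total of the sums over
  the hyperbolic classes through \<open>\<pi>\<close>.\<close>

lemma eigenvector_orthogonal_classes_zero:
  fixes w :: "('a^'n) set \<Rightarrow> real"
  assumes w: "\<And>C. C \<in> quadric_hyperbolic_classes d Q \<Longrightarrow> sum w C = 0"
    and eig: "\<And>\<pi>. \<pi> \<in> gens \<Longrightarrow> (\<Sum>T | T \<in> gens \<and> T \<inter> \<pi> = {0}. w T) = - (real CARD('a) ^ (d choose 2) * w \<pi>)"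
    and \<pi>: "\<pi> \<in> gens"
  shows "w \<pi> = 0"
proof -
  let ?q = "real CARD('a)"
  have s\<pi>: "vec.subspace \<pi>" by (rule gens_subspace[OF \<pi>])
  define \<X> where "\<X> = {X. vec.subspace X \<and> X \<subseteq> \<pi> \<and> even (vec.dim X + d)}"
  \<comment> \<open>The first factor is the number of non-tangent functionals vanishing on \<pi> and
    on a generator that meets it in \<open>X\<close>; the second is the absolute value of the
    Moebius function between \<open>X\<close> and \<pi>.\<close>
  define f where "f X = real ((CARD('a) - 1) * card X) * ?q ^ ((d - vec.dim X) choose 2)" for X :: "('a^'n) set"
  have N\<pi>: "(\<Sum>T | T \<in> gens \<and> \<pi> \<subseteq> T. w T) = w \<pi>"
  proof -
    have "T = \<pi>" if "T \<in> gens" "\<pi> \<subseteq> T" for T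
      using gen_eq[OF that gens_card[OF \<pi>]] by simp
    then have "{T. T \<in> gens \<and> \<pi> \<subseteq> T} = {\<pi>}" using \<pi> by auto
    then show ?thesis by (simp only:) simp
  qed
  have b: "(\<Sum>T | T \<in> gens \<and> T \<inter> \<pi> = X. w T) = ?q ^ ((d - vec.dim X) choose 2) * w \<pi>" if X: "X \<in> \<X>" for X
  proof -
    have sX: "vec.subspace X" "X \<subseteq> \<pi>" "even (vec.dim X + d)" using X by (auto simp: \<X>_def)
    have le: "vec.dim X \<le> d" using vec.dim_subset[OF sX(2)] dim_gen[OF \<pi>] by simp
    have "(\<Sum>T | T \<in> gens \<and> T \<inter> \<pi> = X. w T) =
      (-1) ^ (d - vec.dim X) * ?q ^ ((d - vec.dim X) choose 2) * (\<Sum>T | T \<in> gens \<and> \<pi> \<subseteq> T. w T)"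
    proof (rule moebius_subspaces[OF gens_subspace s\<pi> sX(1,2)])
      show "card \<pi> = CARD('a) ^ (d - vec.dim X) * card X"
        using gens_card[OF \<pi>] card_subspace[OF sX(1)] le by (simp flip: power_add)
      fix Z assume Z: "vec.subspace Z" "X \<subseteq> Z" "Z \<subset> \<pi>"
      have "totally_singular Q Z" using ts_mono[OF gens_ts[OF \<pi>] Z(1)] Z(3) by auto
      moreover have "vec.dim Z < d" using subspace_psubset_dim[OF Z(1) s\<pi> Z(3)] dim_gen[OF \<pi>] by simp
      ultimately show "(\<Sum>T | T \<in> gens \<and> Z \<subseteq> T. w T) = 0"
        by (intro pencil_sum_zero[OF w eig _ card_subspace[OF Z(1)]])
    qed
    moreover have "even (d - vec.dim X)" using sX(3) le by auto
    ultimately show ?thesis using N\<pi> by simp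
  qed
  have "0 = (\<Sum>\<phi> | \<not> tangent \<phi> \<and> \<pi> \<subseteq> kernel \<phi>. sum w (class_of (kernel \<phi>) \<pi>))"
    by (rule sum.neutral[symmetric]) (use w class_of_kernel \<pi> in auto)
  also have "\<dots> = (\<Sum>\<phi> | \<not> tangent \<phi> \<and> \<pi> \<subseteq> kernel \<phi>.
      \<Sum>\<tau> | \<tau> \<in> {\<tau> \<in> gens. even (vec.dim (\<tau> \<inter> \<pi>) + d)} \<and> \<tau> \<subseteq> kernel \<phi>. w \<tau>)"
    by (intro sum.cong refl) (auto simp: class_of_def gens_in_def Int_commute)
  also have "\<dots> = (\<Sum>\<tau>\<in>{\<tau> \<in> gens. even (vec.dim (\<tau> \<inter> \<pi>) + d)}.
      w \<tau> * real (card {\<phi> \<in> {\<phi>. \<not> tangent \<phi> \<and> \<pi> \<subseteq> kernel \<phi>}. \<tau> \<subseteq> kernel \<phi>}))"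
    by (rule sum_swap_count) auto
  also have "\<dots> = (\<Sum>\<tau>\<in>{\<tau> \<in> gens. even (vec.dim (\<tau> \<inter> \<pi>) + d)}.
      w \<tau> * real ((CARD('a) - 1) * card (\<tau> \<inter> \<pi>)))"
  proof (rule sum.cong[OF refl])
    fix \<tau> assume "\<tau> \<in> {\<tau> \<in> gens. even (vec.dim (\<tau> \<inter> \<pi>) + d)}"
    then have \<tau>: "\<tau> \<in> gens" by simp
    have "{\<phi> \<in> {\<phi>. \<not> tangent \<phi> \<and> \<pi> \<subseteq> kernel \<phi>}. \<tau> \<subseteq> kernel \<phi>} =
      {\<phi>. \<not> tangent \<phi> \<and> \<pi> \<subseteq> kernel \<phi> \<and> \<tau> \<subseteq> kernel \<phi>}" by auto
    then show "w \<tau> * real (card {\<phi> \<in> {\<phi>. \<not> tangent \<phi> \<and> \<pi> \<subseteq> kernel \<phi>}. \<tau> \<subseteq> kernel \<phi>}) =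
      w \<tau> * real ((CARD('a) - 1) * card (\<tau> \<inter> \<pi>))"
      using card_hyperbolic_functionals_pair[OF \<pi> \<tau>] by (simp only: Int_commute)
  qed
  also have "\<dots> = (\<Sum>X\<in>\<X>. \<Sum>\<tau>\<in>{\<tau> \<in> {\<tau> \<in> gens. even (vec.dim (\<tau> \<inter> \<pi>) + d)}. \<tau> \<inter> \<pi> = X}.
      w \<tau> * real ((CARD('a) - 1) * card (\<tau> \<inter> \<pi>)))"
  proof (rule sum.group[symmetric])
    show "(\<lambda>\<tau>. \<tau> \<inter> \<pi>) ` {\<tau> \<in> gens. even (vec.dim (\<tau> \<inter> \<pi>) + d)} \<subseteq> \<X>"
      using vec.subspace_inter[OF gens_subspace s\<pi>] by (auto simp: \<X>_def)
  qed auto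
  also have "\<dots> = (\<Sum>X\<in>\<X>. w \<pi> * f X)"
  proof (rule sum.cong[OF refl])
    fix X assume X: "X \<in> \<X>"
    then have "{\<tau> \<in> {\<tau> \<in> gens. even (vec.dim (\<tau> \<inter> \<pi>) + d)}. \<tau> \<inter> \<pi> = X} = {\<tau>. \<tau> \<in> gens \<and> \<tau> \<inter> \<pi> = X}"
      by (auto simp: \<X>_def)
    then have "(\<Sum>\<tau>\<in>{\<tau> \<in> {\<tau> \<in> gens. even (vec.dim (\<tau> \<inter> \<pi>) + d)}. \<tau> \<inter> \<pi> = X}.
      w \<tau> * real ((CARD('a) - 1) * card (\<tau> \<inter> \<pi>))) =
      (\<Sum>\<tau> | \<tau> \<in> gens \<and> \<tau> \<inter> \<pi> = X. w \<tau> * real ((CARD('a) - 1) * card X))"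
      by (simp only:) (rule sum.cong, auto)
    also have "\<dots> = (\<Sum>\<tau> | \<tau> \<in> gens \<and> \<tau> \<inter> \<pi> = X. w \<tau>) * real ((CARD('a) - 1) * card X)"
      by (rule sum_distrib_right[symmetric])
    also have "\<dots> = w \<pi> * f X" unfolding b[OF X] f_def by (simp only: mult_ac)
    finally show "(\<Sum>\<tau>\<in>{\<tau> \<in> {\<tau> \<in> gens. even (vec.dim (\<tau> \<inter> \<pi>) + d)}. \<tau> \<inter> \<pi> = X}.
      w \<tau> * real ((CARD('a) - 1) * card (\<tau> \<inter> \<pi>))) = w \<pi> * f X" .
  qed
  also have "\<dots> = w \<pi> * sum f \<X>" by (rule sum_distrib_left[symmetric])
  finally have "w \<pi> * sum f \<X> = 0" by simp
  moreover have "sum f \<X> > 0"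
  proof (rule sum_pos2)
    show "\<pi> \<in> \<X>" using s\<pi> dim_gen[OF \<pi>] by (simp add: \<X>_def)
    show "0 < f \<pi>"
      using card_ge_two[where 'a = 'a] gens_card[OF \<pi>] by (auto simp: f_def)
  qed (auto simp: f_def)
  ultimately show ?thesis by simp
qed

end

section \<open>Regularity of the hyperbolic classes\<close>

context parabolic_quadric
begin

lemma card_disjoint_in:
  assumes H: "hyperbolic_hyperplane d Q H" and \<sigma>: "\<sigma> \<in> gens_in H"
  shows "card {\<tau> \<in> gens_in H. \<tau> \<inter> \<sigma> = {0}} = CARD('a) ^ (d choose 2)"
proof -
  interpret h: hyperbolic_space Q H d by (rule hyperbolic_space[OF H])
  have \<sigma>': "\<sigma> \<in> h.gens" using \<sigma> gens_in_eq[OF H] by simp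
  have "0 \<in> H" using h.subspace_S vec.subspace_0 by blast
  have "card {T \<in> h.gens. {0} \<subseteq> T \<and> T \<inter> \<sigma> = {0}} = CARD('a) ^ (\<Sum>i=0..<d. d - 1 - i)"
    using h.card_gens_through_disjoint[OF \<sigma>' gens_zero_subspace(1) _ gens_zero_subspace(3,4)]
      \<open>0 \<in> H\<close> h.gens_eq_zero_iff[OF \<sigma>'] by auto
  moreover have "{T \<in> h.gens. {0} \<subseteq> T \<and> T \<inter> \<sigma> = {0}} = {\<tau> \<in> gens_in H. \<tau> \<inter> \<sigma> = {0}}"
    using gens_in_eq[OF H] by auto
  \<comment> \<open>The summand for \<open>i = d - 1\<close> is zero, so the sum is that of
    \<open>sum_arith_choose\<close> with \<open>d - 1\<close> in place of \<open>d\<close>.\<close>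
  moreover obtain e where "d = Suc e" using dm(1) by (cases d) auto
  then have "(\<Sum>i=0..<d. d - 1 - i) = d choose 2"
    using sum_arith_choose[of 0 e] by simp
  ultimately show ?thesis by simp
qed

lemma card_disjoint_class:
  assumes d: "odd d" and C: "C \<in> quadric_hyperbolic_classes d Q" and \<pi>: "\<pi> \<in> gens"
  shows "card {\<tau> \<in> C. \<pi> \<inter> \<tau> = {0}} = (if \<pi> \<in> C then 0 else CARD('a) ^ (d choose 2))"
proof -
  obtain H \<pi>\<^sub>0 where H: "hyperbolic_hyperplane d Q H" and \<pi>\<^sub>0: "\<pi>\<^sub>0 \<in> gens_in H" and C_eq: "C = class_of H \<pi>\<^sub>0"
    using C by (auto simp: quadric_hyperbolic_classes_eq)
  interpret h: hyperbolic_space Q H d by (rule hyperbolic_space[OF H])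
  note hg = gens_in_eq[OF H]
  have sub0: "vec.subspace (\<alpha> \<inter> \<beta>)" if "\<alpha> \<in> gens" "\<beta> \<in> gens" for \<alpha> \<beta>
    using that gens_subspace vec.subspace_inter by blast
  have parity: "even (vec.dim (\<sigma> \<inter> \<tau>) + vec.dim (\<pi>\<^sub>0 \<inter> \<sigma>))"
    if "\<sigma> \<in> gens_in H" "\<tau> \<in> C" for \<sigma> \<tau>
    using parity_in[OF H \<pi>\<^sub>0 that(1), of \<tau>] that(2)
    by (auto simp: C_eq class_of_def Int_commute)
  \<comment> \<open>Dimension 0 has the parity opposite to the odd \<open>d\<close>, so disjoint
    generators of \<open>H\<close> belong to different classes; for \<sigma> outside
    \<open>C\<close> all its disjoint partners in \<open>H\<close> are in \<open>C\<close>.\<close>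
  have inside: "card {\<tau> \<in> C. \<sigma> \<inter> \<tau> = {0}} = (if \<sigma> \<in> C then 0 else CARD('a) ^ (d choose 2))"
    if \<sigma>: "\<sigma> \<in> gens_in H" for \<sigma>
  proof (cases "\<sigma> \<in> C")
    case True
    have "\<sigma> \<inter> \<tau> \<noteq> {0}" if "\<tau> \<in> C" for \<tau>
    proof
      assume "\<sigma> \<inter> \<tau> = {0}"
      then have "even (vec.dim (\<pi>\<^sub>0 \<inter> \<sigma>))" using parity[OF \<sigma> that] by simp
      then show False using True d by (simp add: C_eq class_of_def)
    qed
    then have "{\<tau> \<in> C. \<sigma> \<inter> \<tau> = {0}} = {}" unfolding Collect_empty_eq by metis
    then show ?thesis using True by (simp only: card.empty if_True)
  next
    case False
    have "\<tau> \<in> C" if \<tau>: "\<tau> \<in> gens_in H" "\<tau> \<inter> \<sigma> = {0}" for \<tau>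
    proof -
      have "vec.dim (\<tau> \<inter> \<sigma>) = 0" using \<tau>(2) by simp
      moreover have "odd (vec.dim (\<pi>\<^sub>0 \<inter> \<sigma>) + d)" using False \<sigma> by (simp add: C_eq class_of_def)
      moreover have "even (vec.dim (\<pi>\<^sub>0 \<inter> \<tau>) + vec.dim (\<tau> \<inter> \<sigma>) + vec.dim (\<pi>\<^sub>0 \<inter> \<sigma>) + d)"
        using parity_in[OF H \<pi>\<^sub>0 \<sigma> \<tau>(1)] by (simp only: Int_commute)
      ultimately have "even (vec.dim (\<pi>\<^sub>0 \<inter> \<tau>) + d)" using d by presburger
      then show ?thesis using \<tau>(1) by (simp add: C_eq class_of_def)
    qed
    moreover have "C \<subseteq> gens_in H" by (auto simp: C_eq class_of_def)
    ultimately have "\<tau> \<in> C \<and> \<sigma> \<inter> \<tau> = {0} \<longleftrightarrow> \<tau> \<in> gens_in H \<and> \<tau> \<inter> \<sigma> = {0}" for \<tau>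
      unfolding Int_commute[of \<sigma>] by (metis subsetD)
    then have "{\<tau> \<in> C. \<sigma> \<inter> \<tau> = {0}} = {\<tau> \<in> gens_in H. \<tau> \<inter> \<sigma> = {0}}"
      by (simp only:)
    then show ?thesis using False card_disjoint_in[OF H \<sigma>] by (simp only: if_False)
  qed
  show ?thesis
  proof (cases "\<pi> \<subseteq> H")
    case True
    then show ?thesis using inside \<pi> by (simp add: gens_in_def)
  next
    case False
    define \<rho> where "\<rho> = \<pi> \<inter> H"
    have s: "vec.subspace \<pi>" "vec.subspace H" using gens_subspace[OF \<pi>] h.subspace_S by auto
    have s\<rho>: "vec.subspace \<rho>" unfolding \<rho>_def using s by (rule vec.subspace_inter)
    \<comment> \<open>\<pi> is not contained in the hyperplane \<open>H\<close>, so the two generate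
      the whole space and the dimension formula makes \<rho> a hyperplane of \<pi>.\<close>
    have c\<rho>: "card \<rho> * CARD('a) = CARD('a) ^ d"
    proof -
      let ?W = "subspace_plus \<pi> H"
      have "H \<subset> ?W" using subspace_plus_upper[OF s] False by blast
      then have "CARD('a) * card H \<le> card ?W"
        by (rule subspace_psubset_card[OF s(2) subspace_subspace_plus[OF s]])
      moreover have "card ?W \<le> CARD('a^'n)" by (rule card_mono) auto
      moreover have "CARD('a^'n) = CARD('a) * card H"
        unfolding card_vec h.card_S by (simp add: mult_2)
      ultimately have "card ?W = CARD('a) * card H" by linarith
      then have "(CARD('a) * card \<rho>) * card H = CARD('a) ^ d * card H"
        using card_subspace_plus[OF s] gens_card[OF \<pi>] by (simp add: \<rho>_def mult_ac)
      moreover have "card H \<noteq> 0" unfolding h.card_S by simp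
      ultimately show ?thesis by (metis mult_cancel2 mult.commute)
    qed
    have ts\<rho>: "totally_singular Q \<rho>" and \<rho>H: "\<rho> \<subseteq> H"
      using ts_mono[OF gens_ts[OF \<pi>] s\<rho>] by (auto simp: \<rho>_def)
    obtain \<sigma>\<^sub>1 where \<sigma>\<^sub>1: "\<sigma>\<^sub>1 \<in> h.gens" "\<rho> \<subseteq> \<sigma>\<^sub>1"
    proof -
      have \<pi>0: "\<pi>\<^sub>0 \<in> h.gens" using \<pi>\<^sub>0 hg by simp
      have "\<rho> \<subseteq> subspace_plus \<rho> (\<pi>\<^sub>0 \<inter> perp Q \<rho>)"
        by (rule subspace_plus_upper(1)[OF s\<rho> vec.subspace_inter[OF h.gens_subspace[OF \<pi>0] subspace_perp]])
      then show thesis using that[OF h.gen_through[OF ts\<rho> \<rho>H \<pi>0]] by simp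
    qed
    \<comment> \<open>Adjacent generators have different parity against
      \<open>\<pi>\<^sub>0\<close>, so at least one generator of \<open>H\<close> through \<rho> is
      outside \<open>C\<close>.\<close>
    obtain \<sigma> where \<sigma>: "\<sigma> \<in> h.gens" "\<rho> \<subseteq> \<sigma>" "\<sigma> \<notin> C"
    proof (cases "\<sigma>\<^sub>1 \<in> C")
      case True
      obtain \<sigma>' where \<sigma>': "\<sigma>' \<in> h.gens" "\<rho> \<subseteq> \<sigma>'" "\<sigma>' \<noteq> \<sigma>\<^sub>1"
        using h.adjacent_gen_exists[OF \<sigma>\<^sub>1(1) s\<rho> \<sigma>\<^sub>1(2) c\<rho>] by metis
      have "odd (vec.dim (\<pi>\<^sub>0 \<inter> \<sigma>\<^sub>1) + vec.dim (\<pi>\<^sub>0 \<inter> \<sigma>'))"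
        using h.dim_inter_adjacent[OF \<sigma>\<^sub>1(1) \<sigma>'(1) \<sigma>'(3)[symmetric] s\<rho> \<sigma>\<^sub>1(2) \<sigma>'(2) c\<rho>] \<pi>\<^sub>0 hg by simp
      then have "\<sigma>' \<notin> C" using True by (auto simp: C_eq class_of_def)
      then show thesis using that \<sigma>' by blast
    next
      case False
      then show thesis using that \<sigma>\<^sub>1 by blast
    qed
    have \<sigma>H: "\<sigma> \<in> gens_in H" and \<sigma>g: "\<sigma> \<in> gens" using \<sigma>(1) hg by (auto simp: gens_in_def)
    have "\<pi> \<inter> \<tau> = {0} \<longleftrightarrow> \<sigma> \<inter> \<tau> = {0}" if \<tau>: "\<tau> \<in> C" for \<tau>
    proof -
      have \<tau>H: "\<tau> \<in> gens" "\<tau> \<subseteq> H" using \<tau> by (auto simp: C_eq class_of_def gens_in_def)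
      have st: "vec.subspace (\<sigma> \<inter> \<tau>)" using \<sigma>g \<tau>H(1) by (rule sub0)
      have eq: "\<pi> \<inter> \<tau> = \<rho> \<inter> \<tau>" using \<tau>H by (auto simp: \<rho>_def)
      show ?thesis
      proof
        \<comment> \<open>\<open>\<sigma> \<inter> \<tau>\<close> meets the hyperplane \<rho> of
          \<sigma> trivially, so its dimension is at most 1; as \<sigma> is outside the class of
          \<tau>, the dimension is even and therefore 0.\<close>
        assume z: "\<pi> \<inter> \<tau> = {0}"
        have i: "\<sigma> \<inter> \<tau> \<inter> \<rho> = {0}" using z eq \<sigma>(2) by auto
        have "subspace_plus (\<sigma> \<inter> \<tau>) \<rho> \<subseteq> \<sigma>"
          using \<sigma>(2) gens_subspace[OF \<sigma>g] by (auto simp: subspace_plus_def intro!: vec.subspace_add)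
        then have "card (subspace_plus (\<sigma> \<inter> \<tau>) \<rho>) \<le> card \<sigma>" by (intro card_mono) auto
        then have "card (\<sigma> \<inter> \<tau>) * card \<rho> \<le> CARD('a) * card \<rho>"
          using card_subspace_plus[OF st s\<rho>] gens_card[OF \<sigma>g] c\<rho> i by (simp add: mult.commute)
        moreover have "card \<rho> > 0" using vec.subspace_0[OF s\<rho>] by (auto simp: card_gt_0_iff)
        ultimately have "card (\<sigma> \<inter> \<tau>) \<le> CARD('a) ^ 1" by simp
        then have "CARD('a) ^ vec.dim (\<sigma> \<inter> \<tau>) \<le> CARD('a) ^ 1"
          using card_subspace[OF st] by simp
        then have "vec.dim (\<sigma> \<inter> \<tau>) \<le> 1"
          using card_ge_two[where 'a='a] by (subst (asm) power_increasing_iff) auto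
        moreover have "even (vec.dim (\<sigma> \<inter> \<tau>))"
          using parity[OF \<sigma>H \<tau>] \<sigma>(3) \<sigma>H d by (auto simp: C_eq class_of_def)
        moreover have "n \<le> 1 \<Longrightarrow> even n \<Longrightarrow> n = 0" for n :: nat by presburger
        ultimately have "vec.dim (\<sigma> \<inter> \<tau>) = 0" by metis
        then have "\<sigma> \<inter> \<tau> \<subseteq> {0}" by (simp only: vec.dim_eq_0)
        then show "\<sigma> \<inter> \<tau> = {0}" using vec.subspace_0[OF st] by auto
      next
        assume z: "\<sigma> \<inter> \<tau> = {0}"
        have "0 \<in> \<pi> \<inter> \<tau>" using vec.subspace_0[OF sub0[OF \<pi> \<tau>H(1)]] .
        then show "\<pi> \<inter> \<tau> = {0}" using z eq \<sigma>(2) by auto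
      qed
    qed
    then have "{\<tau> \<in> C. \<pi> \<inter> \<tau> = {0}} = {\<tau> \<in> C. \<sigma> \<inter> \<tau> = {0}}"
      by (intro Collect_cong conj_cong refl)
    moreover have "\<pi> \<notin> C" using False by (auto simp: C_eq class_of_def gens_in_def)
    ultimately show ?thesis using inside[OF \<sigma>H] \<sigma>(3) by simp
  qed
qed

lemma class_subset: "C \<in> quadric_hyperbolic_classes d Q \<Longrightarrow> C \<subseteq> gens"
  by (auto simp: quadric_hyperbolic_classes_eq class_of_def gens_in_def)

end

section \<open>Orthogonal decomposition along the classes\<close>

text \<open>Orthogonal projection onto the span of the class vectors, carried out in the Euclidean
  space \<open>real^'g\<close> over the whole type; values of \<open>k\<close> outside
  \<open>G\<close> do not enter the class sums, because the classes lie in \<open>G\<close>.\<close>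

lemma class_decomposition:
  fixes G :: "'g::finite set" and H :: "'g set set" and f :: "'g \<Rightarrow> real"
  assumes HG: "\<And>C. C \<in> H \<Longrightarrow> C \<subseteq> G"
  obtains y k where "\<And>x. x \<in> G \<Longrightarrow> f x = (\<Sum>C\<in>H. incidence_matrix C x * y C) + k x"
    "\<And>C. C \<in> H \<Longrightarrow> sum k C = 0"
proof -
  define e where "e C = (\<chi> x. incidence_matrix C x)" for C :: "'g set"
  obtain t z where tz: "t \<in> span (e ` H)" "\<And>w. w \<in> span (e ` H) \<Longrightarrow> orthogonal z w" "(\<chi> x. f x) = t + z"
    using orthogonal_subspace_decomp_exists[of "e ` H" "\<chi> x. f x"] by metis
  have inj: "inj_on e H"
    by (rule inj_onI) (auto simp: e_def vec_eq_iff incidence_matrix_def split: if_splits)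
  obtain u where "t = (\<Sum>v\<in>e ` H. u v *\<^sub>R v)"
    using tz(1) span_finite[of "e ` H"] by auto
  then have t: "t = (\<Sum>C\<in>H. u (e C) *\<^sub>R e C)" by (simp add: sum.reindex[OF inj])
  show thesis
  proof (rule that)
    fix x
    have "f x = t $ x + z $ x" using tz(3) by (simp add: vec_eq_iff)
    then show "f x = (\<Sum>C\<in>H. incidence_matrix C x * u (e C)) + z $ x"
      by (simp add: t e_def mult.commute)
  next
    fix C assume "C \<in> H"
    then have "orthogonal z (e C)" using tz(2) span_base by blast
    then have "(\<Sum>x\<in>UNIV. z $ x * incidence_matrix C x) = 0"
      by (simp add: orthogonal_def inner_vec_def e_def)
    then have "(\<Sum>x\<in>UNIV. if x \<in> C then z $ x else 0) = 0"
      by (simp add: incidence_matrix_def if_distrib cong: if_cong)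
    then show "sum (($) z) C = 0" by (simp add: sum.If_cases)
  qed
qed

lemma char_vec_in_image_iff:
  "char_vec G L \<in> mat_image G H (mat_transpose incidence_matrix) \<longleftrightarrow>
    (\<exists>y. \<forall>x\<in>G. indicator L x = (\<Sum>C\<in>H. incidence_matrix C x * y C))"
proof
  assume "char_vec G L \<in> mat_image G H (mat_transpose incidence_matrix)"
  then obtain y where "char_vec G L = mat_vec G H (mat_transpose incidence_matrix) y"
    by (auto simp: mat_image_def)
  then have "\<forall>x\<in>G. indicator L x = (\<Sum>C\<in>H. incidence_matrix C x * y C)"
    by (auto simp: char_vec_def mat_vec_def mat_transpose_def restrict_def fun_eq_iff split: if_splits)
  then show "\<exists>y. \<forall>x\<in>G. indicator L x = (\<Sum>C\<in>H. incidence_matrix C x * y C)"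
    by blast
next
  assume "\<exists>y. \<forall>x\<in>G. indicator L x = (\<Sum>C\<in>H. incidence_matrix C x * y C)"
  then obtain y where "\<forall>x\<in>G. indicator L x = (\<Sum>C\<in>H. incidence_matrix C x * y C)" by blast
  then have "char_vec G L = mat_vec G H (mat_transpose incidence_matrix) (restrict y H)"
    by (auto simp: char_vec_def mat_vec_def mat_transpose_def restrict_def fun_eq_iff)
  then show "char_vec G L \<in> mat_image G H (mat_transpose incidence_matrix)"
    unfolding mat_image_def by blast
qed

lemma sum_incidence:
  assumes "finite G"
  shows "(\<Sum>x\<in>G. incidence_matrix C x * v x) = sum v (G \<inter> C)"
proof -
  have "(\<Sum>x\<in>G. incidence_matrix C x * v x) = (\<Sum>x\<in>G. if x \<in> C then v x else 0)"
    by (intro sum.cong) (auto simp: incidence_matrix_def)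
  also have "\<dots> = sum v (G \<inter> C)"
    using assms by (rule sum.inter_restrict[symmetric])
  finally show ?thesis .
qed

lemma mat_kernel_iff:
  assumes "finite G" "\<And>C. C \<in> H \<Longrightarrow> C \<subseteq> G"
  shows "v \<in> mat_kernel H G incidence_matrix \<longleftrightarrow> v \<in> extensional G \<and> (\<forall>C\<in>H. sum v C = 0)"
proof -
  have "mat_vec H G incidence_matrix v = (\<lambda>C\<in>H. sum v C)"
    unfolding mat_vec_def sum_incidence[OF assms(1)] using assms(2)
    by (intro restrict_ext) (simp add: Int_absorb1)
  then show ?thesis
    by (auto simp: mat_kernel_def restrict_def fun_eq_iff split: if_splits)
qed

lemma sum_class_combination:
  assumes "finite G" "\<And>C. C \<in> H \<Longrightarrow> C \<subseteq> G" "\<And>C. C \<in> H \<Longrightarrow> sum v C = 0"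
  shows "(\<Sum>x\<in>G. (\<Sum>C\<in>H. incidence_matrix C x * y C) * v x) = 0"
proof -
  have "(\<Sum>x\<in>G. (\<Sum>C\<in>H. incidence_matrix C x * y C) * v x) =
    (\<Sum>C\<in>H. \<Sum>x\<in>G. y C * (incidence_matrix C x * v x))"
    unfolding sum_distrib_right by (subst sum.swap) (intro sum.cong refl, simp add: mult_ac)
  also have "\<dots> = (\<Sum>C\<in>H. y C * sum v C)"
    using assms(2) by (simp add: sum_distrib_left[symmetric] sum_incidence[OF assms(1)] Int_absorb1)
  also have "\<dots> = 0" using assms by simp
  finally show ?thesis .
qed

text \<open>For the converse direction the component \<open>k\<close> of the decomposition is tested
  against itself: its restriction to \<open>G\<close> lies in the kernel, so its inner product with
  the characteristic vector, which equals the sum of squares of \<open>k\<close>, vanishes.\<close>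

lemma image_iff_orth_complement:
  fixes G :: "'g::finite set" and H :: "'g set set"
  assumes HG: "\<And>C. C \<in> H \<Longrightarrow> C \<subseteq> G"
  shows "char_vec G L \<in> mat_image G H (mat_transpose incidence_matrix) \<longleftrightarrow>
    char_vec G L \<in> orth_complement G (mat_kernel H G incidence_matrix)"
proof -
  have chi: "(\<Sum>j\<in>G. char_vec G L j * v j) = (\<Sum>j\<in>G. indicator L j * v j)" for v
    by (intro sum.cong) (auto simp: char_vec_def)
  have orth: "char_vec G L \<in> orth_complement G (mat_kernel H G incidence_matrix) \<longleftrightarrow>
    (\<forall>v\<in>extensional G. (\<forall>C\<in>H. sum v C = (0::real)) \<longrightarrow> (\<Sum>j\<in>G. indicator L j * v j) = 0)"
  proof -
    have "char_vec G L \<in> extensional G" by (simp add: char_vec_def)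
    moreover have "v \<in> mat_kernel H G incidence_matrix \<longleftrightarrow> v \<in> extensional G \<and> (\<forall>C\<in>H. sum v C = 0)" for v
      using HG by (intro mat_kernel_iff) auto
    ultimately show ?thesis
      unfolding orth_complement_def mem_Collect_eq chi by blast
  qed
  show ?thesis
    unfolding orth char_vec_in_image_iff
  proof
    assume "\<exists>y. \<forall>x\<in>G. indicator L x = (\<Sum>C\<in>H. incidence_matrix C x * y C)"
    then obtain y where y: "\<And>x. x \<in> G \<Longrightarrow> indicator L x = (\<Sum>C\<in>H. incidence_matrix C x * y C)" by blast
    then show "\<forall>v\<in>extensional G. (\<forall>C\<in>H. sum v C = (0::real)) \<longrightarrow> (\<Sum>j\<in>G. indicator L j * v j) = 0"
      using sum_class_combination[of G H _ y] HG by simp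
  next
    assume perp: "\<forall>v\<in>extensional G. (\<forall>C\<in>H. sum v C = (0::real)) \<longrightarrow> (\<Sum>j\<in>G. indicator L j * v j) = 0"
    obtain y k where yk: "\<And>x. x \<in> G \<Longrightarrow> indicator L x = (\<Sum>C\<in>H. incidence_matrix C x * y C) + k x"
      "\<And>C. C \<in> H \<Longrightarrow> sum k C = 0"
      using class_decomposition[OF HG, where f = "indicator L"] by metis
    have "sum (restrict k G) C = 0" if "C \<in> H" for C
    proof -
      have "sum (restrict k G) C = sum k C" using HG[OF that] by (intro sum.cong) auto
      then show ?thesis using yk(2)[OF that] by simp
    qed
    then have "(\<Sum>j\<in>G. indicator L j * restrict k G j) = 0"
      using perp by (metis restrict_extensional)
    moreover have "(\<Sum>j\<in>G. indicator L j * restrict k G j) =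
      (\<Sum>x\<in>G. (\<Sum>C\<in>H. incidence_matrix C x * y C) * k x) + (\<Sum>x\<in>G. (k x)\<^sup>2)"
      unfolding sum.distrib[symmetric]
      by (intro sum.cong) (auto simp: yk(1) power2_eq_square distrib_right)
    moreover have "(\<Sum>x\<in>G. (\<Sum>C\<in>H. incidence_matrix C x * y C) * k x) = 0"
      using HG yk(2) by (intro sum_class_combination) auto
    ultimately have "(\<Sum>x\<in>G. (k x)\<^sup>2) = 0" by simp
    then have "\<And>x. x \<in> G \<Longrightarrow> k x = 0" by (subst (asm) sum_nonneg_eq_0_iff) auto
    then show "\<exists>y. \<forall>x\<in>G. indicator L x = (\<Sum>C\<in>H. incidence_matrix C x * y C)"
      using yk(1) by (intro exI[of _ y]) simp
  qed
qed

text \<open>The equivalence for an abstract symmetric relation of valency \<open>c * k\<close>. By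
  \<open>class_count\<close> its matrix sends each class vector to \<open>c\<close> times the
  complementary one, and the size \<open>(k + 1) * M\<close> of \<open>G\<close> is what makes the
  parameter \<open>card L / M\<close> equal to the coefficient sum of a combination of
  classes.\<close>

lemma image_iff_regular:
  fixes G L :: "'g::finite set" and H :: "'g set set" and D :: "'g \<Rightarrow> 'g \<Rightarrow> bool"
  assumes HG: "\<And>C. C \<in> H \<Longrightarrow> C \<subseteq> G" and LG: "L \<subseteq> G" and c: "c > 0" and k: "k > 0"
    and sym: "\<And>x y. D x y \<longleftrightarrow> D y x"
    and class_count: "\<And>C x. C \<in> H \<Longrightarrow> x \<in> G \<Longrightarrow> real (card {y \<in> C. D x y}) = c * (1 - indicator C x)"
    and degree: "\<And>x. x \<in> G \<Longrightarrow> real (card {y \<in> G. D x y}) = c * k"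
    and card_G: "G \<noteq> {} \<Longrightarrow> real (card G) = (k + 1) * M"
    and total: "\<And>w :: 'g \<Rightarrow> real. (\<And>C. C \<in> H \<Longrightarrow> sum w C = 0) \<Longrightarrow> sum w G = 0"
    and eigen: "\<And>(w :: 'g \<Rightarrow> real) x. (\<And>C. C \<in> H \<Longrightarrow> sum w C = 0) \<Longrightarrow>
      (\<And>x. x \<in> G \<Longrightarrow> (\<Sum>y | y \<in> G \<and> D y x. w y) = - (c * w x)) \<Longrightarrow> x \<in> G \<Longrightarrow> w x = 0"
  shows "char_vec G L \<in> mat_image G H (mat_transpose incidence_matrix) \<longleftrightarrow>
    (\<forall>x\<in>G. real (card {y \<in> L. D x y}) = (real (card L) / M - indicator L x) * c)"
proof -
  define S where "S w x = (\<Sum>y | y \<in> G \<and> D x y. w y)" for w :: "'g \<Rightarrow> real" and x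
  define t where "t y x = (\<Sum>C\<in>H. incidence_matrix C x * y C)" for y :: "'g set \<Rightarrow> real" and x
  have S_ind: "S (indicator L) x = real (card {y \<in> L. D x y})" for x
  proof -
    have "S (indicator L) x = (\<Sum>y | y \<in> G \<and> D x y. incidence_matrix L y * 1)"
      unfolding S_def by (intro sum.cong) (auto simp: incidence_matrix_def)
    also have "\<dots> = (\<Sum>y\<in>{y \<in> G. D x y} \<inter> L. 1)"
      by (rule sum_incidence) simp
    finally have "S (indicator L) x = (\<Sum>y\<in>{y \<in> G. D x y} \<inter> L. 1)" .
    moreover have "{y \<in> G. D x y} \<inter> L = {y \<in> L. D x y}" using LG by auto
    ultimately show ?thesis by simp
  qed
  have S_t: "S (t y) x = c * (sum y H - t y x)" if x: "x \<in> G" for y x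
  proof -
    have "S (t y) x = (\<Sum>C\<in>H. \<Sum>z | z \<in> G \<and> D x z. incidence_matrix C z * y C)"
      unfolding S_def t_def by (rule sum.swap)
    also have "\<dots> = (\<Sum>C\<in>H. c * (y C - incidence_matrix C x * y C))"
    proof (rule sum.cong[OF refl])
      fix C assume C: "C \<in> H"
      have "(\<Sum>z | z \<in> G \<and> D x z. incidence_matrix C z * y C) = (\<Sum>z\<in>{z \<in> G. D x z} \<inter> C. y C)"
        by (rule sum_incidence) simp
      moreover have "{z \<in> G. D x z} \<inter> C = {z \<in> C. D x z}" using HG[OF C] by auto
      ultimately have "(\<Sum>z | z \<in> G \<and> D x z. incidence_matrix C z * y C) = real (card {z \<in> C. D x z}) * y C"
        by simp
      then show "(\<Sum>z | z \<in> G \<and> D x z. incidence_matrix C z * y C) = c * (y C - incidence_matrix C x * y C)"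
        using class_count[OF C x] by (simp add: incidence_matrix_def indicator_def)
    qed
    also have "\<dots> = c * (sum y H - t y x)"
      by (simp only: t_def right_diff_distrib sum_subtractf sum_distrib_left)
    finally show ?thesis .
  qed
  have S_sum: "(\<Sum>x\<in>G. S w x) = c * k * sum w G" for w
  proof -
    have "(\<Sum>x\<in>G. S w x) = (\<Sum>y\<in>G. w y * real (card {x \<in> G. D x y}))"
      unfolding S_def by (rule sum_swap_count) auto
    also have "\<dots> = (\<Sum>y\<in>G. w y * (c * k))"
      by (intro sum.cong refl) (simp add: degree sym[of _ y for y])
    finally show ?thesis by (simp add: sum_distrib_left mult.commute)
  qed
  have sum_L: "(\<Sum>x\<in>G. indicator L x) = real (card L)"
  proof -
    have "(\<Sum>x\<in>G. indicator L x) = (\<Sum>x\<in>G. incidence_matrix L x * 1)"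
      by (intro sum.cong) (auto simp: incidence_matrix_def)
    also have "\<dots> = (\<Sum>x\<in>G \<inter> L. 1)" by (rule sum_incidence) simp
    finally show ?thesis using LG by (simp add: Int_absorb1)
  qed
  show ?thesis
    unfolding char_vec_in_image_iff t_def[symmetric] S_ind[symmetric]
  proof
    assume "\<exists>y. \<forall>x\<in>G. indicator L x = t y x"
    then obtain y where y: "\<And>x. x \<in> G \<Longrightarrow> indicator L x = t y x" by blast
    have SL: "S (indicator L) x = c * (sum y H - indicator L x)" if "x \<in> G" for x
    proof -
      have "S (indicator L) x = S (t y) x"
        unfolding S_def by (intro sum.cong) (auto simp: y)
      then show ?thesis using S_t[OF that] y[OF that] by simp
    qed
    show "\<forall>x\<in>G. S (indicator L) x = (real (card L) / M - indicator L x) * c"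
    proof
      fix x assume x: "x \<in> G"
      then have pos: "real (card G) > 0" by (auto simp: card_gt_0_iff)
      have M: "real (card G) = (k + 1) * M" using x by (intro card_G) auto
      then have M0: "M \<noteq> 0" using pos by (intro notI) simp
      \<comment> \<open>Evaluating this total in two ways, by regularity and by \<open>SL\<close>,
        determines the coefficient sum of \<open>y\<close>.\<close>
      have "c * k * real (card L) = (\<Sum>x\<in>G. S (indicator L) x)"
        using S_sum[of "indicator L"] sum_L by simp
      also have "\<dots> = (\<Sum>x\<in>G. c * (sum y H - indicator L x))"
        by (intro sum.cong refl SL)
      also have "\<dots> = c * (sum y H * real (card G) - real (card L))"
        by (simp add: sum_distrib_left[symmetric] sum_subtractf sum_L mult.commute)
      finally have "c * (k * real (card L)) = c * (sum y H * real (card G) - real (card L))"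
        by (simp only: mult.assoc)
      then have "k * real (card L) = sum y H * real (card G) - real (card L)"
        using c by simp
      then have "(k + 1) * (sum y H * M) = (k + 1) * real (card L)"
        unfolding M by (simp add: algebra_simps)
      then have "sum y H * M = real (card L)" using k by simp
      then have "sum y H = real (card L) / M" using M0 by (simp add: field_simps)
      then show "S (indicator L) x = (real (card L) / M - indicator L x) * c"
        using SL[OF x] by simp
    qed
  next
    assume CL: "\<forall>x\<in>G. S (indicator L) x = (real (card L) / M - indicator L x) * c"
    obtain y \<kappa> where y: "\<And>x. x \<in> G \<Longrightarrow> indicator L x = t y x + \<kappa> x"
      and \<kappa>: "\<And>C. C \<in> H \<Longrightarrow> sum \<kappa> C = 0"
      unfolding t_def using class_decomposition[OF HG, where f = "indicator L"] by metis
    \<comment> \<open>The Cameron-Liebler equation gives the eigenvalue equation for \<kappa> up to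
      this constant. Summed over \<open>G\<close>, both \<kappa> and \<open>S \<kappa>\<close> give
      zero, which forces the constant to vanish.\<close>
    define e where "e = c * (real (card L) / M - sum y H)"
    have S\<kappa>: "S \<kappa> x = e - c * \<kappa> x" if x: "x \<in> G" for x
    proof -
      have "S (indicator L) x = S (t y) x + S \<kappa> x"
        unfolding S_def sum.distrib[symmetric] by (intro sum.cong) (auto simp: y)
      then show ?thesis using CL x S_t[OF x] y[OF x] by (simp add: e_def algebra_simps)
    qed
    have "(\<Sum>x\<in>G. S \<kappa> x) = 0" using S_sum total[OF \<kappa>] by simp
    moreover have "(\<Sum>x\<in>G. S \<kappa> x) = e * real (card G)"
      using total[OF \<kappa>] by (simp add: S\<kappa> sum_subtractf sum_distrib_left[symmetric])
    ultimately have e: "e = 0" if "x \<in> G" for x using that by auto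
    have "\<kappa> x = 0" if x: "x \<in> G" for x
    proof (rule eigen[OF \<kappa> _ x])
      fix z assume "z \<in> G"
      then show "(\<Sum>y | y \<in> G \<and> D y z. \<kappa> y) = - (c * \<kappa> z)"
        using S\<kappa>[of z] e by (simp add: S_def sym[of _ z])
    qed
    then show "\<exists>y. \<forall>x\<in>G. indicator L x = t y x"
      using y by (intro exI[of _ y]) simp
  qed
qed

section \<open>The equivalence for parabolic quadrics\<close>

lemma parabolic_quadric:
  fixes Q :: "'a::{field,finite}^'n::finite \<Rightarrow> 'a"
  assumes "parabolic d Q" "0 < d"
  shows "parabolic_quadric Q d"
proof
  show "quadratic_form Q" "nonsingular_on UNIV Q" using assms by (auto simp: parabolic_def)
  show "card (UNIV :: ('a^'n) set) = CARD('a) ^ (d + (d + 1))"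
    using assms by (simp add: parabolic_def mult_2)
qed (use assms in auto)

text \<open>Collects what has to be known about generators and classes, so that the symplectic case
  only has to transport these facts and not the whole argument.\<close>

lemma equivalence_from_counts:
  fixes P :: "('a::{field,finite}, 'n::finite) polar_space"
  assumes d: "0 < d" and L: "L \<subseteq> generators d P"
    and classes: "\<And>C. C \<in> hyperbolic_classes d P \<Longrightarrow> C \<subseteq> generators d P"
    and class_count: "\<And>C \<pi>. C \<in> hyperbolic_classes d P \<Longrightarrow> \<pi> \<in> generators d P \<Longrightarrow>
      card {\<tau> \<in> C. \<pi> \<inter> \<tau> = {0}} = (if \<pi> \<in> C then 0 else CARD('a) ^ (d choose 2))"
    and degree: "\<And>\<pi>. \<pi> \<in> generators d P \<Longrightarrow>
      card {\<tau> \<in> generators d P. \<pi> \<inter> \<tau> = {0}} = CARD('a) ^ (d choose 2) * CARD('a) ^ d"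
    and card_G: "generators d P \<noteq> {} \<Longrightarrow> card (generators d P) = (\<Prod>i<d. CARD('a) ^ (i + 1) + 1)"
    and total: "\<And>w :: ('a^'n) set \<Rightarrow> real. (\<And>C. C \<in> hyperbolic_classes d P \<Longrightarrow> sum w C = 0) \<Longrightarrow>
      sum w (generators d P) = 0"
    and eigen: "\<And>(w :: ('a^'n) set \<Rightarrow> real) \<pi>. (\<And>C. C \<in> hyperbolic_classes d P \<Longrightarrow> sum w C = 0) \<Longrightarrow>
      (\<And>\<pi>. \<pi> \<in> generators d P \<Longrightarrow>
        (\<Sum>\<tau> | \<tau> \<in> generators d P \<and> \<tau> \<inter> \<pi> = {0}. w \<tau>) = - (real CARD('a) ^ (d choose 2) * w \<pi>)) \<Longrightarrow>
      \<pi> \<in> generators d P \<Longrightarrow> w \<pi> = 0"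
  defines "G \<equiv> generators d P" and "H \<equiv> hyperbolic_classes d P"
  shows "(char_vec G L \<in> mat_image G H (mat_transpose incidence_matrix) \<longleftrightarrow>
      char_vec G L \<in> orth_complement G (mat_kernel H G incidence_matrix)) \<and>
    (char_vec G L \<in> orth_complement G (mat_kernel H G incidence_matrix) \<longleftrightarrow> cameron_liebler d P L)"
proof -
  let ?q = "real CARD('a)"
  let ?M = "\<Prod>i<d - 1. ?q ^ (1 + i) + 1"
  obtain e where e: "d = Suc e" using d by (cases d) auto
  have 1: "char_vec G L \<in> mat_image G H (mat_transpose incidence_matrix) \<longleftrightarrow>
      char_vec G L \<in> orth_complement G (mat_kernel H G incidence_matrix)"
    using classes unfolding G_def H_def by (intro image_iff_orth_complement)
  have "char_vec G L \<in> mat_image G H (mat_transpose incidence_matrix) \<longleftrightarrow>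
    (\<forall>\<pi>\<in>G. real (card {\<tau> \<in> L. \<pi> \<inter> \<tau> = {0}}) = (real (card L) / ?M - indicator L \<pi>) * ?q ^ (d choose 2))"
  \<comment> \<open>A generator is disjoint from \<open>q ^ d\<close> times as many generators as
    the constant \<open>c\<close> says, and \<open>q ^ d + 1\<close> is the last factor of the
    product for the number of generators, the other factors being \<open>?M\<close>.\<close>
  proof (rule image_iff_regular[where k = "?q ^ d"])
    show "C \<in> H \<Longrightarrow> C \<subseteq> G" for C using classes by (simp add: G_def H_def)
    show "L \<subseteq> G" using L by (simp add: G_def)
    show "C \<in> H \<Longrightarrow> \<pi> \<in> G \<Longrightarrow> real (card {\<tau> \<in> C. \<pi> \<inter> \<tau> = {0}}) = ?q ^ (d choose 2) * (1 - indicator C \<pi>)" for C \<pi>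
      using class_count[of C \<pi>] by (simp add: G_def H_def)
    show "\<pi> \<in> G \<Longrightarrow> real (card {\<tau> \<in> G. \<pi> \<inter> \<tau> = {0}}) = ?q ^ (d choose 2) * ?q ^ d" for \<pi>
      using degree[of \<pi>] by (simp add: G_def)
    show "real (card G) = (?q ^ d + 1) * ?M" if "G \<noteq> {}"
    proof -
      have "real (card G) = (\<Prod>i<d. ?q ^ (i + 1) + 1)"
        using card_G that by (simp add: G_def add.commute)
      then show ?thesis by (simp add: e mult.commute)
    qed
    show "sum w G = 0" if "\<And>C. C \<in> H \<Longrightarrow> sum w C = 0" for w :: "('a^'n) set \<Rightarrow> real"
      using total[of w] that by (simp add: G_def H_def)
    show "w \<pi> = 0" if "\<And>C. C \<in> H \<Longrightarrow> sum w C = 0"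
      "\<And>\<pi>. \<pi> \<in> G \<Longrightarrow> (\<Sum>\<tau> | \<tau> \<in> G \<and> \<tau> \<inter> \<pi> = {0}. w \<tau>) = - (?q ^ (d choose 2) * w \<pi>)" "\<pi> \<in> G"
      for w :: "('a^'n) set \<Rightarrow> real" and \<pi>
      using eigen[of w \<pi>] that by (simp add: G_def H_def)
  qed (auto simp: Int_commute)
  moreover have "(d - 1 choose 2) + (d - 1) = d choose 2"
    by (simp add: e numeral_2_eq_2)
  ultimately have "char_vec G L \<in> mat_image G H (mat_transpose incidence_matrix) \<longleftrightarrow> cameron_liebler d P L"
    using L by (simp add: cameron_liebler_def G_def Let_def)
  then show ?thesis using 1 by simp
qed

lemma equivalence_parabolic:
  fixes Q :: "'a::{field,finite}^'n::finite \<Rightarrow> 'a"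
  assumes Q: "parabolic d Q" and d: "odd d" and L: "L \<subseteq> generators d (Parabolic Q)"
  defines "G \<equiv> generators d (Parabolic Q)" and "H \<equiv> hyperbolic_classes d (Parabolic Q)"
  shows "(char_vec G L \<in> mat_image G H (mat_transpose incidence_matrix) \<longleftrightarrow>
      char_vec G L \<in> orth_complement G (mat_kernel H G incidence_matrix)) \<and>
    (char_vec G L \<in> orth_complement G (mat_kernel H G incidence_matrix) \<longleftrightarrow> cameron_liebler d (Parabolic Q) L)"
proof -
  have d0: "0 < d" using d by (cases d) auto
  interpret parabolic_quadric Q d by (rule parabolic_quadric[OF Q d0])
  have g: "generators d (Parabolic Q) = gens" by (simp add: gens_quadric_subspaces)
  show ?thesis
    unfolding G_def H_def
  proof (rule equivalence_from_counts[OF d0 L], unfold g hyperbolic_classes.simps)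
    show "card {\<tau> \<in> gens. \<pi> \<inter> \<tau> = {0}} = CARD('a) ^ (d choose 2) * CARD('a) ^ d" if "\<pi> \<in> gens" for \<pi>
      using card_disjoint[OF that] by (simp only: Int_commute)
  qed (fact class_subset card_disjoint_class[OF d] card_gens sum_gens_zero eigenvector_orthogonal_classes_zero)+
qed

section \<open>Projection from the nucleus\<close>

text \<open>Square roots, available in finite fields of even characteristic, allow any vector to be
  moved to a singular one along the nucleus; this is how generators are lifted.\<close>

locale nucleus_proj = parabolic_quadric Q d
  for Q :: "'a::{field,finite}^'n::finite \<Rightarrow> 'a" and d +
  fixes f :: "'a^'m::finite \<Rightarrow> 'a^'m \<Rightarrow> 'a" and p :: "'a^'n \<Rightarrow> 'a^'m"
  assumes proj: "nucleus_projection Q f p" and sqrt: "\<And>a :: 'a. \<exists>s. s\<^sup>2 = a"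
begin

lemma p_add: "p (u + v) = p u + p v" and p_scale: "p (c *s v) = c *s p v"
proof -
  have "Vector_Spaces.linear (*s) (*s) p" using proj by (simp add: nucleus_projection_def)
  then interpret l: Vector_Spaces.linear "(*s)" "(*s)" p .
  show "p (u + v) = p u + p v" "p (c *s v) = c *s p v" by (rule l.add, rule l.scale)
qed

lemma p_0: "p 0 = 0"
  using p_scale[of 0 0] by simp

lemma p_surj: "\<exists>v. p v = x"
  using proj unfolding nucleus_projection_def surj_def by metis

lemma f_p: "f (p u) (p v) = B u v"
  using proj by (simp add: nucleus_projection_def)

text \<open>\<open>u - v\<close> lies in the kernel of \<open>p\<close>, hence in the radical of
  \<open>B\<close>. It is also singular, since \<open>B u v = f (p u) (p v) = B v v\<close>, which
  is \<open>2 * Q v = 0\<close>. Nonsingularity leaves only zero.\<close>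

lemma singular_p_inject:
  assumes "Q u = 0" "Q v = 0" "p u = p v"
  shows "u = v"
proof -
  have k: "p (u + (-1) *s v) = 0" by (simp only: p_add p_scale assms(3)) simp
  have "B (u + (-1) *s v) w = 0" for w
    using f_p[of "u + (-1) *s v" w] f_p[of 0 w] k by (simp add: p_0 B_simps)
  moreover have "B u v = 0"
  proof -
    have "v + v = 2 *s v" by (simp add: vec_eq_iff)
    then have "B v v = Q (2 *s v) - Q v - Q v" by (simp only: polar_form_def)
    also have "\<dots> = 0" by (simp add: Q_scale assms(2))
    finally show ?thesis using f_p[of u v] f_p[of v v] assms(3) by simp
  qed
  then have "Q (u + (-1) *s v) = 0"
    using assms by (simp only: Q_add Q_scale B_simps) simp
  ultimately have "u + (-1) *s v = 0"
    using nonsing unfolding nonsingular_on_def by blast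
  then show ?thesis by simp
qed

lemma inj_on_ts:
  assumes "totally_singular Q U"
  shows "inj_on p U"
  using assms ts_Q singular_p_inject by (intro inj_onI) blast

lemma image_inter:
  assumes "\<pi> \<in> gens" "\<tau> \<in> gens"
  shows "p ` \<pi> \<inter> p ` \<tau> = p ` (\<pi> \<inter> \<tau>)"
proof
  show "p ` \<pi> \<inter> p ` \<tau> \<subseteq> p ` (\<pi> \<inter> \<tau>)"
  proof
    fix x assume "x \<in> p ` \<pi> \<inter> p ` \<tau>"
    then obtain u v where uv: "u \<in> \<pi>" "v \<in> \<tau>" "x = p u" "x = p v" by auto
    then have "u = v"
      using ts_Q[OF gens_ts[OF assms(1)]] ts_Q[OF gens_ts[OF assms(2)]] by (intro singular_p_inject) auto
    then show "x \<in> p ` (\<pi> \<inter> \<tau>)" using uv by auto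
  qed
qed auto

lemma image_disjoint:
  assumes "\<pi> \<in> gens" "\<tau> \<in> gens"
  shows "p ` \<pi> \<inter> p ` \<tau> = {0} \<longleftrightarrow> \<pi> \<inter> \<tau> = {0}"
proof -
  have 0: "0 \<in> \<pi> \<inter> \<tau>" using gens_eq_zero_iff assms by blast
  have "inj_on p (\<pi> \<inter> \<tau>)" using inj_on_ts[OF gens_ts[OF assms(1)]] by (rule inj_on_subset) auto
  then have "p ` (\<pi> \<inter> \<tau>) = p ` {0} \<longleftrightarrow> \<pi> \<inter> \<tau> = {0}"
    using 0 by (intro inj_on_image_eq_iff) auto
  then show ?thesis using image_inter[OF assms] p_0 by simp
qed

lemma subspace_image: "vec.subspace U \<Longrightarrow> vec.subspace (p ` U)"
  unfolding vec.subspace_def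
  by (auto simp: p_0[symmetric] p_add[symmetric] p_scale[symmetric] simp del: image_eqI intro!: imageI)

lemma image_gen:
  assumes "\<pi> \<in> gens"
  shows "p ` \<pi> \<in> isotropic_subspaces d f"
proof -
  have s: "vec.subspace (p ` \<pi>)" by (rule subspace_image[OF gens_subspace[OF assms]])
  have "card (p ` \<pi>) = CARD('a) ^ d"
    using card_image[OF inj_on_ts[OF gens_ts[OF assms]]] gens_card[OF assms] by simp
  then have "vec.dim (p ` \<pi>) = d" using dim_eq_iff_card[OF s] by blast
  then show ?thesis
    using s ts_B[OF gens_ts[OF assms]] by (auto simp: isotropic_subspaces_def f_p)
qed

lemma nucleus_vector:
  obtains n where "p n = 0" "Q n \<noteq> 0"
proof -
  have N: "vec.dim {v. p v = 0} = 1"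
    using proj by (simp add: nucleus_projection_def is_nucleus_def)
  have "\<not> {v. p v = 0} \<subseteq> {0}"
  proof
    assume "{v. p v = 0} \<subseteq> {0}"
    then have "vec.dim {v. p v = 0} = 0" by (simp only: vec.dim_eq_0)
    then show False using N by simp
  qed
  then obtain n where n: "p n = 0" "n \<noteq> 0" by auto
  have "Q n \<noteq> 0" using singular_p_inject[of n 0] n p_0 by auto
  then show thesis using that n by blast
qed

text \<open>On the preimage of \<tau> the polar form vanishes, so \<open>Q\<close> is additive there
  and its zeros form a subspace. They map onto \<tau> because every coset of the nucleus contains a
  singular vector.\<close>

lemma isotropic_lift:
  assumes \<tau>: "\<tau> \<in> isotropic_subspaces d f"
  obtains \<pi> where "\<pi> \<in> gens" "p ` \<pi> = \<tau>"
proof -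
  define \<pi> where "\<pi> = {v. p v \<in> \<tau> \<and> Q v = 0}"
  have s\<tau>: "vec.subspace \<tau>" and d\<tau>: "vec.dim \<tau> = d" and iso: "\<And>x y. x \<in> \<tau> \<Longrightarrow> y \<in> \<tau> \<Longrightarrow> f x y = 0"
    using \<tau> by (auto simp: isotropic_subspaces_def)
  have "vec.subspace \<pi>"
    unfolding vec.subspace_def
  proof (intro conjI ballI allI)
    show "0 \<in> \<pi>" using vec.subspace_0[OF s\<tau>] by (simp add: \<pi>_def p_0)
    fix u v c assume u: "u \<in> \<pi>"
    show "c *s u \<in> \<pi>"
      using u vec.subspace_scale[OF s\<tau>] by (simp add: \<pi>_def p_scale Q_scale)
    assume v: "v \<in> \<pi>"
    have "B u v = 0" using iso[of "p u" "p v"] u v f_p by (simp add: \<pi>_def)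
    then show "u + v \<in> \<pi>"
      using u v vec.subspace_add[OF s\<tau>] by (simp add: \<pi>_def p_add Q_add)
  qed
  then have ts: "totally_singular Q \<pi>" by (simp add: totally_singular_def \<pi>_def)
  have im: "p ` \<pi> = \<tau>"
  proof
    show "\<tau> \<subseteq> p ` \<pi>"
    proof
      fix x assume x: "x \<in> \<tau>"
      obtain v where v: "p v = x" using p_surj by blast
      obtain n where n: "p n = 0" "Q n \<noteq> 0" by (rule nucleus_vector)
      \<comment> \<open>As \<open>n\<close> is orthogonal to \<open>v\<close>,
        \<open>Q (v + s *s n) = Q v + s\<^sup>2 * Q n\<close>, and this choice makes it
        zero.\<close>
      obtain s where s: "s\<^sup>2 = - Q v / Q n" using sqrt by blast
      have "B v n = 0" using f_p[of v n] f_p[of v 0] n by (simp add: p_0 B_simps)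
      then have "Q (v + s *s n) = 0"
        using s n by (simp add: Q_add Q_scale B_simps)
      moreover have "p (v + s *s n) = x" using v n by (simp add: p_add p_scale)
      ultimately show "x \<in> p ` \<pi>" using x by (intro image_eqI[of _ _ "v + s *s n"]) (auto simp: \<pi>_def)
    qed
  qed (auto simp: \<pi>_def)
  have "card \<pi> = CARD('a) ^ d"
    using card_image[OF inj_on_ts[OF ts]] im card_subspace[OF s\<tau>] d\<tau> by simp
  then have "\<pi> \<in> gens" using ts by (simp add: mem_gens)
  then show thesis using that im by blast
qed

lemma isotropic_eq: "isotropic_subspaces d f = (\<lambda>\<pi>. p ` \<pi>) ` gens"
proof
  show "isotropic_subspaces d f \<subseteq> (\<lambda>\<pi>. p ` \<pi>) ` gens" using isotropic_lift by blast
qed (auto simp: image_gen)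

lemma inj_on_gens: "inj_on (\<lambda>\<pi>. p ` \<pi>) gens"
proof (rule inj_onI)
  fix \<pi> \<tau> assume g: "\<pi> \<in> gens" "\<tau> \<in> gens" and eq: "p ` \<pi> = p ` \<tau>"
  have "p ` (\<pi> \<inter> \<tau>) = p ` \<pi>" using image_inter[OF g] eq by simp
  then have "\<pi> \<inter> \<tau> = \<pi>"
    using inj_on_image_eq_iff[OF inj_on_ts[OF gens_ts[OF g(1)]], of "\<pi> \<inter> \<tau>" \<pi>] by simp
  then show "\<pi> = \<tau>" using gen_eq[OF g(2), of \<pi>] gens_card[OF g(1)] by auto
qed

lemma card_image_disjoint:
  assumes \<pi>: "\<pi> \<in> gens" and C: "C \<subseteq> gens"
  shows "card {\<tau> \<in> (\<lambda>\<pi>. p ` \<pi>) ` C. p ` \<pi> \<inter> \<tau> = {0}} = card {\<tau> \<in> C. \<pi> \<inter> \<tau> = {0}}"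
proof -
  have "{\<tau> \<in> (\<lambda>\<pi>. p ` \<pi>) ` C. p ` \<pi> \<inter> \<tau> = {0}} = (\<lambda>\<pi>. p ` \<pi>) ` {\<tau> \<in> C. \<pi> \<inter> \<tau> = {0}}"
    (is "?A = ?h ` ?B")
  proof (rule set_eqI)
    fix x
    have "x \<in> ?A \<longleftrightarrow> (\<exists>\<tau>\<in>C. x = p ` \<tau> \<and> p ` \<pi> \<inter> p ` \<tau> = {0})" by auto
    also have "\<dots> \<longleftrightarrow> (\<exists>\<tau>\<in>C. x = p ` \<tau> \<and> \<pi> \<inter> \<tau> = {0})"
      by (intro bex_cong refl conj_cong image_disjoint[OF \<pi>] subsetD[OF C])
    also have "\<dots> \<longleftrightarrow> x \<in> ?h ` ?B" by auto
    finally show "x \<in> ?A \<longleftrightarrow> x \<in> ?h ` ?B" .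
  qed
  moreover have "inj_on (\<lambda>\<pi>. p ` \<pi>) {\<tau> \<in> C. \<pi> \<inter> \<tau> = {0}}"
    using inj_on_gens by (rule inj_on_subset) (use C in auto)
  ultimately show ?thesis by (simp only: card_image)
qed

lemma sum_image_gens:
  assumes "C \<subseteq> gens"
  shows "sum w ((\<lambda>\<pi>. p ` \<pi>) ` C) = (\<Sum>\<pi>\<in>C. w (p ` \<pi>))"
  using sum.reindex[OF inj_on_subset[OF inj_on_gens assms], of w] by (simp add: comp_def)

end

section \<open>Symplectic forms in even characteristic\<close>

lemma even_card_involution:
  assumes "finite S" "\<And>x. x \<in> S \<Longrightarrow> g x \<in> S \<and> g (g x) = x \<and> g x \<noteq> x"
  shows "even (card S)"
  using assms
proof (induction "card S" arbitrary: S rule: less_induct)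
  case less
  show ?case
  proof (cases "S = {}")
    case False
    then obtain x where x: "x \<in> S" by auto
    let ?T = "S - {x, g x}"
    have gx: "g x \<in> S" "g (g x) = x" "g x \<noteq> x" using less.prems(2)[OF x] by auto
    have "S = insert x (insert (g x) ?T)" using x gx(1) by auto
    moreover have "card (insert x (insert (g x) ?T)) = card ?T + 2"
      using gx(3) less.prems(1) by simp
    ultimately have c: "card S = card ?T + 2" by (rule trans[OF arg_cong])
    have "even (card ?T)"
    proof (rule less.hyps)
      show "card ?T < card S" using c by simp
      show "g y \<in> ?T \<and> g (g y) = y \<and> g y \<noteq> y" if y: "y \<in> ?T" for y
      proof -
        have gy: "g y \<in> S" "g (g y) = y" "g y \<noteq> y" using less.prems(2)[of y] y by auto
        then have "g y \<noteq> x" "g y \<noteq> g x" using y gx by (metis DiffD2 insertCI)+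
        then show ?thesis using gy by simp
      qed
    qed (use less.prems in auto)
    then show ?thesis using c by simp
  qed simp
qed

text \<open>If 2 were nonzero, negation would pair off the nonzero elements without fixed points,
  and the number of elements would be odd.\<close>

lemma even_card_field_char_2:
  assumes "even CARD('a::{field,finite})"
  shows "(2 :: 'a) = 0"
proof (rule ccontr)
  assume two: "(2 :: 'a) \<noteq> 0"
  have "even (card (UNIV - {0 :: 'a}))"
  proof (rule even_card_involution[where g = uminus])
    fix x :: 'a assume x: "x \<in> UNIV - {0}"
    have "- x \<noteq> x"
    proof
      assume "- x = x"
      then have "2 * x = 0" by (metis add.right_inverse mult_2)
      then show False using x two by simp
    qed
    then show "- x \<in> UNIV - {0} \<and> - (- x) = x \<and> - x \<noteq> x" using x by simp
  qed simp
  moreover have "card (UNIV - {0 :: 'a}) = CARD('a) - 1" by (simp add: card_Diff_singleton)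
  ultimately show False using assms card_ge_two[where 'a = 'a] by simp
qed

text \<open>Squaring is additive in characteristic 2 and hence injective; finiteness makes it
  surjective.\<close>

lemma square_surj_char_2:
  assumes two: "(2 :: 'a::{field,finite}) = 0"
  shows "\<exists>s. s\<^sup>2 = (a :: 'a)"
proof -
  have "inj (\<lambda>s :: 'a. s\<^sup>2)"
  proof (rule injI)
    fix s t :: 'a assume st: "s\<^sup>2 = t\<^sup>2"
    have "(s - t)\<^sup>2 = s\<^sup>2 + t\<^sup>2 - 2 * s * t" by (simp add: power2_diff)
    also have "\<dots> = 2 * t\<^sup>2 - 2 * s * t" by (simp only: st mult_2)
    finally have "(s - t)\<^sup>2 = 0" by (simp only: two mult_zero_left) simp
    then show "s = t" by simp
  qed
  then have "surj (\<lambda>s :: 'a. s\<^sup>2)" by (rule finite_UNIV_inj_surj[OF finite])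
  then show ?thesis by (metis surjD)
qed

lemma neg_eq_char_2:
  assumes "(2 :: 'a::field) = 0"
  shows "- x = (x :: 'a)"
proof -
  have "x + x = 2 * x" by simp
  also have "\<dots> = 0" by (simp only: assms mult_zero_left)
  finally show ?thesis by (metis add_eq_0_iff2)
qed

lemma bilin_expand:
  fixes f :: "'a::field^'m::finite \<Rightarrow> 'a^'m \<Rightarrow> 'a"
  assumes f: "bilin f"
  shows "f u v = (\<Sum>i\<in>UNIV. \<Sum>j\<in>UNIV. f (axis i 1) (axis j 1) * (u $ i * v $ j))"
proof -
  have "f u v = dotp (\<chi> i. f (axis i 1) v) u"
    by (rule functional_eq_dotp[of "\<lambda>u. f u v"]) (simp_all add: bilinD[OF f])
  moreover have "f (axis i 1) v = dotp (\<chi> j. f (axis i 1) (axis j 1)) v" for i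
    by (rule functional_eq_dotp) (simp_all add: bilinD[OF f])
  ultimately show ?thesis
    by (simp add: dotp_def sum_distrib_left sum_distrib_right mult_ac)
qed

text \<open>The strictly upper triangular part of the Gram matrix is a quadratic form that polarizes to \<open>f\<close>; adding
  the square of the extra coordinate makes the kernel of the projection the nucleus.\<close>

lemma symplectic_polarization:
  fixes f :: "'a::{field,finite}^'m::finite \<Rightarrow> 'a^'m \<Rightarrow> 'a"
  assumes two: "(2 :: 'a) = 0" and f: "bilin f" and alt: "\<And>v. f v v = 0"
  obtains Q where "\<And>c u. Q (c *s u) = c\<^sup>2 * Q u" "\<And>u v. Q (u + v) = Q u + Q v + f u v"
proof -
  \<comment> \<open>An arbitrary numbering of the index type, which gives "upper triangular" a
    meaning.\<close>
  obtain ix :: "'m \<Rightarrow> nat" where ix: "inj ix"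
    using finite_imp_inj_to_nat_seg[of "UNIV :: 'm set"] by auto
  define a where "a i j = f (axis i 1) (axis j 1)" for i j
  define Q where "Q u = (\<Sum>i\<in>UNIV. \<Sum>j\<in>UNIV. if ix i < ix j then a i j * (u $ i * u $ j) else 0)" for u
  have asym: "a i j = a j i" for i j
  proof -
    have "f (x + y) (x + y) = f x x + f y y + (f x y + f y x)" for x y
      by (simp add: bilinD(1,2)[OF f] algebra_simps)
    then have "f x y + f y x = 0" for x y by (simp add: alt)
    then have "a i j + a j i = 0" by (simp only: a_def)
    then show ?thesis using neg_eq_char_2[OF two] by (metis add_eq_0_iff2)
  qed
  have adiag: "a i i = 0" for i by (simp add: a_def alt)
  have fexp: "f u v = (\<Sum>i\<in>UNIV. \<Sum>j\<in>UNIV. if ix i < ix j then a i j * (u $ i * v $ j + v $ i * u $ j) else 0)"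
    (is "_ = ?R") for u v
  proof -
    have "f u v = (\<Sum>i\<in>UNIV. \<Sum>j\<in>UNIV. a i j * (u $ i * v $ j))"
      unfolding a_def by (rule bilin_expand[OF f])
    also have "\<dots> = (\<Sum>i\<in>UNIV. \<Sum>j\<in>UNIV. (if ix i < ix j then a i j * (u $ i * v $ j) else 0) +
        (if ix j < ix i then a i j * (u $ i * v $ j) else 0))"
    proof (intro sum.cong refl)
      fix i j
      consider "ix i < ix j" | "ix j < ix i" | "i = j" using ix by (metis injD linorder_neqE_nat)
      then show "a i j * (u $ i * v $ j) = (if ix i < ix j then a i j * (u $ i * v $ j) else 0) +
        (if ix j < ix i then a i j * (u $ i * v $ j) else 0)"
        by cases (auto simp: adiag)
    qed
    also have "\<dots> = (\<Sum>i\<in>UNIV. \<Sum>j\<in>UNIV. if ix i < ix j then a i j * (u $ i * v $ j) else 0) +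
        (\<Sum>i\<in>UNIV. \<Sum>j\<in>UNIV. if ix j < ix i then a i j * (u $ i * v $ j) else 0)"
      by (simp only: sum.distrib)
    also have "(\<Sum>i\<in>UNIV. \<Sum>j\<in>UNIV. if ix j < ix i then a i j * (u $ i * v $ j) else 0) =
        (\<Sum>i\<in>UNIV. \<Sum>j\<in>UNIV. if ix i < ix j then a i j * (v $ i * u $ j) else 0)"
      by (subst sum.swap) (intro sum.cong refl, simp add: asym mult.commute)
    also have "(\<Sum>i\<in>UNIV. \<Sum>j\<in>UNIV. if ix i < ix j then a i j * (u $ i * v $ j) else 0) + \<dots> = ?R"
      unfolding sum.distrib[symmetric] by (intro sum.cong refl) (simp add: distrib_left)
    finally show ?thesis .
  qed
  show thesis
  proof (rule that[of Q])
    fix c u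
    show "Q (c *s u) = c\<^sup>2 * Q u"
      unfolding Q_def sum_distrib_left by (intro sum.cong refl) (simp add: power2_eq_square)
  next
    fix u v
    show "Q (u + v) = Q u + Q v + f u v"
      unfolding Q_def fexp sum.distrib[symmetric] by (intro sum.cong refl) (simp add: algebra_simps)
  qed
qed

lemma bilin_imp_bilinear_form:
  assumes "bilin f"
  shows "bilinear_form f"
  unfolding bilinear_form_def
proof (intro conjI allI)
  have vs: "vector_space ((*s) :: 'a \<Rightarrow> 'a^'b \<Rightarrow> 'a^'b)" "vector_space ((*) :: 'a \<Rightarrow> 'a \<Rightarrow> 'a)"
    using vec.vector_space_axioms vector_space_over_itself.vector_space_axioms by auto
  show "Vector_Spaces.linear (*s) (*) (f u)" "Vector_Spaces.linear (*s) (*) (\<lambda>u. f u v)" for u v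
    unfolding Vector_Spaces.linear_iff using vs bilinD[OF assms] by simp_all
qed

lemma symplectic_lift:
  fixes f :: "'a::{field,finite}^'m::finite \<Rightarrow> 'a^'m \<Rightarrow> 'a"
  assumes two: "(2 :: 'a) = 0" and f: "symplectic_form f" and m: "CARD('m) = 2 * d"
  obtains Q :: "'a^'m option \<Rightarrow> 'a" and p where "parabolic d Q" "nucleus_projection Q f p"
proof -
  have bf: "bilin f" and alt: "\<And>v. f v v = 0" and nd: "\<And>v. (\<And>w. f v w = 0) \<Longrightarrow> v = 0"
    using f bilinear_form_imp_bilin by (auto simp: symplectic_form_def)
  obtain Q0 where Q0: "\<And>c u. Q0 (c *s u) = c\<^sup>2 * Q0 u" "\<And>u v. Q0 (u + v) = Q0 u + Q0 v + f u v"
    using symplectic_polarization[OF two bf alt] by metis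
  have Q00: "Q0 0 = 0" using Q0(1)[of 0 0] by simp
  define p :: "'a^'m option \<Rightarrow> 'a^'m" where "p v = (\<chi> i. v $ Some i)" for v
  define Q :: "'a^'m option \<Rightarrow> 'a" where "Q v = Q0 (p v) + (v $ None)\<^sup>2" for v
  have p_add: "p (u + v) = p u + p v" and p_scale: "p (c *s v) = c *s p v" for u v c
    by (simp_all add: p_def vec_eq_iff)
  have p_surj: "\<exists>v. p v = x" for x
    by (intro exI[of _ "\<chi> j. case j of None \<Rightarrow> 0 | Some i \<Rightarrow> x $ i"]) (simp add: p_def vec_eq_iff)
  \<comment> \<open>The square of the extra coordinate does not contribute to the polar form,
    because its cross term carries the factor 2.\<close>
  have pf: "polar_form Q u v = f (p u) (p v)" for u v
  proof -
    have "(u $ None + v $ None)\<^sup>2 = (u $ None)\<^sup>2 + (v $ None)\<^sup>2 + 2 * (u $ None) * (v $ None)"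
      by (rule power2_sum)
    also have "\<dots> = (u $ None)\<^sup>2 + (v $ None)\<^sup>2" by (simp only: two mult_zero_left add_0_right)
    finally show ?thesis by (simp add: polar_form_def Q_def p_add Q0(2))
  qed
  have Q_scale: "Q (c *s v) = c\<^sup>2 * Q v" for c v
    by (simp add: Q_def p_scale Q0(1) power_mult_distrib distrib_left)
  have bQ: "bilin (polar_form Q)"
    unfolding bilin_def by (simp add: pf p_add p_scale bilinD[OF bf])
  have quad: "quadratic_form Q"
    unfolding quadratic_form_def using Q_scale bilin_imp_bilinear_form[OF bQ] by simp
  have p0_iff: "p v = 0 \<longleftrightarrow> (\<exists>t. v = axis None t)" for v
  proof
    assume "p v = 0"
    then have "v $ Some i = 0" for i by (simp add: p_def vec_eq_iff)
    then have "v $ j = axis None (v $ None) $ j" for j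
      by (cases j) (simp_all add: axis_def)
    then have "v = axis None (v $ None)" by (intro vec_eq_iff[THEN iffD2] allI)
    then show "\<exists>t. v = axis None t" by (rule exI)
  next
    assume "\<exists>t. v = axis None t"
    then obtain t where "v = axis None t" by blast
    then have "v $ Some i = 0" for i by (simp add: axis_def)
    then show "p v = 0" by (simp add: p_def vec_eq_iff)
  qed
  have nonsing: "nonsingular_on UNIV Q"
    unfolding nonsingular_on_def
  proof (intro ballI impI, elim conjE)
    fix v assume v: "Q v = 0" "\<forall>w\<in>UNIV. polar_form Q v w = 0"
    have "f (p v) w = 0" for w using v(2) pf p_surj by (metis UNIV_I)
    then have pv: "p v = 0" by (rule nd)
    then have "v $ None = 0" using v(1) by (simp add: Q_def Q00)
    moreover obtain t where "v = axis None t" using pv p0_iff by blast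
    ultimately show "v = 0" by (simp add: axis_def vec_eq_iff)
  qed
  have par: "parabolic d Q"
    using quad nonsing m by (simp add: parabolic_def card_UNIV_option)
  define n :: "'a^'m option" where "n = axis None 1"
  have "axis None t = t *s n" for t
    unfolding n_def by (simp add: vec_eq_iff axis_def)
  then have Nn: "{v. p v = 0} = range (\<lambda>t. t *s n)"
    unfolding p0_iff by auto
  have pn: "p n = 0" using p0_iff n_def by blast
  have Qn: "Q n = 1" by (simp add: Q_def pn Q00) (simp add: n_def)
  have n0: "n \<noteq> 0" using pn Qn Q_scale[of 0 n] by auto
  have sN: "vec.subspace {v. p v = 0}"
    using p_scale[of 0 0] by (auto simp: vec.subspace_def p_add p_scale)
  interpret quadratic Q by unfold_locales (rule quad)
  have B_n: "B v n = 0" for v by (simp add: pf pn bilinD[OF bf])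
  have nuc: "is_nucleus Q {v. p v = 0}"
    unfolding is_nucleus_def
  proof (intro conjI allI impI)
    show "vec.subspace {v. p v = 0}" by (rule sN)
    have "inj (\<lambda>t. t *s n)" using n0 by (auto intro: injI)
    then have "card {v. p v = 0} = CARD('a) ^ 1" unfolding Nn by (simp add: card_image)
    then show "vec.dim {v. p v = 0} = 1" using dim_eq_iff_card[OF sN] by blast
    fix l assume "vec.subspace l \<and> vec.dim l = 2 \<and> {v. p v = 0} \<subseteq> l"
    then have sl: "vec.subspace l" and dl: "vec.dim l = 2" and nl: "n \<in> l" using pn by auto
    have "\<not> l \<subseteq> {v. p v = 0}"
      using vec.dim_subset[of l "{v. p v = 0}"] dl \<open>vec.dim {v. p v = 0} = 1\<close> by auto
    then obtain v0 where v0: "v0 \<in> l" "p v0 \<noteq> 0" by auto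
    \<comment> \<open>As \<open>Q n = 1\<close> and \<open>n\<close> is orthogonal to everything,
      \<open>Q (v0 + s *s n) = Q v0 + s\<^sup>2\<close>; the choice produces a singular point on the
      line.\<close>
    obtain s where s: "s\<^sup>2 = - Q v0" using square_surj_char_2[OF two] by blast
    define v where "v = v0 + s *s n"
    have vl: "v \<in> l" unfolding v_def using v0 nl sl by (intro vec.subspace_add vec.subspace_scale)
    have Qv: "Q v = 0" by (simp add: v_def Q_add Q_scale B_simps B_n Qn s)
    have pv: "p v \<noteq> 0" using v0 by (simp add: v_def p_add p_scale pn)
    define N where "N = {v. p v = 0}"
    have vN: "v \<notin> N" using pv by (simp add: N_def)
    have l_eq: "l = vec.span (insert v N)"
    proof (rule card_subset_eq[symmetric])
      show "vec.span (insert v N) \<subseteq> l"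
        using vl nl sl unfolding N_def Nn by (auto simp: span_insert_subset_iff intro: vec.subspace_scale)
      have "card N = CARD('a)" using \<open>card {v. p v = 0} = CARD('a) ^ 1\<close> by (simp add: N_def)
      then show "card (vec.span (insert v N)) = card l"
        using card_span_insert[OF _ vN] sN card_subspace[OF sl] dl by (simp add: N_def power2_eq_square)
    qed simp
    \<comment> \<open>On the line, \<open>Q (k *s v + t *s n) = t\<^sup>2\<close>, so the singular
      point is unique.\<close>
    have sing: "\<exists>k. x = k *s v" if x: "x \<in> l" "Q x = 0" for x
    proof -
      have "vec.subspace N" using sN by (simp add: N_def)
      then obtain k u where ku: "u \<in> N" "x = k *s v + u"
        using x(1) mem_span_insert unfolding l_eq by blast
      then obtain t where t: "u = t *s n" unfolding N_def Nn by auto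
      have "Q x = t\<^sup>2" by (simp add: ku t Q_add Q_scale B_simps B_n Qv Qn)
      then have "t = 0" using x(2) by simp
      then show ?thesis using ku t by auto
    qed
    have s0: "vec.subspace {0 :: 'a^'m option}" by (rule vec.subspace_single_0)
    have v_ne: "v \<notin> {0}" using pv p_scale[of 0 v] by auto
    define P where "P = vec.span (insert v {0 :: 'a^'m option})"
    have P_iff: "x \<in> P \<longleftrightarrow> (\<exists>k. x = k *s v)" for x
      unfolding P_def mem_span_insert[OF s0] by simp
    have dP: "vec.dim P = 1"
    proof -
      have "card P = CARD('a) ^ 1" unfolding P_def using card_span_insert[OF s0 v_ne] by simp
      then show ?thesis using dim_eq_iff_card[of P 1] by (simp add: P_def)
    qed
    have "\<exists>!P'. P' \<in> quadric_subspaces 1 Q \<and> P' \<subseteq> l"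
    proof (rule ex1I[of _ P])
      have "Q x = 0" if "x \<in> P" for x using that Qv by (auto simp: P_iff Q_scale)
      moreover have "P \<subseteq> l" using vl sl by (auto simp: P_iff intro: vec.subspace_scale)
      ultimately show "P \<in> quadric_subspaces 1 Q \<and> P \<subseteq> l"
        using dP by (simp add: quadric_subspaces_def P_def)
      fix P' assume P': "P' \<in> quadric_subspaces 1 Q \<and> P' \<subseteq> l"
      then have sP': "vec.subspace P'" "vec.dim P' = 1" by (auto simp: quadric_subspaces_def)
      have "P' \<subseteq> P" using P' sing by (auto simp: quadric_subspaces_def P_iff)
      then show "P' = P"
        using subspace_psubset_dim[OF sP'(1), of P] dP sP' by (auto simp: P_def)
    qed
    then show "tangent_line Q l" using sl dl by (simp add: tangent_line_def)
  qed
  have lin: "Vector_Spaces.linear (*s) (*s) p"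
    unfolding Vector_Spaces.linear_iff
    by (intro conjI allI vec.vector_space_axioms p_add p_scale)
  have "nucleus_projection Q f p"
    unfolding nucleus_projection_def using lin nuc pf p_surj by (auto simp: surj_def) metis
  with par show thesis by (rule that)
qed

text \<open>The count for a class is proved with whichever quadric and projection produced that
  class. The vanishing statements need only one fixed pair: a vector that sums to zero on all
  symplectic classes does so on the images of the classes of this one quadric, and it is pulled back
  there.\<close>

lemma equivalence_symplectic:
  fixes f :: "'a::{field,finite}^'m::finite \<Rightarrow> 'a^'m \<Rightarrow> 'a"
  assumes f: "type_III d (Symplectic f)" and L: "L \<subseteq> generators d (Symplectic f)"
  defines "G \<equiv> generators d (Symplectic f)" and "H \<equiv> hyperbolic_classes d (Symplectic f)"
  shows "(char_vec G L \<in> mat_image G H (mat_transpose incidence_matrix) \<longleftrightarrow>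
      char_vec G L \<in> orth_complement G (mat_kernel H G incidence_matrix)) \<and>
    (char_vec G L \<in> orth_complement G (mat_kernel H G incidence_matrix) \<longleftrightarrow> cameron_liebler d (Symplectic f) L)"
proof -
  have d: "odd d" and two: "(2 :: 'a) = 0" and m: "CARD('m) = 2 * d" and sf: "symplectic_form f"
    using f even_card_field_char_2 by auto
  have d0: "0 < d" using d by (cases d) auto
  have np: "nucleus_proj Q d f p" if "parabolic d Q" "nucleus_projection Q f p"
    for Q :: "'a^'m option \<Rightarrow> 'a" and p
  proof -
    interpret parabolic_quadric Q d by (rule parabolic_quadric[OF that(1) d0])
    show ?thesis using that(2) square_surj_char_2[OF two] by unfold_locales auto
  qed
  obtain Q :: "'a^'m option \<Rightarrow> 'a" and p where Q: "parabolic d Q" "nucleus_projection Q f p"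
    using symplectic_lift[OF two sf m] by metis
  interpret nucleus_proj Q d f p by (rule np[OF Q])
  have classE: "\<exists>(Q' :: 'a^'m option \<Rightarrow> 'a) p' C'. nucleus_proj Q' d f p' \<and> C' \<in> quadric_hyperbolic_classes d Q' \<and> C = (\<lambda>\<pi>. p' ` \<pi>) ` C'"
    if "C \<in> symplectic_hyperbolic_classes d f" for C
    using that np unfolding symplectic_hyperbolic_classes_def by blast
  have classI: "(\<lambda>\<pi>. p ` \<pi>) ` C \<in> symplectic_hyperbolic_classes d f"
    if "C \<in> quadric_hyperbolic_classes d Q" for C
    using that Q unfolding symplectic_hyperbolic_classes_def by blast
  have lift_zero: "(\<Sum>\<pi>\<in>C. w (p ` \<pi>)) = 0"
    if w: "\<And>C. C \<in> symplectic_hyperbolic_classes d f \<Longrightarrow> sum w C = 0"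
      and C: "C \<in> quadric_hyperbolic_classes d Q" for w :: "('a^'m) set \<Rightarrow> real" and C
    using w[OF classI[OF C]] sum_image_gens[OF class_subset[OF C], of w] by simp
  show ?thesis
    unfolding G_def H_def
  proof (rule equivalence_from_counts[OF d0 L], unfold generators.simps hyperbolic_classes.simps)
    fix C assume C: "C \<in> symplectic_hyperbolic_classes d f"
    obtain Q' :: "'a^'m option \<Rightarrow> 'a" and p' C' where
      C': "nucleus_proj Q' d f p'" "C' \<in> quadric_hyperbolic_classes d Q'" "C = (\<lambda>\<pi>. p' ` \<pi>) ` C'"
      using classE[OF C] by (elim exE conjE) (rule that)
    interpret n: nucleus_proj Q' d f p' by (rule C'(1))
    have sub: "C' \<subseteq> n.gens" by (rule n.class_subset[OF C'(2)])
    then show "C \<subseteq> isotropic_subspaces d f" unfolding C'(3) n.isotropic_eq by (rule image_mono)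
    fix \<pi> assume "\<pi> \<in> isotropic_subspaces d f"
    then obtain \<pi>' where \<pi>': "\<pi>' \<in> n.gens" "\<pi> = p' ` \<pi>'" unfolding n.isotropic_eq by blast
    have "\<pi> \<in> C \<longleftrightarrow> \<pi>' \<in> C'"
      unfolding C'(3) \<pi>'(2) using inj_on_image_mem_iff[OF n.inj_on_gens \<pi>'(1) sub] .
    then show "card {\<tau> \<in> C. \<pi> \<inter> \<tau> = {0}} = (if \<pi> \<in> C then 0 else CARD('a) ^ (d choose 2))"
      using n.card_disjoint_class[OF d C'(2) \<pi>'(1)]
      by (simp only: C'(3) \<pi>'(2) n.card_image_disjoint[OF \<pi>'(1) sub])
  next
    fix \<pi> assume "\<pi> \<in> isotropic_subspaces d f"
    then obtain \<pi>' where \<pi>': "\<pi>' \<in> gens" "\<pi> = p ` \<pi>'" unfolding isotropic_eq by blast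
    show "card {\<tau> \<in> isotropic_subspaces d f. \<pi> \<inter> \<tau> = {0}} = CARD('a) ^ (d choose 2) * CARD('a) ^ d"
      unfolding isotropic_eq \<pi>'(2) card_image_disjoint[OF \<pi>'(1) subset_refl]
      using card_disjoint[OF \<pi>'(1)] by (simp only: Int_commute)
  next
    assume "isotropic_subspaces d f \<noteq> {}"
    then have "gens \<noteq> {}" unfolding isotropic_eq by simp
    then show "card (isotropic_subspaces d f) = (\<Prod>i<d. CARD('a) ^ (i + 1) + 1)"
      unfolding isotropic_eq card_image[OF inj_on_gens] by (rule card_gens)
  next
    fix w :: "('a^'m) set \<Rightarrow> real"
    assume w: "\<And>C. C \<in> symplectic_hyperbolic_classes d f \<Longrightarrow> sum w C = 0"
    show "sum w (isotropic_subspaces d f) = 0"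
      unfolding isotropic_eq sum_image_gens[OF subset_refl]
      by (rule sum_gens_zero) (rule lift_zero[OF w])
  next
    fix w :: "('a^'m) set \<Rightarrow> real" and \<pi>
    assume w: "\<And>C. C \<in> symplectic_hyperbolic_classes d f \<Longrightarrow> sum w C = 0"
      and eig: "\<And>\<pi>. \<pi> \<in> isotropic_subspaces d f \<Longrightarrow>
        (\<Sum>\<tau> | \<tau> \<in> isotropic_subspaces d f \<and> \<tau> \<inter> \<pi> = {0}. w \<tau>) = - (real CARD('a) ^ (d choose 2) * w \<pi>)"
      and \<pi>: "\<pi> \<in> isotropic_subspaces d f"
    obtain \<pi>' where \<pi>': "\<pi>' \<in> gens" "\<pi> = p ` \<pi>'" using \<pi> unfolding isotropic_eq by blast
    have "w (p ` \<pi>') = 0"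
    proof (rule eigenvector_orthogonal_classes_zero[OF lift_zero[OF w] _ \<pi>'(1)])
      fix \<sigma> assume \<sigma>: "\<sigma> \<in> gens"
      have "{\<tau> \<in> isotropic_subspaces d f. \<tau> \<inter> p ` \<sigma> = {0}} = (\<lambda>\<pi>. p ` \<pi>) ` {T \<in> gens. T \<inter> \<sigma> = {0}}"
        (is "?A = ?h ` ?B")
      proof (rule set_eqI)
        fix x
        have "x \<in> ?A \<longleftrightarrow> (\<exists>\<tau>\<in>gens. x = p ` \<tau> \<and> p ` \<tau> \<inter> p ` \<sigma> = {0})"
          unfolding isotropic_eq by auto
        also have "\<dots> \<longleftrightarrow> (\<exists>\<tau>\<in>gens. x = p ` \<tau> \<and> \<tau> \<inter> \<sigma> = {0})"
          by (intro bex_cong refl conj_cong image_disjoint \<sigma>)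
        also have "\<dots> \<longleftrightarrow> x \<in> ?h ` ?B" by auto
        finally show "x \<in> ?A \<longleftrightarrow> x \<in> ?h ` ?B" .
      qed
      then have "(\<Sum>T | T \<in> gens \<and> T \<inter> \<sigma> = {0}. w (p ` T)) =
        (\<Sum>\<tau> | \<tau> \<in> isotropic_subspaces d f \<and> \<tau> \<inter> p ` \<sigma> = {0}. w \<tau>)"
        using sum_image_gens[of ?B w] by simp
      also have "\<dots> = - (real CARD('a) ^ (d choose 2) * w (p ` \<sigma>))"
        by (rule eig) (rule image_gen[OF \<sigma>])
      finally show "(\<Sum>T | T \<in> gens \<and> T \<inter> \<sigma> = {0}. w (p ` T)) =
        - (real CARD('a) ^ (d choose 2) * w (p ` \<sigma>))" .
    qed
    then show "w \<pi> = 0" by (simp only: \<pi>'(2))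
  qed
qed

theorem theorem3p26:
  fixes P :: "('a::{field,finite}, 'n::finite) polar_space"
    and d :: nat
    and L :: "('a^'n) set set"
  assumes "type_III d P"
    and "L \<subseteq> generators d P"
  defines "G \<equiv> generators d P"
    and "H \<equiv> hyperbolic_classes d P"
    and "B \<equiv> (incidence_matrix :: ('a^'n) set set \<Rightarrow> ('a^'n) set \<Rightarrow> real)"
    and "chi \<equiv> char_vec (generators d P) L"
  shows "(chi \<in> mat_image G H (mat_transpose B) \<longleftrightarrow>
            chi \<in> orth_complement G (mat_kernel H G B)) \<and>
         (chi \<in> orth_complement G (mat_kernel H G B) \<longleftrightarrow> cameron_liebler d P L)"
proof (cases P)
  case (Parabolic Q)
  then show ?thesis
    unfolding G_def H_def B_def chi_def
    using assms(1,2) equivalence_parabolic[of d Q L] by simp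
next
  case (Symplectic f)
  then show ?thesis
    unfolding G_def H_def B_def chi_def
    using assms(1,2) equivalence_symplectic[of d f L] by simp
qed

end
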